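(* For every $n\ge 3$, the invariants $tb$ and $rot$ do not determine the Legendrian class of a topologically planar $n\theta$-graph: there exist two topologically planar Legendrian $n\theta$-graphs $G$ and $G'$ in $(\mathbb{R}^3,\xi_{std})$ which, for suitable orderings and orientations of their cycles, satisfy $tb(G)=tb(G')$ and $rot(G)=rot(G')$, but which are not Legendrian isotopic.
   Context: $\xi_{std}=\ker(dz-y\,dx)$ on $\mathbb{R}^3$. A spatial graph is Legendrian if all its edges are Legendrian curves (tangent to $\xi_{std}$) that are non-tangent to each other at the vertices; more precisely, if all edges around a vertex are oriented outward, no two tangent vectors at the vertex coincide, but two may have the same direction with opposite orientations. An $n\theta$-graph is a graph with two vertices and $n$ edges, each joining the two vertices. A spatial graph is topologically planar if it is ambient isotopic to a planar embedding. Two Legendrian graphs are Legendrian isotopic (have the same Legendrian class) if they are isotopic through Legendrian graphs. For a Legendrian graph $G$ with a fixed order on its cycles, $tb(G)$ is the ordered list of the Thurston-Bennequin numbers of the cycles; with a fixed order and orientations on the cycles, $rot(G)$ is the ordered list of their rotation numbers. For a (piecewise smooth) Legendrian cycle $\mathcal{C}$ these are computed from the front projection (projection to the $xz$-plane) by $tb(\mathcal{C})=w(\mathcal{C})-\frac12\mathrm{cusps}(\mathcal{C})$ and $rot(\mathcal{C})=\frac12(\downarrow\!\mathrm{cusps}(\mathcal{C})-\uparrow\!\mathrm{cusps}(\mathcal{C}))$, where $w$ is the writhe, and cusps are counted in total, traversed downward, and traversed upward respectively; a vertex at which the two edges of $\mathcal{C}$ lie on the same side counts as a cusp. *)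

theory Defs
  imports "HOL-Analysis.Analysis"
begin

text \<open>
  The coordinates \<open>x\<close>, \<open>y\<close>, \<open>z\<close> of a point \<open>p :: real^3\<close> are \<open>p $ 1\<close>, \<open>p $ 2\<close>, \<open>p $ 3\<close>.
  All curves are parametrised by the unit interval; derivatives at its end points are one-sided,
  so values of a curve outside the unit interval never matter.
\<close>

definition vel :: "(real \<Rightarrow> real^3) \<Rightarrow> real \<Rightarrow> real^3" where
  "vel a t = vector_derivative a (at t within {0..1})"

definition smooth_curve :: "(real \<Rightarrow> real^3) \<Rightarrow> bool" where
  "smooth_curve a \<longleftrightarrow> (\<exists>D :: nat \<Rightarrow> real \<Rightarrow> real^3.
     (\<forall>t\<in>{0..1}. D 0 t = a t) \<and>
     (\<forall>k. \<forall>t\<in>{0..1}. (D k has_vector_derivative D (Suc k) t) (at t within {0..1})))"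

text \<open>In the next definition \<open>D j k\<close> is the partial derivative of order \<open>j\<close> in the deformation
  parameter \<open>s\<close> and of order \<open>k\<close> in the curve parameter \<open>t\<close>.\<close>

definition smooth_family :: "(real \<Rightarrow> real \<Rightarrow> real^3) \<Rightarrow> bool" where
  "smooth_family F \<longleftrightarrow> (\<exists>D :: nat \<Rightarrow> nat \<Rightarrow> real \<Rightarrow> real \<Rightarrow> real^3.
     (\<forall>s\<in>{0..1}. \<forall>t\<in>{0..1}. D 0 0 s t = F s t) \<and>
     (\<forall>j k. continuous_on ({0..1} \<times> {0..1}) (\<lambda>(s, t). D j k s t) \<and>
       (\<forall>s\<in>{0..1}. \<forall>t\<in>{0..1}.
          ((\<lambda>s'. D j k s' t) has_vector_derivative D (Suc j) k s t) (at s within {0..1}) \<and>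
          ((\<lambda>t'. D j k s t') has_vector_derivative D j (Suc k) s t) (at t within {0..1}))))"


section \<open>Legendrian theta-graphs\<close>

text \<open>The plane at \<open>p\<close> of the contact structure \<open>ker (dz - y dx)\<close>.\<close>

definition xi_std :: "real^3 \<Rightarrow> (real^3) set" where
  "xi_std p = {u. u $ 3 - p $ 2 * u $ 1 = 0}"

definition legendrian_arc :: "(real \<Rightarrow> real^3) \<Rightarrow> bool" where
  "legendrian_arc a \<longleftrightarrow> arc a \<and> smooth_curve a \<and>
     (\<forall>t\<in>{0..1}. vel a t \<noteq> 0 \<and> vel a t \<in> xi_std (a t))"

text \<open>A graph with \<open>n\<close> edges joining two vertices is given by parametrisations \<open>G i\<close>, \<open>i < n\<close>, of
  its edges, all running from the same vertex \<open>v\<close> to the other vertex \<open>w\<close>. The outward unit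
  tangent vector of edge \<open>i\<close> is \<open>sgn (vel (G i) 0)\<close> at \<open>v\<close> and \<open>sgn (- vel (G i) 1)\<close> at \<open>w\<close>.\<close>

type_synonym theta = "nat \<Rightarrow> real \<Rightarrow> real^3"

definition legendrian_theta :: "nat \<Rightarrow> theta \<Rightarrow> bool" where
  "legendrian_theta n G \<longleftrightarrow> (\<exists>v w. v \<noteq> w \<and>
     (\<forall>i<n. legendrian_arc (G i) \<and> pathstart (G i) = v \<and> pathfinish (G i) = w) \<and>
     (\<forall>i<n. \<forall>j<n. i \<noteq> j \<longrightarrow>
        path_image (G i) \<inter> path_image (G j) = {v, w} \<and>
        sgn (vel (G i) 0) \<noteq> sgn (vel (G j) 0) \<and>
        sgn (- vel (G i) 1) \<noteq> sgn (- vel (G j) 1)))"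

definition support :: "nat \<Rightarrow> theta \<Rightarrow> (real^3) set" where
  "support n G = (\<Union>i<n. path_image (G i))"

text \<open>The spatial graph underlying a parametrised one: each edge, as a point set, together with its
  set of end points. This forgets the parametrisations, the numbering of the edges and the
  order of the two vertices.\<close>

definition spatial_edges :: "nat \<Rightarrow> theta \<Rightarrow> ((real^3) set \<times> (real^3) set) set" where
  "spatial_edges n G = (\<lambda>i. ({pathstart (G i), pathfinish (G i)}, path_image (G i))) ` {..<n}"

definition legendrian_isotopic :: "nat \<Rightarrow> theta \<Rightarrow> theta \<Rightarrow> bool" where
  "legendrian_isotopic n G G' \<longleftrightarrow> (\<exists>H :: real \<Rightarrow> theta.
     (\<forall>s\<in>{0..1}. legendrian_theta n (H s)) \<and>
     (\<forall>i<n. smooth_family (\<lambda>s. H s i)) \<and>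
     spatial_edges n (H 0) = spatial_edges n G \<and>
     spatial_edges n (H 1) = spatial_edges n G')"


section \<open>Topological planarity\<close>

definition ambient_isotopic :: "(real^3) set \<Rightarrow> (real^3) set \<Rightarrow> bool" where
  "ambient_isotopic A B \<longleftrightarrow> (\<exists>H :: real \<Rightarrow> real^3 \<Rightarrow> real^3.
     continuous_on ({0..1} \<times> UNIV) (\<lambda>(s, p). H s p) \<and>
     (\<forall>s\<in>{0..1}. \<exists>K. homeomorphism UNIV UNIV (H s) K) \<and>
     (\<forall>p. H 0 p = p) \<and> H 1 ` A = B)"

text \<open>An ambient isotopy carries an embedded graph to an embedded graph, so for the support of a
  graph the set \<open>P\<close> below is automatically an embedding of that graph in a plane.\<close>

definition topologically_planar :: "(real^3) set \<Rightarrow> bool" where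
  "topologically_planar A \<longleftrightarrow>
     (\<exists>P a b. a \<noteq> 0 \<and> P \<subseteq> {p. a \<bullet> p = b} \<and> ambient_isotopic A P)"


section \<open>Generic front projections\<close>

text \<open>A front is generic if no edge is vertical (in the \<open>y\<close>-direction) at a vertex, all cusps in the
  interior of edges are semicubical, and the only multiple points are finitely many double points
  away from vertices and cusps. Such double points are transverse: \<open>y\<close> is the slope \<open>dz/dx\<close>
  of the front, and distinct points with the same front have different \<open>y\<close>.\<close>

definition same_front :: "real^3 \<Rightarrow> real^3 \<Rightarrow> bool" where
  "same_front p q \<longleftrightarrow> p $ 1 = q $ 1 \<and> p $ 3 = q $ 3"

definition generic_front :: "nat \<Rightarrow> theta \<Rightarrow> bool" where
  "generic_front n G \<longleftrightarrow>
     (\<forall>i<n. vel (G i) 0 $ 1 \<noteq> 0 \<and> vel (G i) 1 $ 1 \<noteq> 0 \<and>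
        (\<forall>t\<in>{0<..<1}. vel (G i) t $ 1 = 0 \<longrightarrow> vel (vel (G i)) t $ 1 \<noteq> 0)) \<and>
     (\<forall>i<n. \<forall>j<n. \<forall>s\<in>{0..1}. \<forall>t\<in>{0..1}.
        G i s \<noteq> G j t \<and> same_front (G i s) (G j t) \<longrightarrow>
          s \<in> {0<..<1} \<and> t \<in> {0<..<1} \<and> vel (G i) s $ 1 \<noteq> 0 \<and> vel (G j) t $ 1 \<noteq> 0) \<and>
     (\<forall>p\<in>support n G. \<forall>q\<in>support n G. \<forall>r\<in>support n G.
        same_front p q \<and> same_front q r \<longrightarrow> p = q \<or> q = r \<or> p = r) \<and>
     finite {(p, q). p \<in> support n G \<and> q \<in> support n G \<and> p \<noteq> q \<and> same_front p q}"


section \<open>Thurston-Bennequin and rotation numbers of piecewise smooth cycles\<close>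

text \<open>An oriented cycle is a list of arcs, each ending where the cyclically next one starts. The
  pair \<open>(k, t)\<close> stands for the point with parameter \<open>t\<close> on the \<open>k\<close>-th arc.\<close>

type_synonym cycle = "(real \<Rightarrow> real^3) list"

definition next_arc :: "cycle \<Rightarrow> nat \<Rightarrow> real \<Rightarrow> real^3" where
  "next_arc C k = C ! (Suc k mod length C)"

text \<open>A crossing is recorded once, with its over-strand first. In the \<open>xz\<close>-plane with \<open>x\<close> pointing to
  the right and \<open>z\<close> upwards, the positive \<open>y\<close>-axis points away from the viewer, so the strand with
  the smaller \<open>y\<close> is the over-strand.\<close>

definition crossings :: "cycle \<Rightarrow> ((nat \<times> real) \<times> (nat \<times> real)) set" where
  "crossings C = {((k, s), (l, t)). k < length C \<and> l < length C \<and>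
     s \<in> {0<..<1} \<and> t \<in> {0<..<1} \<and>
     same_front ((C ! k) s) ((C ! l) t) \<and> (C ! k) s $ 2 < (C ! l) t $ 2}"

text \<open>A crossing is positive if the direction of the over-strand is turned counterclockwise, by
  less than a half turn, to that of the under-strand.\<close>

definition crossing_sign :: "cycle \<Rightarrow> (nat \<times> real) \<times> (nat \<times> real) \<Rightarrow> real" where
  "crossing_sign C = (\<lambda>((k, s), (l, t)).
     let u = vel (C ! k) s; v = vel (C ! l) t in sgn (u $ 1 * v $ 3 - u $ 3 * v $ 1))"

definition writhe :: "cycle \<Rightarrow> real" where
  "writhe C = (\<Sum>c\<in>crossings C. crossing_sign C c)"

text \<open>Cusps in the interior of an arc have parameter \<open>t < 1\<close>. The parameter \<open>t = 1\<close> stands for the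
  vertex between an arc and the next one; it is a cusp if both arcs lie on the same side of it,
  that is, if the \<open>x\<close>-direction of travel is reversed there.\<close>

definition cusps :: "cycle \<Rightarrow> (nat \<times> real) set" where
  "cusps C = {(k, t). k < length C \<and>
     (t \<in> {0<..<1} \<and> vel (C ! k) t $ 1 = 0 \<or>
      t = 1 \<and> vel (C ! k) 1 $ 1 * vel (next_arc C k) 0 $ 1 < 0)}"

text \<open>A cusp is traversed downwards if, close to it, the front of the incoming branch lies above
  that of the outgoing branch. Here the incoming branch is \<open>a\<close> just before parameter \<open>s0\<close> and the
  outgoing one is \<open>b\<close> just after \<open>t0\<close>.\<close>

definition branch_above ::
    "(real \<Rightarrow> real^3) \<Rightarrow> real \<Rightarrow> (real \<Rightarrow> real^3) \<Rightarrow> real \<Rightarrow> bool" where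
  "branch_above a s0 b t0 \<longleftrightarrow> (\<exists>d>0. \<forall>s\<in>{0<..<1}. \<forall>t\<in>{0<..<1}.
     s0 - d < s \<and> s < s0 \<and> t0 < t \<and> t < t0 + d \<and> a s $ 1 = b t $ 1 \<longrightarrow> a s $ 3 > b t $ 3)"

definition branch_below ::
    "(real \<Rightarrow> real^3) \<Rightarrow> real \<Rightarrow> (real \<Rightarrow> real^3) \<Rightarrow> real \<Rightarrow> bool" where
  "branch_below a s0 b t0 \<longleftrightarrow> (\<exists>d>0. \<forall>s\<in>{0<..<1}. \<forall>t\<in>{0<..<1}.
     s0 - d < s \<and> s < s0 \<and> t0 < t \<and> t < t0 + d \<and> a s $ 1 = b t $ 1 \<longrightarrow> a s $ 3 < b t $ 3)"

definition down_cusps :: "cycle \<Rightarrow> (nat \<times> real) set" where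
  "down_cusps C = {(k, t) \<in> cusps C.
     if t < 1 then branch_above (C ! k) t (C ! k) t else branch_above (C ! k) 1 (next_arc C k) 0}"

definition up_cusps :: "cycle \<Rightarrow> (nat \<times> real) set" where
  "up_cusps C = {(k, t) \<in> cusps C.
     if t < 1 then branch_below (C ! k) t (C ! k) t else branch_below (C ! k) 1 (next_arc C k) 0}"

definition tb :: "cycle \<Rightarrow> real" where
  "tb C = writhe C - real (card (cusps C)) / 2"

definition rot :: "cycle \<Rightarrow> real" where
  "rot C = (real (card (down_cusps C)) - real (card (up_cusps C))) / 2"


section \<open>The cycles of a theta-graph\<close>

text \<open>The oriented cycle \<open>(i, j)\<close> follows edge \<open>i\<close> forwards and then edge \<open>j\<close> backwards;
  \<open>(j, i)\<close> is the same cycle with the opposite orientation.\<close>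

definition theta_cycle :: "theta \<Rightarrow> nat \<times> nat \<Rightarrow> cycle" where
  "theta_cycle G = (\<lambda>(i, j). [G i, reversepath (G j)])"

text \<open>A list containing each cycle exactly once, with one of its two orientations.\<close>

definition oriented_cycle_order :: "nat \<Rightarrow> (nat \<times> nat) list \<Rightarrow> bool" where
  "oriented_cycle_order n cs \<longleftrightarrow>
     distinct (map (\<lambda>(i, j). {i, j}) cs) \<and>
     set (map (\<lambda>(i, j). {i, j}) cs) = {{i, j} | i j. i < n \<and> j < n \<and> i \<noteq> j}"

definition tb_list :: "theta \<Rightarrow> (nat \<times> nat) list \<Rightarrow> real list" where
  "tb_list G cs = map (\<lambda>c. tb (theta_cycle G c)) cs"

definition rot_list :: "theta \<Rightarrow> (nat \<times> nat) list \<Rightarrow> real list" where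
  "rot_list G cs = map (\<lambda>c. rot (theta_cycle G c)) cs"

end

theory Submission
  imports Defs "HOL-Computational_Algebra.Polynomial"
begin

text \<open>
  Let every edge be a Legendrian lift \<open>t \<mapsto> (t, f\<^sub>i' t, f\<^sub>i t)\<close> of the graph of a function, where all
  \<open>f\<^sub>i\<close> have the same value and slope at \<open>0\<close> and at \<open>1\<close>. Such a graph has no cusp inside an edge, and
  every cycle has one cusp at each vertex. At a crossing of two edges their cycle runs
  through the two strands in opposite \<open>x\<close>-directions, so all its crossings are negative, and \<open>tb\<close> is minus
  the number of crossings minus \<open>1\<close>. If edge \<open>i\<close> starts below edge \<open>j\<close> and ends above it, the cycle
  \<open>(i, j)\<close> has two downward cusps and \<open>rot = 1\<close>. In both graphs the edges are numbered upwards at the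
  left vertex and downwards at the right one, so that every \<open>rot\<close> is \<open>1\<close> for \<open>i < j\<close>. All pairs of edges
  cross once, except for a single pair that crosses three times: the two extreme edges \<open>{0, n - 1}\<close>
  in the first graph, the neighbours \<open>{0, 1}\<close> in the second. The lists of \<open>tb\<close> and \<open>rot\<close> agree if the
  exceptional cycle comes first.

  A Legendrian isotopy would have to match extreme edges with extreme edges. At a vertex
  two edges never have the same tangent direction, so the number of full turns between their tangents
  at that vertex, measured with continuous angles along the edges, does not change during the isotopy
  (\<open>relative_winding_constant\<close>). The difference of these numbers at the two vertices shows which of the
  two edges is the lower one at the left vertex (\<open>relative_winding_end\<close>), up to exchanging the
  vertices. So the matching of the edges preserves or reverses their numbering, and the cycle of
  the extreme edges goes to the cycle of the extreme edges; but this cycle has \<open>tb = -4\<close> in the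
  first graph and \<open>tb = -2\<close> in the second.

  It remains to see that \<open>tb\<close> of a cycle is invariant. It is the linking number of the cycle with its
  push-off in the \<open>z\<close>-direction, that is, the degree of the difference map from a torus to the
  complement of the origin. Here the degree is an integral of a closed two-form over the four squares that
  make up the torus (two edges for each factor); Stokes' theorem on a cube gives the invariance, because the
  boundary terms of the squares cancel (\<open>push_off_linking_homotopy_invariant\<close>). A short push-off stays
  disjoint from the cycle during the whole isotopy since the cycle is embedded and its tangents at each
  point project injectively to the \<open>xy\<close>-plane (\<open>no_short_chords_arc\<close>, \<open>no_short_chords_between\<close>).
  For lifts of functions the front of one edge can be deformed to a horizontal line. The double
  integrals then reduce to integrals over one variable, which count the intervals between consecutive
  crossings (\<open>push_off_linking_of_traces\<close>, \<open>hump_integral_count\<close>).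

  Topologically the graph is a braid whose strands are brought together at both ends. Any braid can be
  combed by an isotopy of the plane that follows its strands (\<open>isotopy_tracking_points\<close>). Shrinking
  this isotopy towards the two vertices gives a homeomorphism of space at bounded distance from the
  identity that makes the graph planar, and such a homeomorphism is isotopic to the identity by the
  Alexander trick.
\<close>


section \<open>Legendrian lifts of function graphs\<close>

definition pt :: "real \<Rightarrow> real \<Rightarrow> real \<Rightarrow> real^3" where
  "pt x y z = vector [x, y, z]"

lemma pt_nth [simp]: "pt x y z $ 1 = x" "pt x y z $ 2 = y" "pt x y z $ 3 = z"
  by (simp_all add: pt_def)

lemma vec3_eq_iff: "p = q \<longleftrightarrow> p $ 1 = q $ 1 \<and> p $ 2 = q $ 2 \<and> p $ 3 = q $ 3" for p q :: "real^3"
  by (simp add: vec_eq_iff forall_3)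

lemma pt_conv_axis: "pt x y z = x *\<^sub>R axis 1 1 + y *\<^sub>R axis 2 1 + z *\<^sub>R axis 3 1"
  by (simp add: vec3_eq_iff axis_def)

lemma has_vector_derivative_pt:
  assumes "(f has_real_derivative f') (at t within S)" "(g has_real_derivative g') (at t within S)"
    "(h has_real_derivative h') (at t within S)"
  shows "((\<lambda>t. pt (f t) (g t) (h t)) has_vector_derivative pt f' g' h') (at t within S)"
proof -
  have *: "((\<lambda>t. u t *\<^sub>R a) has_vector_derivative u' *\<^sub>R a) (at t within S)"
    if "(u has_real_derivative u') (at t within S)" for u u' and a :: "real^3"
    using has_vector_derivative_scaleR[OF that has_vector_derivative_const, of a] by simp
  show ?thesis unfolding pt_conv_axis by (intro has_vector_derivative_add * assms)
qed

lemma has_real_derivative_component: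
  "(f has_vector_derivative f') (at t within S) \<Longrightarrow> ((\<lambda>t. f t $ i) has_real_derivative f' $ i) (at t within S)"
  unfolding has_real_derivative_iff_has_vector_derivative
  by (rule bounded_linear.has_vector_derivative[OF bounded_linear_vec_nth])

lemma continuous_on_pt [continuous_intros]:
  "continuous_on S f \<Longrightarrow> continuous_on S g \<Longrightarrow> continuous_on S h \<Longrightarrow> continuous_on S (\<lambda>t. pt (f t) (g t) (h t))"
  unfolding pt_conv_axis by (intro continuous_intros)

lemma vel_eqI: "t \<in> {0..1} \<Longrightarrow> (a has_vector_derivative v) (at t within {0..1}) \<Longrightarrow> vel a t = v"
  unfolding vel_def by (rule vector_derivative_within_closed_interval) auto

text \<open>
  The Legendrian curve over the graph of \<open>f\<close>: the contact condition makes \<open>y\<close> the slope.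
\<close>

definition front_lift :: "real poly \<Rightarrow> real \<Rightarrow> real^3" where
  "front_lift f t = pt t (poly (pderiv f) t) (poly f t)"

lemma front_lift_nth [simp]: "front_lift f t $ 1 = t" "front_lift f t $ 2 = poly (pderiv f) t"
    "front_lift f t $ 3 = poly f t"
  by (simp_all add: front_lift_def)

lemma front_lift_has_vector_derivative:
  "(front_lift f has_vector_derivative pt 1 (poly (pderiv (pderiv f)) t) (poly (pderiv f) t)) (at t within S)"
  unfolding front_lift_def[abs_def]
  by (intro has_vector_derivative_pt) (auto intro!: derivative_eq_intros has_field_derivative_at_within[OF poly_DERIV])

lemma vel_front_lift: "t \<in> {0..1} \<Longrightarrow> vel (front_lift f) t = pt 1 (poly (pderiv (pderiv f)) t) (poly (pderiv f) t)"
  by (rule vel_eqI[OF _ front_lift_has_vector_derivative])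

lemma smooth_curve_front_lift: "smooth_curve (front_lift f)"
proof -
  define X :: "real poly" where "X = [:0, 1:]"
  define D where "D k t = pt (poly ((pderiv ^^ k) X) t) (poly ((pderiv ^^ Suc k) f) t) (poly ((pderiv ^^ k) f) t)" for k t
  have "(D k has_vector_derivative D (Suc k) t) (at t within {0..1})" for k t
    unfolding D_def by (intro has_vector_derivative_pt) (simp_all add: has_field_derivative_at_within[OF poly_DERIV])
  moreover have "D 0 t = front_lift f t" for t by (simp add: D_def X_def front_lift_def)
  ultimately show ?thesis unfolding smooth_curve_def by blast
qed

lemma legendrian_arc_front_lift: "legendrian_arc (front_lift f)"
proof -
  have "arc (front_lift f)"
    unfolding arc_def path_def
  proof
    show "continuous_on {0..1} (front_lift f)"
      unfolding front_lift_def[abs_def] by (intro continuous_intros)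
    show "inj_on (front_lift f) {0..1}" by (auto simp: inj_on_def vec3_eq_iff)
  qed
  moreover have "vel (front_lift f) t \<noteq> 0 \<and> vel (front_lift f) t \<in> xi_std (front_lift f t)" if "t \<in> {0..1}" for t
    using vel_front_lift[OF that] by (auto simp: vec3_eq_iff xi_std_def)
  ultimately show ?thesis using smooth_curve_front_lift unfolding legendrian_arc_def by blast
qed

text \<open>
  Multiplying by this weight makes all fronts agree to first order at both ends, while the second
  derivative there, which decides the tangent direction of the lift, is twice the value of the other factor.
\<close>

definition end_weight :: "real poly" where "end_weight = [:0, 1, -1:]\<^sup>2"

lemma poly_end_weight: "poly end_weight x = (x * (1 - x))\<^sup>2"
  by (simp add: end_weight_def power2_eq_square algebra_simps)

lemma poly_pderiv_end_weight: "poly (pderiv end_weight) x = 2 * (x * (1 - x)) * (1 - 2 * x)"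
  by (simp add: end_weight_def power2_eq_square pderiv_mult pderiv_pCons algebra_simps)

lemma poly_pderiv2_end_weight: "poly (pderiv (pderiv end_weight)) x = 2 - 12 * x + 12 * x\<^sup>2"
  by (simp add: end_weight_def power2_eq_square pderiv_mult pderiv_add pderiv_pCons algebra_simps)

definition braid_theta :: "(nat \<Rightarrow> real poly) \<Rightarrow> theta" where
  "braid_theta h i = front_lift (end_weight * h i)"

lemma poly_pderiv_weighted: 
  "poly (pderiv (end_weight * h)) x = 2 * (x * (1 - x)) * (1 - 2 * x) * poly h x + (x * (1 - x))\<^sup>2 * poly (pderiv h) x"
  by (simp add: pderiv_mult poly_end_weight poly_pderiv_end_weight algebra_simps)

lemma poly_pderiv2_weighted_ends:
  "x = 0 \<or> x = 1 \<Longrightarrow> poly (pderiv (pderiv (end_weight * h))) x = 2 * poly h x"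
  by (auto simp: pderiv_mult pderiv_add poly_end_weight poly_pderiv_end_weight poly_pderiv2_end_weight)

lemma braid_theta_start: "braid_theta h i 0 = 0"
  by (simp add: braid_theta_def vec3_eq_iff poly_pderiv_weighted poly_end_weight)

lemma braid_theta_finish: "braid_theta h i 1 = pt 1 0 0"
  by (simp add: braid_theta_def vec3_eq_iff poly_pderiv_weighted poly_end_weight)

lemma sgn_eq_iff_parallel: "(u :: 'a :: real_normed_vector) \<noteq> 0 \<Longrightarrow> sgn u = sgn v \<Longrightarrow> \<exists>c>0. v = c *\<^sub>R u"
proof -
  assume u: "u \<noteq> 0" and e: "sgn u = sgn v"
  then have v: "v \<noteq> 0" by (metis sgn_zero_iff)
  have "v = norm v *\<^sub>R sgn v" using v by (simp add: sgn_div_norm)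
  also have "\<dots> = (norm v / norm u) *\<^sub>R u" unfolding e[symmetric] by (simp add: sgn_div_norm divide_inverse)
  finally show ?thesis using u v by (intro exI[of _ "norm v / norm u"]) auto
qed

lemma vel_reversepath_lift:
  assumes "t \<in> {0..1}"
  shows "vel (reversepath (front_lift f)) t = - vel (front_lift f) (1 - t)"
proof -
  have "((\<lambda>t. front_lift f (1 - t)) has_vector_derivative
      pt (-1) (- poly (pderiv (pderiv f)) (1 - t)) (- poly (pderiv f) (1 - t))) (at t within {0..1})"
    unfolding front_lift_def[abs_def]
    by (intro has_vector_derivative_pt) (auto intro!: derivative_eq_intros DERIV_chain2[OF poly_DERIV])
  from vel_eqI[OF assms this] show ?thesis
    using assms by (simp add: reversepath_def vel_front_lift vec3_eq_iff)
qed

lemma eventually_above: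
  fixes f g :: "real poly"
  assumes "poly f x < poly g x"
  obtains d where "d > 0" "\<And>y. \<bar>y - x\<bar> < d \<Longrightarrow> poly f y < poly g y"
proof -
  have "isCont (\<lambda>y. poly g y - poly f y) x" by (intro continuous_intros)
  then have "\<forall>\<^sub>F y in nhds x. 0 < poly g y - poly f y"
    using assms by (intro order_tendstoD(1)[OF tendsto_at_iff_tendsto_nhds[THEN iffD1]]) (simp_all add: isCont_def)
  then show thesis using that unfolding eventually_nhds_metric by (auto simp: dist_real_def)
qed

section \<open>Theta-graphs from arrangements of fronts\<close>

text \<open>
  The opposite orders at the two ends give all cycles the same rotation number and let the order of the
  edges be recovered from their tangents. The other two conditions make the graph embedded and its front generic.
\<close>

locale front_arrangement =
  fixes n :: nat and h :: "nat \<Rightarrow> real poly"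
  assumes left_order: "i < j \<Longrightarrow> j < n \<Longrightarrow> poly (h i) 0 < poly (h j) 0"
    and right_order: "i < j \<Longrightarrow> j < n \<Longrightarrow> poly (h j) 1 < poly (h i) 1"
    and transverse: "i < n \<Longrightarrow> j < n \<Longrightarrow> i \<noteq> j \<Longrightarrow> 0 < x \<Longrightarrow> x < 1 \<Longrightarrow> poly (h i) x = poly (h j) x \<Longrightarrow>
       poly (pderiv (h i)) x \<noteq> poly (pderiv (h j)) x"
    and no_triple: "i < n \<Longrightarrow> j < n \<Longrightarrow> k < n \<Longrightarrow> i \<noteq> j \<Longrightarrow> j \<noteq> k \<Longrightarrow> i \<noteq> k \<Longrightarrow> 0 < x \<Longrightarrow> x < 1 \<Longrightarrow>
       poly (h i) x = poly (h j) x \<Longrightarrow> poly (h j) x \<noteq> poly (h k) x"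
begin

abbreviation "G \<equiv> braid_theta h"

lemma ends_distinct:
  assumes "i < n" "j < n" "i \<noteq> j"
  shows "poly (h i) 0 \<noteq> poly (h j) 0" "poly (h i) 1 \<noteq> poly (h j) 1"
  using assms left_order[of i j] left_order[of j i] right_order[of i j] right_order[of j i]
  by (metis linorder_neqE_nat less_irrefl)+

lemma same_front_iff:
  assumes "s \<in> {0..1}" "t \<in> {0..1}"
  shows "same_front (G i s) (G j t) \<longleftrightarrow> s = t \<and> (s = 0 \<or> s = 1 \<or> poly (h i) s = poly (h j) s)"
  using assms by (auto simp: same_front_def braid_theta_def poly_end_weight)

lemma eq_iff:
  assumes "i < n" "j < n" "i \<noteq> j" "s \<in> {0..1}" "t \<in> {0..1}"
  shows "G i s = G j t \<longleftrightarrow> s = t \<and> (s = 0 \<or> s = 1)"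
proof
  assume e: "G i s = G j t"
  then have st: "s = t" by (simp add: braid_theta_def vec3_eq_iff)
  show "s = t \<and> (s = 0 \<or> s = 1)"
  proof (rule ccontr)
    assume "\<not> ?thesis"
    then have s: "0 < s" "s < 1" using st assms by auto
    have "poly (h i) s = poly (h j) s" "poly (pderiv (end_weight * h i)) s = poly (pderiv (end_weight * h j)) s"
      using e st s by (auto simp: braid_theta_def vec3_eq_iff poly_end_weight)
    then have "poly (pderiv (h i)) s = poly (pderiv (h j)) s"
      using s by (simp add: poly_pderiv_weighted)
    then show False using transverse[OF assms(1-3) s] \<open>poly (h i) s = poly (h j) s\<close> by blast
  qed
qed (auto simp: braid_theta_start braid_theta_finish)

lemma image_inter:
  assumes "i < n" "j < n" "i \<noteq> j"
  shows "path_image (G i) \<inter> path_image (G j) = {0, pt 1 0 0}"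
proof -
  have "G i 0 = G j 0" "G i 1 = G j 1" by (simp_all add: braid_theta_start braid_theta_finish)
  then show ?thesis
    unfolding path_image_def using eq_iff[OF assms]
    by (auto simp: braid_theta_start braid_theta_finish intro: image_eqI[of _ _ 0] image_eqI[of _ _ 1])
qed

text \<open>
  The tangent direction of an edge at a vertex has slope \<open>2 h\<^sub>i\<close> in the contact plane, so distinct
  end values of the \<open>h\<^sub>i\<close> keep the edges apart there.
\<close>

lemma legendrian: "legendrian_theta n G"
proof -
  have "sgn (vel (G i) 0) \<noteq> sgn (vel (G j) 0)" "sgn (- vel (G i) 1) \<noteq> sgn (- vel (G j) 1)"
    if ij: "i < n" "j < n" "i \<noteq> j" for i j
  proof -
    have *: "poly (h i) t = poly (h j) t" if t: "t = 0 \<or> t = 1" and "sgn (vel (G i) t) = sgn (vel (G j) t)" for t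
    proof -
      have v: "vel (G k) t = pt 1 (2 * poly (h k) t) (poly (pderiv (end_weight * h k)) t)" for k
        unfolding braid_theta_def using t by (subst vel_front_lift) (auto simp: poly_pderiv2_weighted_ends)
      have "vel (G i) t \<noteq> 0" by (simp add: v vec3_eq_iff)
      from sgn_eq_iff_parallel[OF this that(2)] show ?thesis by (auto simp: v vec3_eq_iff)
    qed
    show "sgn (vel (G i) 0) \<noteq> sgn (vel (G j) 0)" "sgn (- vel (G i) 1) \<noteq> sgn (- vel (G j) 1)"
      using *[of 0] *[of 1] ends_distinct[OF ij] by (auto simp: sgn_minus)
  qed
  moreover have "(0 :: real^3) \<noteq> pt 1 0 0" by (simp add: vec3_eq_iff)
  moreover have "legendrian_arc (G i)" for i unfolding braid_theta_def by (rule legendrian_arc_front_lift)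
  ultimately show ?thesis
    unfolding legendrian_theta_def
    by (intro exI[of _ 0] exI[of _ "pt 1 0 0"])
       (simp add: image_inter pathstart_def pathfinish_def braid_theta_start braid_theta_finish)
qed

lemma h_inj: "i < n \<Longrightarrow> j < n \<Longrightarrow> i \<noteq> j \<Longrightarrow> h i \<noteq> h j"
  using ends_distinct by metis

lemma finite_crossings: "i < n \<Longrightarrow> j < n \<Longrightarrow> i \<noteq> j \<Longrightarrow> finite {x. poly (h i) x = poly (h j) x}"
  using poly_roots_finite[of "h i - h j"] h_inj[of i j] by (simp)

lemma vel_x: "t \<in> {0..1} \<Longrightarrow> vel (G i) t $ 1 = 1"
  by (simp add: braid_theta_def vel_front_lift)

lemma support_point:
  assumes "p \<in> support n G" obtains i t where "i < n" "t \<in> {0..1}" "p = G i t"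
  using assms by (auto simp: support_def path_image_def)

lemma generic: "generic_front n G"
proof -
  have dbl: "s = t \<and> 0 < s \<and> s < 1 \<and> i \<noteq> j \<and> poly (h i) s = poly (h j) s"
    if "i < n" "j < n" "s \<in> {0..1}" "t \<in> {0..1}" "G i s \<noteq> G j t" "same_front (G i s) (G j t)" for i j s t
  proof -
    have *: "s = t" "s = 0 \<or> s = 1 \<or> poly (h i) s = poly (h j) s"
      using same_front_iff that by blast+
    then have "s \<noteq> 0" "s \<noteq> 1" using that(5) by (auto simp: braid_theta_start braid_theta_finish)
    then show ?thesis using * that by auto
  qed
  have 1: "s \<in> {0<..<1} \<and> t \<in> {0<..<1} \<and> vel (G i) s $ 1 \<noteq> 0 \<and> vel (G j) t $ 1 \<noteq> 0"
    if "i < n" "j < n" "s \<in> {0..1}" "t \<in> {0..1}" "G i s \<noteq> G j t \<and> same_front (G i s) (G j t)" for i j s t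
    using dbl[of i j s t] that by (auto simp: vel_x)
  have 2: "p = q \<or> q = r \<or> p = r"
    if pqr: "p \<in> support n G" "q \<in> support n G" "r \<in> support n G" and sf: "same_front p q \<and> same_front q r" for p q r
  proof (rule ccontr)
    assume ne: "\<not> ?thesis"
    obtain i s where p: "i < n" "s \<in> {0..1}" "p = G i s" using support_point[OF pqr(1)] by blast
    obtain j t where q: "j < n" "t \<in> {0..1}" "q = G j t" using support_point[OF pqr(2)] by blast
    obtain k u where r: "k < n" "u \<in> {0..1}" "r = G k u" using support_point[OF pqr(3)] by blast
    have "same_front p r" using sf by (auto simp: same_front_def)
    then have "s = t" "t = u" "0 < s" "s < 1" "i \<noteq> j" "j \<noteq> k" "i \<noteq> k" "poly (h i) s = poly (h j) s" "poly (h j) s = poly (h k) s"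
      using dbl[of i j s t] dbl[of j k t u] dbl[of i k s u] ne sf p q r by auto
    then show False using no_triple[of i j k s] p q r by blast
  qed
  have "{(p, q). p \<in> support n G \<and> q \<in> support n G \<and> p \<noteq> q \<and> same_front p q}
     \<subseteq> (\<Union>i<n. \<Union>j\<in>{..<n} - {i}. (\<lambda>x. (G i x, G j x)) ` {x. poly (h i) x = poly (h j) x})"
  proof clarify
    fix p q assume *: "p \<in> support n G" "q \<in> support n G" "p \<noteq> q" "same_front p q"
    obtain i s where p: "i < n" "s \<in> {0..1}" "p = G i s" using support_point[OF *(1)] by blast
    obtain j t where q: "j < n" "t \<in> {0..1}" "q = G j t" using support_point[OF *(2)] by blast
    have "s = t" "i \<noteq> j" "poly (h i) s = poly (h j) s" using dbl[of i j s t] * p q by auto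
    then show "(p, q) \<in> (\<Union>i<n. \<Union>j\<in>{..<n} - {i}. (\<lambda>x. (G i x, G j x)) ` {x. poly (h i) x = poly (h j) x})"
      using p q by blast
  qed
  then have 3: "finite {(p, q). p \<in> support n G \<and> q \<in> support n G \<and> p \<noteq> q \<and> same_front p q}"
    by (rule finite_subset) (intro finite_UN_I finite_imageI, auto intro: finite_crossings)
  show ?thesis
    unfolding generic_front_def using 1 2 3 by (simp add: vel_x)
qed

definition crossing_points :: "nat \<Rightarrow> nat \<Rightarrow> real set" where
  "crossing_points i j = {x. 0 < x \<and> x < 1 \<and> poly (h i) x = poly (h j) x}"

lemma vel_reversepath: "t \<in> {0..1} \<Longrightarrow> vel (reversepath (G i)) t = - vel (G i) (1 - t)"
  unfolding braid_theta_def by (rule vel_reversepath_lift)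

text \<open>
  The strand with the smaller slope is in front, and the two edges are traversed in opposite
  \<open>x\<close>-directions; this makes every crossing negative.
\<close>

lemma writhe_cycle:
  assumes ij: "i < n" "j < n" "i \<noteq> j"
  shows "writhe (theta_cycle G (i, j)) = - real (card (crossing_points i j))"
proof -
  define C where "C = theta_cycle G (i, j)"
  have C: "C = [G i, reversepath (G j)]" by (simp add: C_def theta_cycle_def)
  \<comment> \<open>\<open>\<phi>\<close> lists the over-strand first; the second arc is reversed, which gives the parameter \<open>1 - x\<close>\<close>
  define \<phi> where "\<phi> x = (if G i x $ 2 < G j x $ 2 then ((0::nat, x), (1::nat, 1 - x)) else ((1, 1 - x), (0, x)))" for x :: real
  have ne: "G i x $ 2 \<noteq> G j x $ 2" if "x \<in> crossing_points i j" for x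
  proof
    assume "G i x $ 2 = G j x $ 2"
    with that have "G i x = G j x"
      by (simp add: vec3_eq_iff crossing_points_def braid_theta_def poly_end_weight)
    then show False using eq_iff[OF ij, of x x] that by (auto simp: crossing_points_def)
  qed
  have "crossings C = \<phi> ` crossing_points i j"
  proof (intro equalityI subsetI)
    fix c assume "c \<in> crossings C"
    then obtain k s l t where c: "c = ((k, s), (l, t))" "k < 2" "l < 2" "0 < s" "s < 1" "0 < t" "t < 1"
      "same_front ((C ! k) s) ((C ! l) t)" "(C ! k) s $ 2 < (C ! l) t $ 2"
      by (auto simp: crossings_def C)
    have kl: "k = 0 \<and> l = 1 \<or> k = 1 \<and> l = 0"
    proof (rule ccontr)
      assume "\<not> ?thesis"
      then have "k = 0 \<and> l = 0 \<or> k = 1 \<and> l = 1" using c by auto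
      then have "s = t" using c same_front_iff[of s t i i] same_front_iff[of "1 - s" "1 - t" j j]
        by (auto simp: C reversepath_def)
      then show False using c \<open>k = 0 \<and> l = 0 \<or> _\<close> by auto
    qed
    then show "c \<in> \<phi> ` crossing_points i j"
    proof
      assume "k = 0 \<and> l = 1"
      then have "s = 1 - t" "s \<in> crossing_points i j" "\<phi> s = c"
        using c same_front_iff[of s "1 - t" i j] by (auto simp: C reversepath_def crossing_points_def \<phi>_def)
      then show ?thesis by blast
    next
      assume "k = 1 \<and> l = 0"
      then have "t = 1 - s" "t \<in> crossing_points i j" "\<phi> t = c"
        using c same_front_iff[of "1 - s" t j i] by (auto simp: C reversepath_def crossing_points_def \<phi>_def)
      then show ?thesis by blast
    qed
  next
    fix c assume "c \<in> \<phi> ` crossing_points i j"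
    then obtain x where x: "x \<in> crossing_points i j" "c = \<phi> x" by blast
    then have "same_front (G i x) (G j x)" "same_front (G j x) (G i x)" "0 < x" "x < 1"
      using same_front_iff by (auto simp: crossing_points_def)
    then show "c \<in> crossings C"
      using ne[OF x(1)] x(2) by (auto simp: crossings_def C \<phi>_def reversepath_def)
  qed
  moreover have "crossing_sign C (\<phi> x) = -1" if x: "x \<in> crossing_points i j" for x
  proof -
    have x01: "0 < x" "x < 1" using x by (auto simp: crossing_points_def)
    have 3: "vel (G k) x $ 3 = G k x $ 2" for k
      using x01 by (simp add: braid_theta_def vel_front_lift)
    show ?thesis using ne[OF x] x01
      by (auto simp: crossing_sign_def \<phi>_def C vel_reversepath vel_x 3)
  qed
  moreover have "inj_on \<phi> (crossing_points i j)"
    by (auto simp: inj_on_def \<phi>_def split: if_splits)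
  ultimately have "writhe C = (\<Sum>x\<in>crossing_points i j. -1)"
    unfolding writhe_def by (simp add: sum.reindex)
  then show ?thesis by (simp add: C_def)
qed

lemma cusps_cycle: "cusps (theta_cycle G (i, j)) = {(0, 1), (1, 1)}"
proof -
  have *: "k < 2 \<longleftrightarrow> k = 0 \<or> k = 1" for k :: nat by auto
  show ?thesis
    by (auto simp: cusps_def theta_cycle_def next_arc_def vel_x vel_reversepath * less_Suc_eq)
qed

lemma tb_cycle:
  assumes "i < n" "j < n" "i \<noteq> j"
  shows "tb (theta_cycle G (i, j)) = - real (card (crossing_points i j)) - 1"
  unfolding tb_def writhe_cycle[OF assms] cusps_cycle by simp

text \<open>
  Edge \<open>i\<close> is below edge \<open>j\<close> at the left vertex and above it at the right one, so both vertices
  are downward cusps.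
\<close>

lemma rot_cycle:
  assumes ij: "i < j" "j < n"
  shows "rot (theta_cycle G (i, j)) = 1"
proof -
  define C where "C = theta_cycle G (i, j)"
  have C: "C = [G i, reversepath (G j)]" by (simp add: C_def theta_cycle_def)
  obtain d0 where d0: "d0 > 0" "\<And>y. \<bar>y - 0\<bar> < d0 \<Longrightarrow> poly (h i) y < poly (h j) y"
    using eventually_above[OF left_order[OF ij]] by blast
  obtain d1 where d1: "d1 > 0" "\<And>y. \<bar>y - 1\<bar> < d1 \<Longrightarrow> poly (h j) y < poly (h i) y"
    using eventually_above[OF right_order[OF ij]] by blast
  have w: "0 < y \<Longrightarrow> y < 1 \<Longrightarrow> 0 < poly end_weight y" for y by (simp add: poly_end_weight)
  have a1: "branch_above (G i) 1 (reversepath (G j)) 0"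
    unfolding branch_above_def
    by (rule exI[of _ d1]) (use d1 in \<open>auto simp: reversepath_def braid_theta_def w\<close>)
  have a0: "branch_above (reversepath (G j)) 1 (G i) 0"
    unfolding branch_above_def
    by (rule exI[of _ d0]) (use d0 in \<open>auto simp: reversepath_def braid_theta_def w\<close>)
  have excl: False if "branch_above a 1 b 0" "branch_below a 1 b 0"
    and x: "\<And>s. s \<in> {0<..<1} \<Longrightarrow> a s $ 1 = b (1 - s) $ 1" for a b
  proof -
    obtain d where d: "d > 0" "\<And>s t. s \<in> {0<..<1} \<Longrightarrow> t \<in> {0<..<1} \<Longrightarrow>
      1 - d < s \<and> s < 1 \<and> 0 < t \<and> t < 0 + d \<and> a s $ 1 = b t $ 1 \<Longrightarrow> a s $ 3 > b t $ 3"
      using \<open>branch_above a 1 b 0\<close> unfolding branch_above_def by blast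
    obtain e where e: "e > 0" "\<And>s t. s \<in> {0<..<1} \<Longrightarrow> t \<in> {0<..<1} \<Longrightarrow>
      1 - e < s \<and> s < 1 \<and> 0 < t \<and> t < 0 + e \<and> a s $ 1 = b t $ 1 \<Longrightarrow> a s $ 3 < b t $ 3"
      using \<open>branch_below a 1 b 0\<close> unfolding branch_below_def by blast
    define t where "t = min (1/2) (min (d/2) (e/2))"
    have t: "0 < t" "t < 1" "t < d" "t < e" using d e by (auto simp: t_def min_def)
    have "a (1 - t) $ 1 = b t $ 1" using x[of "1 - t"] t by simp
    then show False using d(2)[of "1 - t" t] e(2)[of "1 - t" t] t by force
  qed
  have b1: "\<not> branch_below (G i) 1 (reversepath (G j)) 0"
    using excl[OF a1] by (auto simp: reversepath_def braid_theta_def)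
  have b0: "\<not> branch_below (reversepath (G j)) 1 (G i) 0"
    using excl[OF a0] by (auto simp: reversepath_def braid_theta_def)
  have "down_cusps C = {(0, 1), (1, 1)}" "up_cusps C = {}"
    using a0 a1 b0 b1 unfolding down_cusps_def up_cusps_def C_def cusps_cycle
    by (auto simp: theta_cycle_def next_arc_def)
  then show ?thesis by (simp add: rot_def C_def)
qed

end

section \<open>Plane isotopies that follow moving points\<close>

lemma bij_plus_contraction:
  fixes f :: "complex \<Rightarrow> complex"
  assumes "0 \<le> c" "c < 1" and lip: "\<And>p q. dist (f p) (f q) \<le> c * dist p q"
  shows "bij (\<lambda>p. p + f p)"
proof (rule bijI)
  show "inj (\<lambda>p. p + f p)"
  proof (rule injI)
    fix p q assume "p + f p = q + f q"
    then have "p - q = f q - f p" by (simp add: algebra_simps)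
    then have "dist p q = dist (f p) (f q)"
      by (metis dist_commute dist_norm)
    with lip[of p q] have "(1 - c) * dist p q \<le> 0" by (simp add: algebra_simps)
    then show "p = q" using \<open>c < 1\<close> by (smt (verit) dist_le_zero_iff mult_pos_pos zero_less_dist_iff)
  qed
  show "surj (\<lambda>p. p + f p)"
    unfolding surj_def
  proof
    fix y :: complex
    have "\<exists>!x. y - f x = x"
      by (rule banach_fix_type[OF assms(1,2)]) (use lip in \<open>simp add: dist_norm norm_minus_commute\<close>)
    then show "\<exists>x. y = x + f x" by (metis diff_eq_eq)
  qed
qed

definition tent :: "real \<Rightarrow> complex \<Rightarrow> complex \<Rightarrow> real" where
  "tent r a p = max 0 (1 - dist p a / r)"

lemma tent_lipschitz: "0 < r \<Longrightarrow> \<bar>tent r a p - tent r a q\<bar> \<le> dist p q / r"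
proof -
  assume r: "0 < r"
  have "\<bar>dist p a - dist q a\<bar> \<le> dist p q" by (metis abs_dist_diff_le dist_commute)
  then have "\<bar>dist p a / r - dist q a / r\<bar> \<le> dist p q / r"
    using r by (simp add: diff_divide_distrib[symmetric] divide_right_mono abs_divide)
  then show ?thesis unfolding tent_def by linarith
qed

lemma tent_bounds: "0 < r \<Longrightarrow> 0 \<le> tent r a p \<and> tent r a p \<le> 1"
  by (simp add: tent_def)

text \<open>
  A homeomorphism that moves the points \<open>a i\<close> by the small vectors \<open>d i\<close>; each displacement is
  cut off by a cone of radius \<open>r\<close>, which contains no other of the points.
\<close>

definition push :: "nat \<Rightarrow> real \<Rightarrow> (nat \<Rightarrow> complex) \<Rightarrow> (nat \<Rightarrow> complex) \<Rightarrow> complex \<Rightarrow> complex" where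
  "push n r a d p = p + (\<Sum>i<n. tent r (a i) p *\<^sub>R d i)"

lemma push_centre:
  assumes "0 < r" "j < n" and sep: "\<And>i. i < n \<Longrightarrow> i \<noteq> j \<Longrightarrow> r \<le> dist (a j) (a i)"
  shows "push n r a d (a j) = a j + d j"
proof -
  have "(\<Sum>i<n. tent r (a i) (a j) *\<^sub>R d i) = (\<Sum>i<n. if i = j then d j else 0)"
    by (rule sum.cong) (use assms in \<open>auto simp: tent_def field_simps\<close>)
  then show ?thesis using assms(2) by (simp add: push_def)
qed

lemma bij_push:
  assumes r: "0 < r" and small: "\<And>i. i < n \<Longrightarrow> norm (d i) \<le> r / (2 * real (Suc n))"
  shows "bij (push n r a d)"
  unfolding push_def
proof (rule bij_plus_contraction[of "1/2"])
  fix p q :: complex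
  have "dist (\<Sum>i<n. tent r (a i) p *\<^sub>R d i) (\<Sum>i<n. tent r (a i) q *\<^sub>R d i)
      = norm (\<Sum>i<n. (tent r (a i) p - tent r (a i) q) *\<^sub>R d i)"
    by (simp add: dist_norm sum_subtractf scaleR_diff_left)
  also have "\<dots> \<le> (\<Sum>i<n. dist p q / r * (r / (2 * real (Suc n))))"
  proof (rule sum_norm_le)
    fix i assume "i \<in> {..<n}"
    then show "norm ((tent r (a i) p - tent r (a i) q) *\<^sub>R d i) \<le> dist p q / r * (r / (2 * real (Suc n)))"
      unfolding norm_scaleR using tent_lipschitz[OF r] small r by (intro mult_mono) simp_all
  qed
  also have "\<dots> = (real n / real (Suc n)) * (1/2 * dist p q)" using r by (simp add: field_simps)
  also have "\<dots> \<le> 1 * (1/2 * dist p q)" by (rule mult_right_mono) auto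
  finally show "dist (\<Sum>i<n. tent r (a i) p *\<^sub>R d i) (\<Sum>i<n. tent r (a i) q *\<^sub>R d i) \<le> 1/2 * dist p q"
    by simp
qed auto

lemma continuous_on_push:
  assumes "\<And>i. i < n \<Longrightarrow> continuous_on S (d i)" "continuous_on S f" "0 < r"
  shows "continuous_on S (\<lambda>x. push n r a (\<lambda>i. d i x) (f x))"
  unfolding push_def tent_def by (intro continuous_intros assms) (use assms in auto)

lemma push_bounded:
  assumes "0 < r" "\<And>i. i < n \<Longrightarrow> norm (d i) \<le> B"
  shows "dist (push n r a d p) p \<le> real n * B"
proof -
  have "dist (push n r a d p) p = norm (\<Sum>i<n. tent r (a i) p *\<^sub>R d i)" by (simp add: push_def dist_norm)
  also have "\<dots> \<le> (\<Sum>i<n. 1 * B)"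
  proof (rule sum_norm_le)
    fix i assume "i \<in> {..<n}"
    then show "norm (tent r (a i) p *\<^sub>R d i) \<le> 1 * B"
      unfolding norm_scaleR using tent_bounds[OF assms(1)] assms(2) by (intro mult_mono) simp_all
  qed
  finally show ?thesis by simp
qed

text \<open>
  On a short interval every point stays close to its initial position, and one simultaneous push
  follows the motion. By uniform continuity finitely many intervals of equal length
  suffice, and the pushes are composed one after the other.
\<close>

theorem isotopy_tracking_points:
  fixes c :: "nat \<Rightarrow> real \<Rightarrow> complex"
  assumes cont: "\<And>i. i < n \<Longrightarrow> continuous_on {0..1} (c i)"
    and dist: "\<And>i j x. i < n \<Longrightarrow> j < n \<Longrightarrow> i \<noteq> j \<Longrightarrow> x \<in> {0..1} \<Longrightarrow> c i x \<noteq> c j x"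
  obtains T B where "continuous_on UNIV (\<lambda>(x, p). T x p)" "\<And>x. bij (T x)"
    "\<And>x p. dist (T x p) p \<le> B" "\<And>x i. x \<in> {0..1} \<Longrightarrow> i < n \<Longrightarrow> T x (c i 0) = c i x"
proof -
  have "\<exists>r>0. \<forall>x\<in>{0..1}. r \<le> dist (c i x) (c j x)" if "i < n" "j < n" "i \<noteq> j" for i j
  proof -
    have "continuous_on {0..1} (\<lambda>x. dist (c i x) (c j x))"
      by (intro continuous_intros cont that)
    from continuous_attains_inf[OF _ _ this] obtain y where
      "y \<in> {0..1}" "\<forall>x\<in>{0..1}. dist (c i y) (c j y) \<le> dist (c i x) (c j x)" by auto
    then show ?thesis using dist[OF that] by (metis zero_less_dist_iff)
  qed
  then obtain R where R: "\<And>i j. i < n \<Longrightarrow> j < n \<Longrightarrow> i \<noteq> j \<Longrightarrow> R i j > 0 \<and> (\<forall>x\<in>{0..1}. R i j \<le> dist (c i x) (c j x))"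
    by metis
  define r where "r = Min (insert 1 ((\<lambda>(i,j). R i j) ` {(i,j). i < n \<and> j < n \<and> i \<noteq> j}))"
  have fin: "finite {(i,j). i < n \<and> j < n \<and> i \<noteq> j}"
    by (rule finite_subset[of _ "{..<n} \<times> {..<n}"]) auto
  have r0: "r > 0" unfolding r_def using fin R by (subst Min_gr_iff) auto
  have rsep: "r \<le> dist (c i x) (c j x)" if "i < n" "j < n" "i \<noteq> j" "x \<in> {0..1}" for i j x
  proof -
    have "r \<le> R i j" unfolding r_def using fin that by (intro Min_le) (auto intro!: image_eqI[of _ _ "(i,j)"])
    then show ?thesis using R that by force
  qed
  \<comment> \<open>displacements of this size keep the sum of the \<open>n\<close> pushes a contraction with constant \<open>1/2\<close>\<close>
  define e where "e = r / (2 * real (Suc n))"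
  have e0: "e > 0" using r0 by (simp add: e_def)
  have "\<exists>d>0. \<forall>x\<in>{0..1}. \<forall>y\<in>{0..1}. dist y x < d \<longrightarrow> dist (c i y) (c i x) < e" if "i < n" for i
    using compact_uniformly_continuous[OF cont[OF that]] e0 unfolding uniformly_continuous_on_def by auto
  then obtain D where D: "\<And>i. i < n \<Longrightarrow> D i > 0 \<and> (\<forall>x\<in>{0..1}. \<forall>y\<in>{0..1}. dist y x < D i \<longrightarrow> dist (c i y) (c i x) < e)"
    by metis
  define d where "d = Min (insert 1 (D ` {..<n}))"
  have d0: "d > 0" unfolding d_def using D by (subst Min_gr_iff) auto
  have dD: "d \<le> D i" if "i < n" for i unfolding d_def using that by (intro Min_le) auto
  obtain N where N: "1 / real (Suc N) < d" using d0 nat_approx_posE by blast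
  define M where "M = real (Suc N)"
  have M0: "M > 0" by (simp add: M_def)
  have "\<exists>T B. continuous_on UNIV (\<lambda>(x, p). T x p) \<and> (\<forall>x. bij (T x)) \<and> (\<forall>x p. dist (T x p) p \<le> B) \<and>
     (\<forall>x\<in>{0..1}. \<forall>i<n. T x (c i 0) = c i (min x (k / M)))" if "k \<le> Suc N" for k :: nat
    using that
  proof (induction k)
    case 0
    have "continuous_on UNIV (\<lambda>(x :: real, p :: complex). p)" unfolding case_prod_unfold by (rule continuous_on_snd[OF continuous_on_id])
    moreover have "bij (\<lambda>p :: complex. p)" using bij_id by (simp add: id_def)
    moreover have "min x (real 0 / M) = 0" if "x \<in> {0..1}" for x using that by simp
    ultimately show ?case
      by (intro exI[of _ "\<lambda>x p. p"] exI[of _ 0] conjI allI) auto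
  next
    case (Suc k)
    from Suc.IH[OF Suc_leD[OF Suc.prems]]
    obtain T B where T: "continuous_on UNIV (\<lambda>(x, p). T x p)" "\<And>x. bij (T x)"
      "\<And>x p. dist (T x p) p \<le> B" "\<And>x i. x \<in> {0..1} \<Longrightarrow> i < n \<Longrightarrow> T x (c i 0) = c i (min x (k / M))" by blast
    define a where "a = real k / M"
    define b where "b = real (Suc k) / M"
    have ab: "0 \<le> a" "a \<le> b" "b \<le> 1" "b - a < d" using Suc.prems N M0
      by (auto simp: a_def b_def M_def field_simps)
    define cl where "cl x = max a (min x b)" for x
    have cl: "cl x \<in> {a..b}" for x using ab by (auto simp: cl_def)
    have cl01: "cl x \<in> {0..1}" for x using cl[of x] ab by auto
    define dd where "dd i x = c i (cl x) - c i a" for i x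
    have small: "norm (dd i x) \<le> e" if "i < n" for i x
    proof -
      have "dist (cl x) a < D i" using cl[of x] ab dD[OF that] by (auto simp: dist_real_def)
      then show ?thesis using D[OF that] cl01[of x] ab by (auto simp: dd_def dist_norm less_imp_le)
    qed
    have contdd: "continuous_on S (\<lambda>z. dd i (g z))" if "i < n" "continuous_on S g" for i and S :: "(real\<times>complex) set" and g
      unfolding dd_def
      by (intro continuous_intros continuous_on_compose2[OF cont[OF that(1)], of _ "\<lambda>z. cl (g z)"])
        (use cl01 in \<open>auto simp: cl_def[abs_def] intro!: continuous_intros that\<close>)
    define T' where "T' x p = push n r (\<lambda>i. c i a) (\<lambda>i. dd i x) (T x p)" for x p
    have 1: "continuous_on UNIV (\<lambda>(x, p). T' x p)"
      unfolding T'_def case_prod_unfold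
      by (rule continuous_on_push[OF _ T(1)[unfolded case_prod_unfold] r0])
         (rule contdd, assumption, rule continuous_on_fst, rule continuous_on_id)
    have 2: "bij (T' x)" for x
    proof -
      have "bij (push n r (\<lambda>i. c i a) (\<lambda>i. dd i x) \<circ> T x)"
        by (intro bij_comp T(2) bij_push r0) (use small in \<open>auto simp: e_def\<close>)
      then show ?thesis by (simp add: T'_def[abs_def] comp_def)
    qed
    have 3: "dist (T' x p) p \<le> real n * e + B" for x p
      unfolding T'_def using push_bounded[OF r0, of n "\<lambda>i. dd i x" e "\<lambda>i. c i a" "T x p"] small T(3)[of x p]
      by (meson add_mono dist_triangle order_trans)
    have 4: "T' x (c i 0) = c i (min x (Suc k / M))" if x: "x \<in> {0..1}" and i: "i < n" for x i
    proof (cases "x \<le> a")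
      case True
      then have "cl x = a" "min x b = x" "min x a = x" using ab by (auto simp: cl_def)
      then have "dd i x = 0" for i by (simp add: dd_def)
      then have "T' x p = T x p" for p using \<open>cl x = a\<close> by (simp add: T'_def push_def dd_def)
      then show ?thesis using T(4)[OF x i] \<open>min x b = x\<close> \<open>min x a = x\<close> by (simp add: a_def b_def)
    next
      case False
      then have "min x a = a" "cl x = min x b" using ab by (auto simp: cl_def)
      then have "T x (c i 0) = c i a" using T(4)[OF x i] by (simp add: a_def)
      then have "T' x (c i 0) = c i a + dd i x"
        unfolding T'_def using push_centre[OF r0 i, of "\<lambda>i. c i a" "\<lambda>i. dd i x"] rsep[OF i] ab by auto
      then show ?thesis using \<open>cl x = min x b\<close> by (simp add: dd_def b_def)
    qed
    show ?case using 1 2 3 4 by blast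
  qed
  from this[OF order_refl] obtain T B where "continuous_on UNIV (\<lambda>(x, p). T x p)" "\<And>x. bij (T x)"
      "\<And>x p. dist (T x p) p \<le> B" "\<And>x i. x \<in> {0..1} \<Longrightarrow> i < n \<Longrightarrow> T x (c i 0) = c i (min x (Suc N / M))" by blast
  then show thesis using that[of T B] by (auto simp: M_def min_def)
qed

text \<open>
  The Alexander trick: conjugating the homeomorphism with a scaling by \<open>s\<close> moves points by at most
  \<open>s B\<close>, so the conjugates tend to the identity as \<open>s\<close> tends to \<open>0\<close>.
\<close>

lemma ambient_isotopic_of_bounded_homeomorphism:
  fixes K L :: "real^3 \<Rightarrow> real^3"
  assumes hom: "homeomorphism UNIV UNIV K L" and bd: "\<And>p. dist (K p) p \<le> B"
  shows "ambient_isotopic A (K ` A)"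
proof -
  define H where "H s p = p + s *\<^sub>R (K (p /\<^sub>R s) - p /\<^sub>R s)" for s p
  have Heq: "H s p = s *\<^sub>R K (p /\<^sub>R s)" if "s \<noteq> 0" for s p
    using that by (simp add: H_def algebra_simps)
  have contK: "continuous_on UNIV K" and contL: "continuous_on UNIV L"
    and KL: "\<And>p. K (L p) = p" "\<And>p. L (K p) = p"
    using hom by (auto simp: homeomorphism_def)
  have "continuous (at z within {0..1} \<times> UNIV) (\<lambda>(s, p). H s p)" if z: "z \<in> {0..1} \<times> UNIV" for z
  proof (cases "fst z = 0")
    case False
    have q: "isCont (\<lambda>z. snd z /\<^sub>R fst z) z" using False by (intro continuous_intros)
    have "isCont K p" for p using contK by (simp add: continuous_on_eq_continuous_at)
    from isCont_o2[OF q this] q have "isCont (\<lambda>z. H (fst z) (snd z)) z"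
      unfolding H_def
      by (intro continuous_add[OF continuous_snd] continuous_scaleR[OF continuous_fst] continuous_diff continuous_ident)
    then show ?thesis unfolding case_prod_unfold by (rule continuous_at_imp_continuous_at_within)
  next
    case True
    have "((\<lambda>y. fst y *\<^sub>R (K (snd y /\<^sub>R fst y) - snd y /\<^sub>R fst y)) \<longlongrightarrow> 0) (at z within {0..1} \<times> UNIV)"
    proof (rule Lim_null_comparison)
      show "\<forall>\<^sub>F y in at z within {0..1} \<times> UNIV.
          norm (fst y *\<^sub>R (K (snd y /\<^sub>R fst y) - snd y /\<^sub>R fst y)) \<le> \<bar>fst y\<bar> * B"
        using bd by (auto intro!: always_eventually mult_left_mono simp: dist_norm)
      have "((\<lambda>y. \<bar>fst y\<bar> * B) \<longlongrightarrow> \<bar>fst z\<bar> * B) (at z within {0..1} \<times> UNIV)"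
        by (intro tendsto_intros)
      then show "((\<lambda>y. \<bar>fst y\<bar> * B) \<longlongrightarrow> 0) (at z within {0..1} \<times> UNIV)" using True by simp
    qed
    from tendsto_add[OF tendsto_snd[OF tendsto_ident_at] this]
    have "((\<lambda>y. H (fst y) (snd y)) \<longlongrightarrow> snd z) (at z within {0..1} \<times> UNIV)" by (simp add: H_def)
    moreover have "H (fst z) (snd z) = snd z" using True by (simp add: H_def)
    ultimately show ?thesis by (simp add: continuous_within case_prod_unfold)
  qed
  then have "continuous_on ({0..1} \<times> UNIV) (\<lambda>(s, p). H s p)"
    by (simp add: continuous_on_eq_continuous_within)
  moreover have "\<exists>K'. homeomorphism UNIV UNIV (H s) K'" if "s \<in> {0..1}" for s
  proof (cases "s = 0")
    case True
    then show ?thesis by (intro exI[of _ "\<lambda>p. p"]) (simp add: H_def homeomorphism_def)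
  next
    case False
    have "continuous_on UNIV (\<lambda>p. s *\<^sub>R M (p /\<^sub>R s))" if "continuous_on UNIV M" for M :: "real^3 \<Rightarrow> real^3"
      by (rule continuous_on_scaleR[OF continuous_on_const continuous_on_compose2[OF that]])
         (auto intro: continuous_on_scaleR continuous_on_const continuous_on_id)
    from this[OF contK] this[OF contL] have "homeomorphism UNIV UNIV (\<lambda>p. s *\<^sub>R K (p /\<^sub>R s)) (\<lambda>p. s *\<^sub>R L (p /\<^sub>R s))"
      by (rule homeomorphismI) (use False in \<open>simp_all add: KL\<close>)
    then show ?thesis unfolding Heq[OF False, abs_def] by blast
  qed
  moreover have "\<forall>p. H 0 p = p" by (simp add: H_def)
  moreover have "H 1 ` A = K ` A" by (simp add: H_def)
  ultimately show ?thesis unfolding ambient_isotopic_def by blast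
qed

section \<open>Topological planarity of arrangements\<close>

text \<open>
  In the plane at \<open>x\<close> the edges are \<open>n\<close> points. Divided by \<open>x (1 - x)\<close> they have distinct limits
  \<open>(\<plusminus>2 h\<^sub>i, 0)\<close> at both vertices, so the isotopy that follows them exists on all of \<open>[0, 1]\<close>. Scaled back,
  it extends by the identity to the rest of space and straightens the edges into the plane \<open>z = 0\<close>.
\<close>

context front_arrangement begin

lemma planar: "topologically_planar (support n G)"
proof -
  define c where "c i x = Complex (2 * (1 - 2 * x) * poly (h i) x + x * (1 - x) * poly (pderiv (h i)) x)
     (x * (1 - x) * poly (h i) x)" for i x
  have cont: "continuous_on {0..1} (c i)" for i
    unfolding c_def Complex_eq by (intro continuous_intros)
  \<comment> \<open>at the ends the second coordinate vanishes and the first is \<open>\<plusminus>2 h\<close>; inside, equality would contradict transversality\<close>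
  have ne: "c i x \<noteq> c j x" if ij: "i < n" "j < n" "i \<noteq> j" and x: "x \<in> {0..1}" for i j x
  proof
    assume e: "c i x = c j x"
    show False
    proof (cases "x = 0 \<or> x = 1")
      case True
      then show False using e ends_distinct[OF ij] by (auto simp: c_def)
    next
      case False
      then have x01: "0 < x" "x < 1" using x by auto
      then have "poly (h i) x = poly (h j) x" "poly (pderiv (h i)) x = poly (pderiv (h j)) x"
        using e by (auto simp: c_def)
      then show False using transverse[OF ij x01] by blast
    qed
  qed
  obtain T B where T: "continuous_on UNIV (\<lambda>(x, p). T x p)" "\<And>x. bij (T x)"
    "\<And>x p. dist (T x p) p \<le> B" "\<And>x i. x \<in> {0..1} \<Longrightarrow> i < n \<Longrightarrow> T x (c i 0) = c i x"
    by (rule isotopy_tracking_points[of n c, OF cont ne]) (assumption | rule that)+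
  define l where "l x = max 0 (x * (1 - x))" for x :: real
  have l0: "0 \<le> l x" for x by (simp add: l_def)
  have contl: "isCont l x" for x unfolding l_def[abs_def] by (intro continuous_intros)
  define q where "q p = Complex (p $ 2) (p $ 3)" for p :: "real^3"
  define S where "S x w = w + l x *\<^sub>R (T x (w /\<^sub>R l x) - w /\<^sub>R l x)" for x w
  define \<Phi> where "\<Phi> p = pt (p $ 1) (Re (S (p $ 1) (q p))) (Im (S (p $ 1) (q p)))" for p
  have S_eq: "S x w = l x *\<^sub>R T x (w /\<^sub>R l x)" if "l x \<noteq> 0" for x w
    using that by (simp add: S_def algebra_simps)
  have bijS: "bij (S x)" for x
  proof (cases "l x = 0")
    case True
    then have "S x = id" by (simp add: S_def fun_eq_iff)
    then show ?thesis by simp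
  next
    case False
    have sc: "bij (\<lambda>w :: complex. k *\<^sub>R w)" if "k \<noteq> 0" for k
      by (rule o_bij[of "\<lambda>w. inverse k *\<^sub>R w"]) (use that in \<open>auto simp: comp_def\<close>)
    have "bij ((\<lambda>w. l x *\<^sub>R w) \<circ> (T x \<circ> (\<lambda>w. inverse (l x) *\<^sub>R w)))"
      using False by (intro bij_comp T(2) sc) auto
    moreover have "(\<lambda>w. l x *\<^sub>R w) \<circ> (T x \<circ> (\<lambda>w. inverse (l x) *\<^sub>R w)) = S x"
      using S_eq[OF False] by (auto simp: fun_eq_iff)
    ultimately show ?thesis by simp
  qed
  have dS: "norm (S x w - w) \<le> l x * B" for x w
    using T(3)[of x "w /\<^sub>R l x"] l0[of x] by (simp add: S_def dist_norm mult_left_mono)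
  have contS: "isCont (\<lambda>z. S (fst z) (snd z)) z" for z
  proof (cases "l (fst z) = 0")
    case False
    have lc: "isCont (\<lambda>z. l (fst z)) z"
      by (rule isCont_o2[OF continuous_fst[OF continuous_ident] contl])
    have q: "isCont (\<lambda>z. snd z /\<^sub>R l (fst z)) z"
      by (rule continuous_scaleR[OF continuous_at_within_inverse[OF lc False] continuous_snd[OF continuous_ident]])
    have "isCont (\<lambda>z. (fst z, snd z /\<^sub>R l (fst z))) z"
      by (rule continuous_Pair[OF continuous_fst[OF continuous_ident] q])
    from isCont_o2[OF this, of "\<lambda>z. T (fst z) (snd z)"]
    have "isCont (\<lambda>z. T (fst z) (snd z /\<^sub>R l (fst z))) z"
      using T(1) by (simp add: continuous_on_eq_continuous_at case_prod_unfold)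
    from continuous_add[OF continuous_snd[OF continuous_ident] continuous_scaleR[OF lc continuous_diff[OF this q]]]
    show ?thesis unfolding S_def .
  next
    case True
    have "((\<lambda>y. S (fst y) (snd y) - snd y) \<longlongrightarrow> 0) (at z)"
    proof (rule Lim_null_comparison)
      show "\<forall>\<^sub>F y in at z. norm (S (fst y) (snd y) - snd y) \<le> l (fst y) * B"
        using dS by simp
      have "(l \<longlongrightarrow> 0) (nhds (fst z))" 
        using True contl by (metis isCont_def tendsto_at_iff_tendsto_nhds)
      then have "((\<lambda>y. l (fst y)) \<longlongrightarrow> 0) (at z)"
        by (rule filterlim_compose) (intro tendsto_intros)
      from tendsto_mult_left_zero[OF this] show "((\<lambda>y. l (fst y) * B) \<longlongrightarrow> 0) (at z)" by simp
    qed
    from tendsto_add[OF this tendsto_snd[OF tendsto_ident_at]]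
    have "((\<lambda>y. S (fst y) (snd y)) \<longlongrightarrow> snd z) (at z)" by simp
    moreover have "S (fst z) (snd z) = snd z" using True by (simp add: S_def)
    ultimately show ?thesis by (simp add: isCont_def)
  qed
  have contq: "continuous_on UNIV q" unfolding q_def[abs_def] Complex_eq by (intro continuous_intros)
  have "continuous_on UNIV (\<lambda>p. S (p $ 1) (q p))"
  proof -
    have "continuous_on UNIV (\<lambda>z. S (fst z) (snd z))" using contS by (simp add: continuous_on_eq_continuous_at)
    moreover have "continuous_on UNIV (\<lambda>p. (p $ 1, q p))"
      by (intro continuous_on_Pair continuous_on_component continuous_on_id contq)
    ultimately show ?thesis using continuous_on_compose2[of UNIV "\<lambda>z. S (fst z) (snd z)" UNIV "\<lambda>p. (p $ 1, q p)"] by simp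
  qed
  then have cont\<Phi>: "continuous_on UNIV \<Phi>"
    unfolding \<Phi>_def[abs_def] by (intro continuous_intros)
  have q\<Phi>: "q (\<Phi> p) = S (p $ 1) (q p)" "\<Phi> p $ 1 = p $ 1" for p by (simp_all add: q_def \<Phi>_def complex_eq_iff)
  have qinj: "p = p'" if "p $ 1 = p' $ 1" "q p = q p'" for p p'
    using that by (simp add: q_def vec3_eq_iff)
  have inj\<Phi>: "inj \<Phi>"
  proof (rule injI)
    fix p p' assume e: "\<Phi> p = \<Phi> p'"
    then have 1: "p $ 1 = p' $ 1" using q\<Phi>(2) by metis
    then have "S (p $ 1) (q p) = S (p $ 1) (q p')" using e q\<Phi>(1) by metis
    then have "q p = q p'" using bijS by (metis bij_def injD)
    then show "p = p'" using 1 qinj by blast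
  qed
  have "surj \<Phi>"
    unfolding surj_def
  proof
    fix y :: "real^3"
    obtain w where w: "S (y $ 1) w = q y" using bijS by (metis bij_pointE)
    have "q (pt (y $ 1) (Re w) (Im w)) = w" by (simp add: q_def)
    then have "\<Phi> (pt (y $ 1) (Re w) (Im w)) = y" using w by (intro qinj) (simp_all add: q\<Phi>)
    then show "\<exists>x. y = \<Phi> x" by metis
  qed
  then obtain K where hom: "homeomorphism UNIV UNIV \<Phi> K"
    using invariance_of_domain_homeomorphism[OF open_UNIV cont\<Phi> order_refl inj\<Phi>] by metis
  have K: "\<Phi> (K p) = p" "K (\<Phi> p) = p" for p using hom by (auto simp: homeomorphism_def)
  have l1: "l x \<le> 1" for x :: real
    using zero_le_power2[of "x - 1/2"] by (simp add: l_def power2_eq_square algebra_simps)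
  have B0: "0 \<le> B" using T(3)[of 0 0] zero_le_dist order_trans by blast
  have "dist (K p) p \<le> 2 * B" for p
  proof -
    define w where "w = S (K p $ 1) (q (K p)) - q (K p)"
    have "norm w \<le> B"
      using dS[of "K p $ 1" "q (K p)"] mult_right_mono[OF l1[of "K p $ 1"] B0] unfolding w_def by linarith
    moreover have "p - K p = \<Phi> (K p) - K p" by (simp add: K)
    then have "p - K p = pt 0 (Re w) (Im w)" by (simp add: \<Phi>_def vec3_eq_iff w_def q_def)
    then have "norm (p - K p) \<le> \<bar>Re w\<bar> + \<bar>Im w\<bar>"
      using norm_le_l1_cart[of "p - K p"] by (simp add: sum_3)
    ultimately show ?thesis using abs_Re_le_cmod[of w] abs_Im_le_cmod[of w]
      by (simp add: dist_norm norm_minus_commute)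
  qed
  then have iso: "ambient_isotopic (support n G) (K ` support n G)"
    using ambient_isotopic_of_bounded_homeomorphism[OF homeomorphism_symD[OF hom]] by blast
  have "K (G i x) $ 3 = 0" if i: "i < n" and x: "x \<in> {0..1}" for i x
  proof -
    have lx: "l x = x * (1 - x)" using x by (simp add: l_def)
    have "\<Phi> (pt x (l x * Re (c i 0)) 0) = G i x"
    proof (cases "l x = 0")
      case True
      then have "x = 0 \<or> x = 1" using lx by simp
      then show ?thesis using True by (auto simp: \<Phi>_def S_def q_def braid_theta_start braid_theta_finish vec3_eq_iff)
    next
      case False
      have "q (pt x (l x * Re (c i 0)) 0) /\<^sub>R l x = c i 0" using False by (simp add: q_def c_def complex_eq_iff)
      then have "S x (q (pt x (l x * Re (c i 0)) 0)) = l x *\<^sub>R c i x"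
        using S_eq[OF False] T(4)[OF x i] by simp
      then have "\<Phi> (pt x (l x * Re (c i 0)) 0) = pt x (l x * Re (c i x)) (l x * Im (c i x))" by (simp add: \<Phi>_def)
      then show ?thesis
        by (simp add: lx c_def braid_theta_def vec3_eq_iff poly_end_weight poly_pderiv_weighted power2_eq_square algebra_simps)
    qed
    then show ?thesis by (metis K(2) pt_nth(3))
  qed
  then have "K ` support n G \<subseteq> {p. axis 3 1 \<bullet> p = 0}"
    by (auto simp: support_def path_image_def inner_axis' )
  then show ?thesis
    unfolding topologically_planar_def using iso
    by (intro exI[of _ "K ` support n G"] exI[of _ "axis 3 1"] exI[of _ 0]) (auto simp: axis_eq_0_iff)
qed

end

section \<open>A smoothed linking integral for the vertical push-off\<close>

lemma DERIV_pos_part_power: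
  "((\<lambda>x. max 0 x ^ Suc (Suc k)) has_real_derivative real (Suc (Suc k)) * max 0 x ^ Suc k) (at x)"
proof -
  consider "x > 0" | "x < 0" | "x = 0" by linarith
  then show ?thesis
  proof cases
    case 1
    have "((\<lambda>x. x ^ Suc (Suc k)) has_real_derivative real (Suc (Suc k)) * max 0 x ^ Suc k) (at x)"
      using DERIV_pow[of "Suc (Suc k)" x] 1 by simp
    then show ?thesis
      by (rule has_field_derivative_transform_within_open[of _ _ _ "{0<..}"]) (use 1 in auto)
  next
    case 2
    have "((\<lambda>x. 0) has_real_derivative real (Suc (Suc k)) * max 0 x ^ Suc k) (at x)"
      using 2 by simp
    then show ?thesis
      by (rule has_field_derivative_transform_within_open[of _ _ _ "{..<0}"]) (use 2 in auto)
  next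
    case 3
    have "((\<lambda>y. (max 0 y ^ Suc (Suc k) - 0) / (y - 0)) \<longlongrightarrow> 0) (at (0::real))"
    proof (rule Lim_null_comparison)
      show "\<forall>\<^sub>F y in at 0. norm ((max 0 y ^ Suc (Suc k) - 0) / (y - 0)) \<le> \<bar>y\<bar> ^ Suc k" for k
      proof (rule eventually_at_filter[THEN iffD2], rule always_eventually, safe)
        fix y :: real assume "y \<noteq> 0"
        then consider "y > 0" | "max 0 y = 0" by linarith
        then show "norm ((max 0 y ^ Suc (Suc k) - 0) / (y - 0)) \<le> \<bar>y\<bar> ^ Suc k"
        proof cases
          case 1
          then show ?thesis by simp
        next
          case 2
          have "0 \<le> \<bar>y\<bar> ^ Suc k" by (rule zero_le_power) simp
          then show ?thesis unfolding 2 by simp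
        qed
      qed
      have "((\<lambda>y :: real. \<bar>y\<bar> ^ Suc k) \<longlongrightarrow> \<bar>0\<bar> ^ Suc k) (at 0)" by (intro tendsto_intros)
      then show "((\<lambda>y :: real. \<bar>y\<bar> ^ Suc k) \<longlongrightarrow> 0) (at 0)" by simp
    qed
    then show ?thesis using 3 by (simp add: has_field_derivative_iff)
  qed
qed

definition third_difference :: "real \<Rightarrow> (real \<Rightarrow> real) \<Rightarrow> real \<Rightarrow> real" where
  "third_difference \<kappa> f x = f (x + \<kappa>) - 3 * f (x + \<kappa> / 3) + 3 * f (x - \<kappa> / 3) - f (x - \<kappa>)"

text \<open>
  A twice differentiable step, namely a cubic spline. A third difference is constant on cubic
  polynomials and vanishes on quadratic ones, so the step is constant and its derivative, the bump, is zero
  outside \<open>[-\<kappa>, \<kappa>]\<close>.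
\<close>

definition smooth_step :: "real \<Rightarrow> real \<Rightarrow> real" where
  "smooth_step \<kappa> = third_difference \<kappa> (\<lambda>x. max 0 x ^ 3)"

definition bump :: "real \<Rightarrow> real \<Rightarrow> real" where
  "bump \<kappa> x = 3 * third_difference \<kappa> (\<lambda>x. max 0 x ^ 2) x"

definition bump_deriv :: "real \<Rightarrow> real \<Rightarrow> real" where
  "bump_deriv \<kappa> x = 6 * third_difference \<kappa> (\<lambda>x. max 0 x) x"

definition step_height :: "real \<Rightarrow> real" where
  "step_height \<kappa> = 16 / 9 * \<kappa> ^ 3"

lemma DERIV_smooth_step: "(smooth_step \<kappa> has_real_derivative bump \<kappa> x) (at x)"
proof -
  have *: "((\<lambda>x. max 0 (x + c) ^ 3) has_real_derivative 3 * max 0 (x + c) ^ 2) (at x)" for c :: real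
    using DERIV_shift[of "\<lambda>x. max 0 x ^ 3" "3 * max 0 (x + c) ^ 2" x c] DERIV_pos_part_power[of 1 "x + c"]
    by (simp add: numeral_eq_Suc)
  from DERIV_diff[OF DERIV_add[OF DERIV_diff[OF *[of \<kappa>] DERIV_cmult[OF *[of "\<kappa> / 3"], of 3]]
      DERIV_cmult[OF *[of "- (\<kappa> / 3)"], of 3]] *[of "- \<kappa>"]]
  show ?thesis unfolding smooth_step_def bump_def third_difference_def[abs_def] by (simp add: algebra_simps)
qed

lemma DERIV_bump: "(bump \<kappa> has_real_derivative bump_deriv \<kappa> x) (at x)"
proof -
  have *: "((\<lambda>x. max 0 (x + c) ^ 2) has_real_derivative 2 * max 0 (x + c)) (at x)" for c :: real
    using DERIV_shift[of "\<lambda>x. max 0 x ^ 2" "2 * max 0 (x + c)" x c] DERIV_pos_part_power[of 0 "x + c"]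
    by (simp add: numeral_eq_Suc)
  from DERIV_cmult[OF DERIV_diff[OF DERIV_add[OF DERIV_diff[OF *[of \<kappa>] DERIV_cmult[OF *[of "\<kappa> / 3"], of 3]]
      DERIV_cmult[OF *[of "- (\<kappa> / 3)"], of 3]] *[of "- \<kappa>"]], of 3]
  show ?thesis unfolding bump_def[abs_def] bump_deriv_def third_difference_def[abs_def] by (simp add: algebra_simps)
qed

lemma smooth_step_left: "0 < \<kappa> \<Longrightarrow> x \<le> - \<kappa> \<Longrightarrow> smooth_step \<kappa> x = 0"
  by (simp add: smooth_step_def third_difference_def)

lemma smooth_step_right: "0 < \<kappa> \<Longrightarrow> x \<ge> \<kappa> \<Longrightarrow> smooth_step \<kappa> x = step_height \<kappa>"
  by (simp add: smooth_step_def third_difference_def step_height_def max_def power3_eq_cube field_simps)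

lemma bump_outside: "0 < \<kappa> \<Longrightarrow> \<bar>x\<bar> \<ge> \<kappa> \<Longrightarrow> bump \<kappa> x = 0"
  by (cases "x \<ge> 0") (simp_all add: bump_def third_difference_def max_def power2_eq_square field_simps)

lemma smooth_step_uminus: "smooth_step \<kappa> (- x) = step_height \<kappa> - smooth_step \<kappa> x"
proof -
  have *: "max 0 (- y) ^ 3 = max 0 y ^ 3 - y ^ 3" for y :: real by (simp add: max_def)
  have "smooth_step \<kappa> (- x) = max 0 (- (x - \<kappa>)) ^ 3 - 3 * max 0 (- (x - \<kappa> / 3)) ^ 3
      + 3 * max 0 (- (x + \<kappa> / 3)) ^ 3 - max 0 (- (x + \<kappa>)) ^ 3"
  proof -
    have a: "- x + \<kappa> = - (x - \<kappa>)" and b: "- x + \<kappa> / 3 = - (x - \<kappa> / 3)"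
      and c: "- x - \<kappa> / 3 = - (x + \<kappa> / 3)" and d: "- x - \<kappa> = - (x + \<kappa>)" by simp_all
    show ?thesis unfolding smooth_step_def third_difference_def a b c d ..
  qed
  also have "\<dots> = step_height \<kappa> - smooth_step \<kappa> x"
    unfolding * smooth_step_def third_difference_def step_height_def
    by (simp add: power3_eq_cube field_simps)
  finally show ?thesis .
qed

lemma step_height_pos: "0 < \<kappa> \<Longrightarrow> 0 < step_height \<kappa>"
  by (simp add: step_height_def)

lemma continuous_on_spline:
  assumes "continuous_on S f"
  shows "continuous_on S (\<lambda>x. smooth_step \<kappa> (f x))" "continuous_on S (\<lambda>x. bump \<kappa> (f x))"
    "continuous_on S (\<lambda>x. bump_deriv \<kappa> (f x))"
  unfolding smooth_step_def bump_def bump_deriv_def third_difference_def by (intro continuous_intros assms)+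

text \<open>
  The density of the two-form \<open>link_density dx \<and> dy\<close>. Its exterior derivative is minus the product of three
  bumps times the volume form, so the form is closed outside the cube of radius \<open>\<kappa>\<close>. Up to a constant
  its integral over a closed surface that avoids the cube is the degree of the surface around the origin.
\<close>

definition link_density :: "real \<Rightarrow> real^3 \<Rightarrow> real" where
  "link_density \<kappa> d = (step_height \<kappa> - smooth_step \<kappa> (d $ 3)) * bump \<kappa> (d $ 1) * bump \<kappa> (d $ 2)"

definition link_density_deriv :: "real \<Rightarrow> real^3 \<Rightarrow> real^3 \<Rightarrow> real" where
  "link_density_deriv \<kappa> d v =
     (step_height \<kappa> - smooth_step \<kappa> (d $ 3)) * (bump_deriv \<kappa> (d $ 1) * v $ 1 * bump \<kappa> (d $ 2)
       + bump \<kappa> (d $ 1) * (bump_deriv \<kappa> (d $ 2) * v $ 2))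
     - bump \<kappa> (d $ 3) * v $ 3 * bump \<kappa> (d $ 1) * bump \<kappa> (d $ 2)"

lemma DERIV_link_density:
  assumes "(d has_vector_derivative v) (at x within S)"
  shows "((\<lambda>x. link_density \<kappa> (d x)) has_real_derivative link_density_deriv \<kappa> (d x) v) (at x within S)"
proof -
  note c = has_real_derivative_component[OF assms]
  have 1: "((\<lambda>x. smooth_step \<kappa> (d x $ i)) has_real_derivative bump \<kappa> (d x $ i) * v $ i) (at x within S)" for i
    by (rule DERIV_chain2[OF DERIV_smooth_step c])
  have 2: "((\<lambda>x. bump \<kappa> (d x $ i)) has_real_derivative bump_deriv \<kappa> (d x $ i) * v $ i) (at x within S)" for i
    by (rule DERIV_chain2[OF DERIV_bump c])
  show ?thesis unfolding link_density_def link_density_deriv_def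
    by (rule derivative_eq_intros 1 2 refl)+ (simp add: algebra_simps)
qed

lemma continuous_on_link_density:
  "continuous_on S d \<Longrightarrow> continuous_on S (\<lambda>x. link_density \<kappa> (d x))"
  unfolding link_density_def by (intro continuous_intros continuous_on_spline)

lemma continuous_on_link_density_deriv:
  "continuous_on S d \<Longrightarrow> continuous_on S v \<Longrightarrow> continuous_on S (\<lambda>x. link_density_deriv \<kappa> (d x) (v x))"
  unfolding link_density_deriv_def by (intro continuous_intros continuous_on_spline)

definition avoids_cube :: "real \<Rightarrow> real^3 \<Rightarrow> bool" where
  "avoids_cube \<kappa> d \<longleftrightarrow> \<bar>d $ 1\<bar> \<ge> \<kappa> \<or> \<bar>d $ 2\<bar> \<ge> \<kappa> \<or> \<bar>d $ 3\<bar> \<ge> \<kappa>"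

text \<open>
  Closedness of the pulled back form. The derivatives of the two horizontal bumps
  contribute determinants with a repeated row; the \<open>z\<close>-derivative contributes the product of
  all three bumps.
\<close>

lemma link_density_closed:
  assumes "0 < \<kappa>" "avoids_cube \<kappa> d"
  shows "link_density_deriv \<kappa> d u * (v $ 1 * w $ 2 - w $ 1 * v $ 2)
       + link_density_deriv \<kappa> d v * (w $ 1 * u $ 2 - u $ 1 * w $ 2)
       + link_density_deriv \<kappa> d w * (u $ 1 * v $ 2 - v $ 1 * u $ 2) = 0"
proof -
  have "bump \<kappa> (d $ 1) * bump \<kappa> (d $ 2) * bump \<kappa> (d $ 3) = 0"
    using assms bump_outside unfolding avoids_cube_def by auto
  then have "bump \<kappa> (d $ 1) = 0 \<or> bump \<kappa> (d $ 2) = 0 \<or> bump \<kappa> (d $ 3) = 0" by simp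
  then show ?thesis
    by (elim disjE) (simp_all add: link_density_deriv_def algebra_simps)
qed

definition link_square :: "real \<Rightarrow> real \<Rightarrow> (real \<Rightarrow> real^3) \<Rightarrow> (real \<Rightarrow> real^3) \<Rightarrow> real" where
  "link_square \<kappa> \<epsilon> a b = integral (cbox (0, 0) (1, 1)) (\<lambda>(s, t).
     link_density \<kappa> (a s - b t + pt 0 0 \<epsilon>) * (vel a s $ 2 * vel b t $ 1 - vel a s $ 1 * vel b t $ 2))"

text \<open>
  For arcs \<open>a\<close> and \<open>b\<close> with common ends the cycle follows \<open>a\<close> forwards and \<open>b\<close> backwards. The
  difference of the cycle and its push-off covers a torus made of four squares, whose signs are those of the
  orientations of the arcs.
\<close>

definition push_off_linking :: "real \<Rightarrow> real \<Rightarrow> (real \<Rightarrow> real^3) \<Rightarrow> (real \<Rightarrow> real^3) \<Rightarrow> real" where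
  "push_off_linking \<kappa> \<epsilon> a b =
     link_square \<kappa> \<epsilon> a a - link_square \<kappa> \<epsilon> a b - link_square \<kappa> \<epsilon> b a + link_square \<kappa> \<epsilon> b b"

text \<open>
  The regularity that differentiation under the integral and Stokes' theorem require: \<open>Ft\<close>,
  \<open>Fl\<close> and \<open>Flt\<close> are the derivatives in the curve parameter, in the deformation parameter, and in both.
\<close>

locale arc_homotopy =
  fixes F Ft Fl Flt :: "real \<Rightarrow> real \<Rightarrow> real^3"
  assumes deriv:
    "l \<in> {0..1} \<Longrightarrow> t \<in> {0..1} \<Longrightarrow> (F l has_vector_derivative Ft l t) (at t within {0..1})"
    "l \<in> {0..1} \<Longrightarrow> t \<in> {0..1} \<Longrightarrow> ((\<lambda>l. F l t) has_vector_derivative Fl l t) (at l within {0..1})"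
    "l \<in> {0..1} \<Longrightarrow> t \<in> {0..1} \<Longrightarrow> ((\<lambda>l. Ft l t) has_vector_derivative Flt l t) (at l within {0..1})"
    "l \<in> {0..1} \<Longrightarrow> t \<in> {0..1} \<Longrightarrow> (Fl l has_vector_derivative Flt l t) (at t within {0..1})"
  and cont: 
    "continuous_on ({0..1} \<times> {0..1}) (\<lambda>z. F (fst z) (snd z))"
    "continuous_on ({0..1} \<times> {0..1}) (\<lambda>z. Ft (fst z) (snd z))"
    "continuous_on ({0..1} \<times> {0..1}) (\<lambda>z. Fl (fst z) (snd z))"
    "continuous_on ({0..1} \<times> {0..1}) (\<lambda>z. Flt (fst z) (snd z))"
begin

lemma vel_eq: "l \<in> {0..1} \<Longrightarrow> t \<in> {0..1} \<Longrightarrow> vel (F l) t = Ft l t"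
  by (rule vel_eqI[OF _ deriv(1)])

lemma cont2:
  assumes "continuous_on S u" "continuous_on S v" "u ` S \<subseteq> {0..1}" "v ` S \<subseteq> {0..1}"
  shows "continuous_on S (\<lambda>x. F (u x) (v x))" "continuous_on S (\<lambda>x. Ft (u x) (v x))"
    "continuous_on S (\<lambda>x. Fl (u x) (v x))" "continuous_on S (\<lambda>x. Flt (u x) (v x))"
proof -
  have *: "continuous_on S (\<lambda>x. g (u x) (v x))" if "continuous_on ({0..1} \<times> {0..1}) (\<lambda>z. g (fst z) (snd z))" for g :: "real \<Rightarrow> real \<Rightarrow> real^3"
    using continuous_on_compose2[OF that, of S "\<lambda>x. (u x, v x)"] assms by (auto intro: continuous_on_Pair)
  show "continuous_on S (\<lambda>x. F (u x) (v x))" "continuous_on S (\<lambda>x. Ft (u x) (v x))"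
    "continuous_on S (\<lambda>x. Fl (u x) (v x))" "continuous_on S (\<lambda>x. Flt (u x) (v x))"
    by (intro * cont)+
qed

end

text \<open>
  The form evaluated on the deformation vector and one edge of a square: the boundary terms in Stokes'
  theorem for the cube that the square sweeps out.
\<close>

definition first_boundary :: "real \<Rightarrow> real \<Rightarrow> real^3 \<Rightarrow> real^3 \<Rightarrow> real^3 \<Rightarrow> real^3 \<Rightarrow> real^3 \<Rightarrow> real" where
  "first_boundary \<kappa> \<epsilon> P Pl Q Qt Ql =
     link_density \<kappa> (P - Q + pt 0 0 \<epsilon>) * ((Pl $ 1 - Ql $ 1) * Qt $ 2 - Qt $ 1 * (Pl $ 2 - Ql $ 2))"

definition second_boundary :: "real \<Rightarrow> real \<Rightarrow> real^3 \<Rightarrow> real^3 \<Rightarrow> real^3 \<Rightarrow> real^3 \<Rightarrow> real^3 \<Rightarrow> real" where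
  "second_boundary \<kappa> \<epsilon> P Pt Pl Q Ql =
     link_density \<kappa> (P - Q + pt 0 0 \<epsilon>) * ((Pl $ 1 - Ql $ 1) * Pt $ 2 - Pt $ 1 * (Pl $ 2 - Ql $ 2))"

text \<open>
  Write \<open>X\<close>, \<open>Y\<close>, \<open>Z\<close> for the three components of the pulled back form on the cube with
  coordinates \<open>l\<close>, \<open>s\<close>, \<open>t\<close>. Closedness is \<open>\<partial>X/\<partial>l + \<partial>Y/\<partial>s + \<partial>Z/\<partial>t = 0\<close>; integrating over the square
  turns the last two terms into boundary values.
\<close>

lemma has_real_derivative_link_square:
  assumes "arc_homotopy A At Al Alt" "arc_homotopy B Bt Bl Blt"
    and \<kappa>: "0 < \<kappa>"
    and avoid: "\<And>l s t. l \<in> {0..1} \<Longrightarrow> s \<in> {0..1} \<Longrightarrow> t \<in> {0..1} \<Longrightarrow> avoids_cube \<kappa> (A l s - B l t + pt 0 0 \<epsilon>)"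
    and l0: "l0 \<in> {0..1}"
  shows "((\<lambda>l. link_square \<kappa> \<epsilon> (A l) (B l)) has_real_derivative
     - integral {0..1} (\<lambda>t. first_boundary \<kappa> \<epsilon> (A l0 1) (Al l0 1) (B l0 t) (Bt l0 t) (Bl l0 t)
                        - first_boundary \<kappa> \<epsilon> (A l0 0) (Al l0 0) (B l0 t) (Bt l0 t) (Bl l0 t))
     - integral {0..1} (\<lambda>s. second_boundary \<kappa> \<epsilon> (A l0 s) (At l0 s) (Al l0 s) (B l0 1) (Bl l0 1)
                        - second_boundary \<kappa> \<epsilon> (A l0 s) (At l0 s) (Al l0 s) (B l0 0) (Bl l0 0)))
     (at l0 within {0..1})"
proof -
  interpret A: arc_homotopy A At Al Alt by fact
  interpret B: arc_homotopy B Bt Bl Blt by fact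
  define d where "d l s t = A l s - B l t + pt 0 0 \<epsilon>" for l s t
  define g where "g l s t v = link_density_deriv \<kappa> (d l s t) v" for l s t v
  define X where "X l z = link_density \<kappa> (d l (fst z) (snd z)) *
    (At l (fst z) $ 2 * Bt l (snd z) $ 1 - At l (fst z) $ 1 * Bt l (snd z) $ 2)" for l z
  define Xl where "Xl l z = g l (fst z) (snd z) (Al l (fst z) - Bl l (snd z)) *
      (At l (fst z) $ 2 * Bt l (snd z) $ 1 - At l (fst z) $ 1 * Bt l (snd z) $ 2) +
    link_density \<kappa> (d l (fst z) (snd z)) *
      (Alt l (fst z) $ 2 * Bt l (snd z) $ 1 + At l (fst z) $ 2 * Blt l (snd z) $ 1
       - Alt l (fst z) $ 1 * Bt l (snd z) $ 2 - At l (fst z) $ 1 * Blt l (snd z) $ 2)" for l z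
  define Y where "Y s t = first_boundary \<kappa> \<epsilon> (A l0 s) (Al l0 s) (B l0 t) (Bt l0 t) (Bl l0 t)" for s t
  define Z where "Z s t = second_boundary \<kappa> \<epsilon> (A l0 s) (At l0 s) (Al l0 s) (B l0 t) (Bl l0 t)" for s t
  define Ys where "Ys s t = g l0 s t (At l0 s) * ((Al l0 s $ 1 - Bl l0 t $ 1) * Bt l0 t $ 2 - Bt l0 t $ 1 * (Al l0 s $ 2 - Bl l0 t $ 2))
     + link_density \<kappa> (d l0 s t) * (Alt l0 s $ 1 * Bt l0 t $ 2 - Bt l0 t $ 1 * Alt l0 s $ 2)" for s t
  define Zt where "Zt s t = g l0 s t (- Bt l0 t) * ((Al l0 s $ 1 - Bl l0 t $ 1) * At l0 s $ 2 - At l0 s $ 1 * (Al l0 s $ 2 - Bl l0 t $ 2))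
     + link_density \<kappa> (d l0 s t) * (At l0 s $ 1 * Blt l0 t $ 2 - Blt l0 t $ 1 * At l0 s $ 2)" for s t
  have box: "cbox (0, 0) (1, 1 :: real) = {0..1 :: real} \<times> {0..1}" by (simp add: cbox_Pair_eq)
  have dl: "((\<lambda>l. d l s t) has_vector_derivative Al l s - Bl l t) (at l within {0..1})"
    and ds: "((\<lambda>s. d l s t) has_vector_derivative At l s) (at s within {0..1})"
    and dt: "((\<lambda>t. d l s t) has_vector_derivative - Bt l t) (at t within {0..1})"
    if "l \<in> {0..1}" "s \<in> {0..1}" "t \<in> {0..1}" for l s t
    unfolding d_def using that
    by (auto intro!: derivative_eq_intros A.deriv B.deriv)
  have lk: "((\<lambda>l. link_square \<kappa> \<epsilon> (A l) (B l)) has_real_derivative integral (cbox (0, 0) (1, 1)) (Xl l0)) (at l0 within {0..1})"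
  proof -
    have sq: "link_square \<kappa> \<epsilon> (A l) (B l) = integral (cbox (0, 0) (1, 1)) (X l)" if "l \<in> {0..1}" for l
      unfolding link_square_def X_def d_def
      by (rule integral_cong) (use that in \<open>auto simp: A.vel_eq B.vel_eq box\<close>)
    have "((\<lambda>l. integral (cbox (0, 0) (1, 1)) (X l)) has_real_derivative integral (cbox (0, 0) (1, 1)) (Xl l0)) (at l0 within {0..1})"
    proof (rule leibniz_rule_field_derivative[OF _ _ _ l0])
      fix l z assume l: "l \<in> {0..1 :: real}" and z: "z \<in> cbox (0, 0) (1 :: real, 1 :: real)"
      then have st: "fst z \<in> {0..1}" "snd z \<in> {0..1}" by (auto simp: box)
      note D = DERIV_link_density[OF dl[OF l st]] has_real_derivative_component[OF A.deriv(3)[OF l st(1)]]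
        has_real_derivative_component[OF B.deriv(3)[OF l st(2)]]
      show "((\<lambda>l. X l z) has_real_derivative Xl l z) (at l within {0..1})"
        unfolding X_def Xl_def g_def
        by (rule derivative_eq_intros D refl)+ (simp add: algebra_simps)
    next
      fix l assume l: "l \<in> {0..1 :: real}"
      show "X l integrable_on cbox (0, 0) (1, 1)"
        unfolding X_def d_def
        by (rule integrable_continuous)
          (use l in \<open>intro continuous_intros continuous_on_link_density A.cont2 B.cont2, auto simp: box\<close>)
    next
      have "continuous_on ({0..1} \<times> cbox (0, 0) (1, 1)) (\<lambda>w. Xl (fst w) (snd w))"
        unfolding Xl_def d_def g_def
        by (intro continuous_intros continuous_on_link_density continuous_on_link_density_deriv A.cont2 B.cont2)
          (auto simp: box)
      then show "continuous_on ({0..1} \<times> cbox (0, 0) (1, 1)) (\<lambda>(l, z). Xl l z)" by (simp add: case_prod_unfold)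
    qed auto
    then show ?thesis
      by (rule has_field_derivative_transform_within[OF _ zero_less_one l0]) (use sq in auto)
  qed
  have sum0: "Xl l0 (s, t) = - Ys s t - Zt s t" if "s \<in> {0..1}" "t \<in> {0..1}" for s t
  proof -
    have "avoids_cube \<kappa> (d l0 s t)" unfolding d_def by (rule avoid[OF l0 that])
    from link_density_closed[OF \<kappa> this, of "Al l0 s - Bl l0 t" "At l0 s" "- Bt l0 t"]
    show ?thesis unfolding Xl_def Ys_def Zt_def g_def by (simp add: algebra_simps)
  qed
  have contYs: "continuous_on (cbox (0, 0) (1, 1)) (\<lambda>(s, t). Ys s t)"
    unfolding Ys_def case_prod_unfold d_def g_def
    by (intro continuous_intros continuous_on_link_density continuous_on_link_density_deriv A.cont2 B.cont2)
       (use l0 in \<open>auto simp: box\<close>)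
  have contZt: "continuous_on (cbox (0, 0) (1, 1)) (\<lambda>(s, t). Zt s t)"
    unfolding Zt_def case_prod_unfold d_def g_def
    by (intro continuous_intros continuous_on_link_density continuous_on_link_density_deriv A.cont2 B.cont2)
       (use l0 in \<open>auto simp: box\<close>)
  have "integral {0..1} (\<lambda>s. Ys s t) = Y 1 t - Y 0 t" if t: "t \<in> {0..1}" for t
  proof (rule integral_unique, rule fundamental_theorem_of_calculus)
    fix s :: real assume s: "s \<in> {0..1}"
    note D = DERIV_link_density[OF ds[OF l0 s t, unfolded d_def]] has_real_derivative_component[OF A.deriv(4)[OF l0 s]]
    have "((\<lambda>s. Y s t) has_real_derivative Ys s t) (at s within {0..1})"
      unfolding Y_def Ys_def g_def d_def first_boundary_def
      by (rule derivative_eq_intros D refl)+ (simp add: algebra_simps)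
    then show "((\<lambda>s. Y s t) has_vector_derivative Ys s t) (at s within {0..1})"
      by (simp add: has_real_derivative_iff_has_vector_derivative)
  qed simp
  moreover have "integral {0..1} (\<lambda>t. Zt s t) = Z s 1 - Z s 0" if s: "s \<in> {0..1}" for s
  proof (rule integral_unique, rule fundamental_theorem_of_calculus)
    fix t :: real assume t: "t \<in> {0..1}"
    note D = DERIV_link_density[OF dt[OF l0 s t, unfolded d_def]] has_real_derivative_component[OF B.deriv(4)[OF l0 t]]
    have "((\<lambda>t. Z s t) has_real_derivative Zt s t) (at t within {0..1})"
      unfolding Z_def Zt_def g_def d_def second_boundary_def
      by (rule derivative_eq_intros D refl)+ (simp add: algebra_simps)
    then show "((\<lambda>t. Z s t) has_vector_derivative Zt s t) (at t within {0..1})"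
      by (simp add: has_real_derivative_iff_has_vector_derivative)
  qed simp
  moreover have "integral (cbox (0, 0) (1, 1)) (Xl l0) = integral (cbox (0, 0) (1, 1)) (\<lambda>z. - (case z of (s, t) \<Rightarrow> Ys s t) - (case z of (s, t) \<Rightarrow> Zt s t))"
    by (rule integral_cong) (use sum0 in \<open>auto simp: box\<close>)
  moreover have "\<dots> = - integral (cbox (0, 0) (1, 1)) (\<lambda>(s, t). Ys s t) - integral (cbox (0, 0) (1, 1)) (\<lambda>(s, t). Zt s t)"
    using integral_diff[OF integrable_neg[OF integrable_continuous[OF contYs]] integrable_continuous[OF contZt]] by simp
  moreover have "integral (cbox (0, 0) (1, 1)) (\<lambda>(s, t). Ys s t) = integral {0..1} (\<lambda>t. integral {0..1} (\<lambda>s. Ys s t))"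
    using integral_prod_continuous[OF contYs] integral_swap_continuous[OF contYs] by simp
  moreover have "integral (cbox (0, 0) (1, 1)) (\<lambda>(s, t). Zt s t) = integral {0..1} (\<lambda>s. integral {0..1} (\<lambda>t. Zt s t))"
    using integral_prod_continuous[OF contZt] by simp
  moreover have "integral {0..1} (\<lambda>t. integral {0..1} (\<lambda>s. Ys s t)) = integral {0..1} (\<lambda>t. Y 1 t - Y 0 t)"
    by (rule integral_cong) (use calculation(1) in auto)
  moreover have "integral {0..1} (\<lambda>s. integral {0..1} (\<lambda>t. Zt s t)) = integral {0..1} (\<lambda>s. Z s 1 - Z s 0)"
    by (rule integral_cong) (use calculation(2) in auto)
  ultimately have "integral (cbox (0, 0) (1, 1)) (Xl l0) = - integral {0..1} (\<lambda>t. Y 1 t - Y 0 t) - integral {0..1} (\<lambda>s. Z s 1 - Z s 0)"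
    by simp
  with lk show ?thesis by (simp add: Y_def Z_def)
qed

text \<open>
  Boundary values at an end of the first arc are the same for \<open>A\<close> and \<open>B\<close>, since the arcs share their
  ends for all parameters. They enter with opposite signs and cancel; the same holds for the second arc.
\<close>

theorem push_off_linking_homotopy_invariant:
  assumes hA: "arc_homotopy A At Al Alt" and hB: "arc_homotopy B Bt Bl Blt"
    and \<kappa>: "0 < \<kappa>"
    and ends: "\<And>l. l \<in> {0..1} \<Longrightarrow> A l 0 = B l 0" "\<And>l. l \<in> {0..1} \<Longrightarrow> A l 1 = B l 1"
    and avoid: "\<And>P Q l s t. P \<in> {A, B} \<Longrightarrow> Q \<in> {A, B} \<Longrightarrow> l \<in> {0..1} \<Longrightarrow> s \<in> {0..1} \<Longrightarrow> t \<in> {0..1} \<Longrightarrow>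
      avoids_cube \<kappa> (P l s - Q l t + pt 0 0 \<epsilon>)"
  shows "push_off_linking \<kappa> \<epsilon> (A 0) (B 0) = push_off_linking \<kappa> \<epsilon> (A 1) (B 1)"
proof -
  interpret A: arc_homotopy A At Al Alt by fact
  interpret B: arc_homotopy B Bt Bl Blt by fact
  have ends': "Al l e = Bl l e" if "l \<in> {0..1}" "e = 0 \<or> e = 1" for l e
  proof -
    have "((\<lambda>l. A l e) has_vector_derivative Al l e) (at l within {0..1})" using that by (intro A.deriv) auto
    moreover have "((\<lambda>l. A l e) has_vector_derivative Bl l e) (at l within {0..1})"
      by (rule has_vector_derivative_transform[where f = "\<lambda>l. B l e"]) (use that ends in \<open>auto intro: B.deriv\<close>)
    ultimately show ?thesis
      using that vector_derivative_unique_within_closed_interval[of 0 1 l "\<lambda>l. A l e"] by auto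
  qed
  have "((\<lambda>l. push_off_linking \<kappa> \<epsilon> (A l) (B l)) has_real_derivative 0) (at l within {0..1})" if l: "l \<in> {0..1}" for l
  proof -
    have a: "A \<in> {A, B}" and b: "B \<in> {A, B}" by auto
    note AA = has_real_derivative_link_square[OF hA hA \<kappa> avoid[OF a a] l]
    note AB = has_real_derivative_link_square[OF hA hB \<kappa> avoid[OF a b] l]
    note BA = has_real_derivative_link_square[OF hB hA \<kappa> avoid[OF b a] l]
    note BB = has_real_derivative_link_square[OF hB hB \<kappa> avoid[OF b b] l]
    have e: "A l 0 = B l 0" "A l 1 = B l 1" "Al l 0 = Bl l 0" "Al l 1 = Bl l 1"
      using ends[OF l] ends'[OF l] by blast+
    show ?thesis unfolding push_off_linking_def
      using DERIV_add[OF DERIV_diff[OF DERIV_diff[OF AA AB] BA] BB] unfolding e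
      by (simp add: first_boundary_def)
  qed
  then obtain c where "\<And>l. l \<in> {0..1} \<Longrightarrow> push_off_linking \<kappa> \<epsilon> (A l) (B l) = c"
    using has_field_derivative_zero_constant[of "{0..1::real}" "\<lambda>l. push_off_linking \<kappa> \<epsilon> (A l) (B l)"] by auto
  then show ?thesis by simp
qed

section \<open>Short chords in a Legendrian isotopy\<close>

lemma smooth_family_arc_homotopy:
  assumes "smooth_family F"
  obtains Ft Fl Flt where "arc_homotopy F Ft Fl Flt"
proof -
  obtain D where D0: "\<And>s t. s \<in> {0..1} \<Longrightarrow> t \<in> {0..1} \<Longrightarrow> D 0 0 s t = F s t"
    and Dc: "\<And>j k. continuous_on ({0..1} \<times> {0..1}) (\<lambda>(s, t). D j k s t)"
    and Ds: "\<And>j k s t. s \<in> {0..1} \<Longrightarrow> t \<in> {0..1} \<Longrightarrow> ((\<lambda>s'. D j k s' t) has_vector_derivative D (Suc j) k s t) (at s within {0..1})"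
    and Dt: "\<And>j k s t. s \<in> {0..1} \<Longrightarrow> t \<in> {0..1} \<Longrightarrow> ((\<lambda>t'. D j k s t') has_vector_derivative D j (Suc k) s t) (at t within {0..1})"
    using assms unfolding smooth_family_def by blast
  have c: "continuous_on ({0..1} \<times> {0..1}) (\<lambda>z. D j k (fst z) (snd z))" for j k
    using Dc[of j k] by (simp add: case_prod_unfold)
  have "arc_homotopy F (D 0 1) (D 1 0) (D 1 1)"
  proof
    fix l t :: real assume lt: "l \<in> {0..1}" "t \<in> {0..1}"
    show "(F l has_vector_derivative D 0 1 l t) (at t within {0..1})"
      unfolding One_nat_def by (rule has_vector_derivative_transform[OF lt(2) _ Dt[OF lt, of 0 0]])
        (use D0 lt in simp)
    show "((\<lambda>l. F l t) has_vector_derivative D 1 0 l t) (at l within {0..1})"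
      unfolding One_nat_def by (rule has_vector_derivative_transform[OF lt(1) _ Ds[OF lt, of 0 0]])
        (use D0 lt in simp)
    show "((\<lambda>l. D 0 1 l t) has_vector_derivative D 1 1 l t) (at l within {0..1})"
      using Ds[OF lt, of 0 1] by simp
    show "(D 1 0 l has_vector_derivative D 1 1 l t) (at t within {0..1})"
      using Dt[OF lt, of 1 0] by simp
  next
    show "continuous_on ({0..1} \<times> {0..1}) (\<lambda>z. F (fst z) (snd z))"
      by (rule continuous_on_eq[OF c[of 0 0]]) (use D0 in auto)
  qed (rule c)+
  then show thesis using that by blast
qed

context arc_homotopy begin

lemma mean_value:
  assumes "l \<in> {0..1}" "s \<in> {0..1}" "e \<in> {0..1}"
  obtains x where "x \<in> {0..1}" "\<bar>x - e\<bar> \<le> \<bar>s - e\<bar>" "F l s $ i - F l e $ i = (s - e) * Ft l x $ i"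
proof -
  have d: "((\<lambda>t. F l t $ i) has_derivative (*) (Ft l x $ i)) (at x within {a..b})" if "x \<in> {a..b}" "0 \<le> a" "b \<le> 1" for x a b
    using has_real_derivative_component[OF deriv(1)[OF assms(1), of x], of i] that
    by (auto simp: has_field_derivative_def intro: has_derivative_subset)
  consider "s = e" | "s < e" | "e < s" by linarith
  then show thesis
  proof cases
    case 1 then show ?thesis using that[of e] assms by auto
  next
    case 2
    obtain x where "x \<in> {s<..<e}" "F l e $ i - F l s $ i = Ft l x $ i * (e - s)"
      using mvt_simple[OF 2, of "\<lambda>t. F l t $ i" "\<lambda>x. (*) (Ft l x $ i)"] d assms by auto
    then show ?thesis using that[of x] assms by (auto simp: algebra_simps)
  next
    case 3
    obtain x where "x \<in> {e<..<s}" "F l s $ i - F l e $ i = Ft l x $ i * (s - e)"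
      using mvt_simple[OF 3, of "\<lambda>t. F l t $ i" "\<lambda>x. (*) (Ft l x $ i)"] d assms by auto
    then show ?thesis using that[of x] assms by (auto simp: algebra_simps)
  qed
qed

lemma tendsto_at_point:
  assumes "\<And>k. u k \<in> {0..1}" "\<And>k. v k \<in> {0..1}" "u \<longlonglongrightarrow> l" "v \<longlonglongrightarrow> t" "l \<in> {0..1}" "t \<in> {0..1}"
  shows "(\<lambda>k. F (u k) (v k)) \<longlonglongrightarrow> F l t" "(\<lambda>k. Ft (u k) (v k)) \<longlonglongrightarrow> Ft l t"
proof -
  have *: "(\<lambda>k. g (u k) (v k)) \<longlonglongrightarrow> g l t" if "continuous_on ({0..1} \<times> {0..1}) (\<lambda>z. g (fst z) (snd z))" for g :: "real \<Rightarrow> real \<Rightarrow> real^3"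
    using continuous_on_tendsto_compose[OF that tendsto_Pair[OF assms(3,4)]] assms by simp
  show "(\<lambda>k. F (u k) (v k)) \<longlonglongrightarrow> F l t" "(\<lambda>k. Ft (u k) (v k)) \<longlonglongrightarrow> Ft l t"
    by (intro * cont)+
qed

end

lemma legendrian_vel_nonzero:
  assumes "legendrian_arc a" "t \<in> {0..1}"
  shows "vel a t $ 1 \<noteq> 0 \<or> vel a t $ 2 \<noteq> 0"
  using assms by (auto simp: legendrian_arc_def xi_std_def vec3_eq_iff)

text \<open>
  A vector in a contact plane is determined by its horizontal part, so the direction of
  that part determines the direction of the vector.
\<close>

lemma xi_std_sgn_eq:
  assumes "u \<in> xi_std p" "v \<in> xi_std p" "0 < c" "u $ 1 = c * v $ 1" "u $ 2 = c * v $ 2"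
  shows "sgn u = sgn v"
proof -
  have "u = c *\<^sub>R v" using assms by (simp add: xi_std_def vec3_eq_iff)
  then show ?thesis using \<open>0 < c\<close> by (simp add: sgn_scaleR)
qed

lemma not_eventually_at_right_sequence:
  assumes "\<not> (\<forall>\<^sub>F e in at_right (0::real). P e)"
  obtains e where "e \<longlonglongrightarrow> 0" "\<And>k. 0 < e k" "\<And>k. \<not> P (e k)"
proof -
  have "\<exists>e. 0 < e \<and> e < inverse (real (Suc k)) \<and> \<not> P e" for k
  proof (rule ccontr)
    assume "\<not> ?thesis"
    then have "\<forall>y>0. y < inverse (real (Suc k)) \<longrightarrow> P y" by blast
    then have "\<forall>\<^sub>F e in at_right 0. P e" by (auto simp: eventually_at_right_field intro!: exI[of _ "inverse (real (Suc k))"])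
    then show False using assms by blast
  qed
  then obtain e where e: "\<And>k. 0 < e k \<and> e k < inverse (real (Suc k)) \<and> \<not> P (e k)" by metis
  have "e \<longlonglongrightarrow> 0"
    by (rule tendsto_sandwich[OF _ _ tendsto_const LIMSEQ_inverse_real_of_nat]) (use e in \<open>auto intro!: always_eventually less_imp_le\<close>)
  then show thesis using that e by blast
qed

text \<open>
  If there are vertical chords of arbitrarily small length, compactness yields a sequence of such chords whose ends
  converge to a common point. The ends of each chord differ but have equal horizontal coordinates.
\<close>

lemma short_chord_limit:
  assumes "arc_homotopy A At Al Alt" "arc_homotopy B Bt Bl Blt"
    and short: "\<not> (\<forall>\<^sub>F \<epsilon> in at_right 0. \<forall>l\<in>{0..1}. \<forall>s\<in>{0..1}. \<forall>t\<in>{0..1}. A l s - B l t + pt 0 0 \<epsilon> \<noteq> 0)"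
  obtains l s t :: "nat \<Rightarrow> real" and l0 s0 t0 where
    "\<And>k. l k \<in> {0..1}" "\<And>k. s k \<in> {0..1}" "\<And>k. t k \<in> {0..1}"
    "l0 \<in> {0..1}" "s0 \<in> {0..1}" "t0 \<in> {0..1}" "l \<longlonglongrightarrow> l0" "s \<longlonglongrightarrow> s0" "t \<longlonglongrightarrow> t0" "A l0 s0 = B l0 t0"
    "\<And>k i. i = 1 \<or> i = 2 \<Longrightarrow> A (l k) (s k) $ i = B (l k) (t k) $ i" "\<And>k. A (l k) (s k) \<noteq> B (l k) (t k)"
proof -
  interpret A: arc_homotopy A At Al Alt by fact
  interpret B: arc_homotopy B Bt Bl Blt by fact
  obtain e where e: "e \<longlonglongrightarrow> 0" "\<And>k. 0 < e k"
    "\<And>k. \<exists>l\<in>{0..1}. \<exists>s\<in>{0..1}. \<exists>t\<in>{0..1}. A l s - B l t + pt 0 0 (e k) = 0"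
    by (rule not_eventually_at_right_sequence[OF short]) blast
  then obtain l s t where lst: "\<And>k. l k \<in> {0..1}" "\<And>k. s k \<in> {0..1}" "\<And>k. t k \<in> {0..1}"
    and eq: "\<And>k. A (l k) (s k) - B (l k) (t k) + pt 0 0 (e k) = 0" by metis
  define f where "f k = (l k, s k, t k)" for k :: nat
  have "compact ({0..1::real} \<times> {0..1::real} \<times> {0..1::real})" by (intro compact_Times compact_Icc)
  moreover have "\<forall>k. f k \<in> {0..1} \<times> {0..1} \<times> {0..1}" using lst by (simp add: f_def)
  ultimately obtain z r where z: "z \<in> {0..1} \<times> {0..1} \<times> {0..1}" and r: "strict_mono r" and lim: "(f \<circ> r) \<longlonglongrightarrow> z"
    unfolding compact_def by metis
  define l0 where "l0 = fst z" define s0 where "s0 = fst (snd z)" define t0 where "t0 = snd (snd z)"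
  have z01: "l0 \<in> {0..1}" "s0 \<in> {0..1}" "t0 \<in> {0..1}" using z by (auto simp: l0_def s0_def t0_def)
  have lims: "(\<lambda>k. l (r k)) \<longlonglongrightarrow> l0" "(\<lambda>k. s (r k)) \<longlonglongrightarrow> s0" "(\<lambda>k. t (r k)) \<longlonglongrightarrow> t0"
    using tendsto_fst[OF lim] tendsto_fst[OF tendsto_snd[OF lim]] tendsto_snd[OF tendsto_snd[OF lim]]
    by (simp_all add: f_def l0_def s0_def t0_def)
  have er: "(\<lambda>k. e (r k)) \<longlonglongrightarrow> 0" using LIMSEQ_subseq_LIMSEQ[OF e(1) r] by (simp add: comp_def)
  have dif: "A (l k) (s k) $ i - B (l k) (t k) $ i = - pt 0 0 (e k) $ i" for k i
    using arg_cong[OF eq[of k], of "\<lambda>v. v $ i"] by simp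
  have "A l0 s0 $ i = B l0 t0 $ i" for i
  proof -
    have "(\<lambda>k. A (l (r k)) (s (r k)) $ i - B (l (r k)) (t (r k)) $ i) \<longlonglongrightarrow> A l0 s0 $ i - B l0 t0 $ i"
      by (intro tendsto_diff tendsto_vec_nth A.tendsto_at_point(1) B.tendsto_at_point(1) lims z01 lst)
    moreover have "(\<lambda>k. - pt 0 0 (e (r k)) $ i) \<longlonglongrightarrow> 0"
    proof -
      have "(\<lambda>k. - ((e (r k)) * axis 3 1 $ i)) \<longlonglongrightarrow> - (0 * axis 3 1 $ i)"
        by (intro tendsto_intros er)
      then show ?thesis by (simp add: pt_conv_axis)
    qed
    ultimately show ?thesis unfolding dif using LIMSEQ_unique by force
  qed
  then have AB: "A l0 s0 = B l0 t0" by (simp add: vec_eq_iff)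
  have same: "A (l k) (s k) $ i = B (l k) (t k) $ i" if "i = 1 \<or> i = 2" for k i
    using dif[of k i] that by auto
  have "A (l k) (s k) \<noteq> B (l k) (t k)" for k
    using eq[of k] e(2)[of k] by (auto simp: vec3_eq_iff)
  then show thesis
    using that[of "\<lambda>k. l (r k)" "\<lambda>k. s (r k)" "\<lambda>k. t (r k)" l0 s0 t0] lst z01 lims AB same by blast
qed

text \<open>
  The ends of short vertical chords would converge to one point of the arc, where by the mean
  value theorem the horizontal velocity would vanish.
\<close>

lemma no_short_chords_arc:
  assumes "arc_homotopy A At Al Alt" and leg: "\<And>l. l \<in> {0..1} \<Longrightarrow> legendrian_arc (A l)"
  shows "\<forall>\<^sub>F \<epsilon> in at_right 0. \<forall>l\<in>{0..1}. \<forall>s\<in>{0..1}. \<forall>t\<in>{0..1}. A l s - A l t + pt 0 0 \<epsilon> \<noteq> 0"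
proof (rule ccontr)
  interpret A: arc_homotopy A At Al Alt by fact
  assume "\<not> ?thesis"
  then show False
  proof (rule short_chord_limit[OF assms(1,1)])
    fix l s t :: "nat \<Rightarrow> real" and l0 s0 t0
    assume lst: "\<And>k. l k \<in> {0..1}" "\<And>k. s k \<in> {0..1}" "\<And>k. t k \<in> {0..1}"
      and z01: "l0 \<in> {0..1}" "s0 \<in> {0..1}" "t0 \<in> {0..1}" and lims: "l \<longlonglongrightarrow> l0" "s \<longlonglongrightarrow> s0" "t \<longlonglongrightarrow> t0"
      and AA: "A l0 s0 = A l0 t0" and same: "\<And>k i. i = 1 \<or> i = 2 \<Longrightarrow> A (l k) (s k) $ i = A (l k) (t k) $ i"
      and ne: "\<And>k. A (l k) (s k) \<noteq> A (l k) (t k)"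
    have st: "s0 = t0" using AA leg[OF z01(1)] z01 unfolding legendrian_arc_def arc_def inj_on_def by blast
    have "At l0 t0 $ i = 0" if i: "i = 1 \<or> i = 2" for i
    proof -
      have "\<exists>x. x \<in> {0..1} \<and> \<bar>x - t k\<bar> \<le> \<bar>s k - t k\<bar> \<and> At (l k) x $ i = 0" for k
      proof -
        obtain x where x: "x \<in> {0..1}" "\<bar>x - t k\<bar> \<le> \<bar>s k - t k\<bar>"
          "A (l k) (s k) $ i - A (l k) (t k) $ i = (s k - t k) * At (l k) x $ i"
          using A.mean_value[OF lst] by blast
        have "s k \<noteq> t k" using ne[of k] by auto
        moreover have "(s k - t k) * At (l k) x $ i = 0" using x(3) same[OF i, of k] by simp
        ultimately show ?thesis using x by auto
      qed
      then obtain x where x: "\<And>k. x k \<in> {0..1}" "\<And>k. \<bar>x k - t k\<bar> \<le> \<bar>s k - t k\<bar>" "\<And>k. At (l k) (x k) $ i = 0" by metis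
      have "(\<lambda>k. x k - t k) \<longlonglongrightarrow> 0"
      proof (rule Lim_null_comparison)
        show "\<forall>\<^sub>F k in sequentially. norm (x k - t k) \<le> \<bar>s k - t k\<bar>" using x(2) by simp
        have "(\<lambda>k. \<bar>s k - t k\<bar>) \<longlonglongrightarrow> \<bar>s0 - t0\<bar>" by (intro tendsto_intros lims)
        then show "(\<lambda>k. \<bar>s k - t k\<bar>) \<longlonglongrightarrow> 0" using st by simp
      qed
      from tendsto_add[OF this lims(3)] have "(\<lambda>k. x k) \<longlonglongrightarrow> t0" by simp
      then have "(\<lambda>k. At (l k) (x k) $ i) \<longlonglongrightarrow> At l0 t0 $ i"
        by (intro tendsto_vec_nth A.tendsto_at_point(2) lims z01 lst x)
      then show ?thesis using x(3) by (simp add: LIMSEQ_const_iff)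
    qed
    then show False using legendrian_vel_nonzero[OF leg[OF z01(1)] z01(3)] A.vel_eq[OF z01(1,3)] by auto
  qed
qed

text \<open>
  Chords between two different edges can only shrink to a common vertex. There, by the mean value
  theorem, the tangents of the two edges would be positively proportional.
\<close>

lemma no_short_chords_between:
  assumes "arc_homotopy A At Al Alt" "arc_homotopy B Bt Bl Blt"
    and legA: "\<And>l. l \<in> {0..1} \<Longrightarrow> legendrian_arc (A l)" and legB: "\<And>l. l \<in> {0..1} \<Longrightarrow> legendrian_arc (B l)"
    and ends: "\<And>l e. l \<in> {0..1} \<Longrightarrow> e = 0 \<or> e = 1 \<Longrightarrow> A l e = B l e"
    and inter: "\<And>l. l \<in> {0..1} \<Longrightarrow> path_image (A l) \<inter> path_image (B l) \<subseteq> {A l 0, A l 1}"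
    and tang: "\<And>l e. l \<in> {0..1} \<Longrightarrow> e = 0 \<or> e = 1 \<Longrightarrow> sgn (vel (A l) e) \<noteq> sgn (vel (B l) e)"
  shows "\<forall>\<^sub>F \<epsilon> in at_right 0. \<forall>l\<in>{0..1}. \<forall>s\<in>{0..1}. \<forall>t\<in>{0..1}. A l s - B l t + pt 0 0 \<epsilon> \<noteq> 0"
proof (rule ccontr)
  interpret A: arc_homotopy A At Al Alt by fact
  interpret B: arc_homotopy B Bt Bl Blt by fact
  assume "\<not> ?thesis"
  then show False
  proof (rule short_chord_limit[OF assms(1,2)])
    fix l s t :: "nat \<Rightarrow> real" and l0 s0 t0
    assume lst: "\<And>k. l k \<in> {0..1}" "\<And>k. s k \<in> {0..1}" "\<And>k. t k \<in> {0..1}"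
      and z01: "l0 \<in> {0..1}" "s0 \<in> {0..1}" "t0 \<in> {0..1}" and lims: "l \<longlonglongrightarrow> l0" "s \<longlonglongrightarrow> s0" "t \<longlonglongrightarrow> t0"
      and AB: "A l0 s0 = B l0 t0" and same: "\<And>k i. i = 1 \<or> i = 2 \<Longrightarrow> A (l k) (s k) $ i = B (l k) (t k) $ i"
      and ne: "\<And>k. A (l k) (s k) \<noteq> B (l k) (t k)"
    have "A l0 s0 \<in> {A l0 0, A l0 1}"
    proof -
      have "A l0 s0 \<in> path_image (A l0)" unfolding path_image_def using z01(2) by (rule imageI)
      moreover have "A l0 s0 \<in> path_image (B l0)" unfolding path_image_def AB using z01(3) by (rule imageI)
      ultimately show ?thesis using inter[OF z01(1)] by blast
    qed
    then obtain v where v: "v = 0 \<or> v = 1" and "A l0 s0 = A l0 v" by blast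
    have v01: "v \<in> {0..1}" using v by auto
    have inj: "inj_on (A l0) {0..1}" "inj_on (B l0) {0..1}"
      using legA[OF z01(1)] legB[OF z01(1)] by (simp_all add: legendrian_arc_def arc_def)
    have st: "s0 = v" "t0 = v"
      using inj_onD[OF inj(1) \<open>A l0 s0 = A l0 v\<close> z01(2) v01] inj_onD[OF inj(2), of t0 v] z01(3) v01
        AB ends[OF z01(1) v] \<open>A l0 s0 = A l0 v\<close> by simp_all
    \<comment> \<open>the velocities approach the ratio \<open>1 - w : w\<close>; the weights lie in a compact set although both distances tend to \<open>0\<close>\<close>
    define w where "w k = \<bar>s k - v\<bar> / (\<bar>s k - v\<bar> + \<bar>t k - v\<bar>)" for k
    have "\<forall>k. w k \<in> {0..1}" by (auto simp: w_def divide_le_eq_1)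
    then obtain c r where c: "c \<in> {0..1}" "(w \<circ> r) \<longlonglongrightarrow> c" and r: "strict_mono r"
      using compact_Icc[of 0 "1::real"] unfolding compact_def by metis
    have limr: "(\<lambda>k. l (r k)) \<longlonglongrightarrow> l0" "(\<lambda>k. s (r k)) \<longlonglongrightarrow> v" "(\<lambda>k. t (r k)) \<longlonglongrightarrow> v" "(\<lambda>k. w (r k)) \<longlonglongrightarrow> c"
      using LIMSEQ_subseq_LIMSEQ[OF lims(1) r] LIMSEQ_subseq_LIMSEQ[OF lims(2) r] LIMSEQ_subseq_LIMSEQ[OF lims(3) r] c(2) st
      by (simp_all add: comp_def)
    have rel: "c * At l0 v $ i = (1 - c) * Bt l0 v $ i" if i: "i = 1 \<or> i = 2" for i
    proof -
      have "\<exists>x y. x \<in> {0..1} \<and> y \<in> {0..1} \<and> \<bar>x - v\<bar> \<le> \<bar>s k - v\<bar> \<and> \<bar>y - v\<bar> \<le> \<bar>t k - v\<bar> \<and>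
          w k * At (l k) x $ i = (1 - w k) * Bt (l k) y $ i" for k
      proof -
        obtain x where x: "x \<in> {0..1}" "\<bar>x - v\<bar> \<le> \<bar>s k - v\<bar>"
          "A (l k) (s k) $ i - A (l k) v $ i = (s k - v) * At (l k) x $ i"
          using A.mean_value[OF lst(1,2) v01] by blast
        obtain y where y: "y \<in> {0..1}" "\<bar>y - v\<bar> \<le> \<bar>t k - v\<bar>"
          "B (l k) (t k) $ i - B (l k) v $ i = (t k - v) * Bt (l k) y $ i"
          using B.mean_value[OF lst(1,3) v01] by blast
        have "A (l k) (s k) $ i = B (l k) (t k) $ i" by (rule same[OF i])
        then have 1: "(s k - v) * At (l k) x $ i = (t k - v) * Bt (l k) y $ i"
          using x(3) y(3) ends[OF lst(1) v] by simp
        have "\<not> (s k = v \<and> t k = v)"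
          using ne[of k] ends[OF lst(1)[of k] v] by auto
        then have pos: "\<bar>s k - v\<bar> + \<bar>t k - v\<bar> > 0" by linarith
        have "\<bar>s k - v\<bar> * At (l k) x $ i = \<bar>t k - v\<bar> * Bt (l k) y $ i"
          using 1 v lst(2,3)[of k] by (auto simp: abs_if algebra_simps)
        moreover have "1 - w k = \<bar>t k - v\<bar> / (\<bar>s k - v\<bar> + \<bar>t k - v\<bar>)"
          using pos by (simp add: w_def field_simps)
        ultimately have "w k * At (l k) x $ i = (1 - w k) * Bt (l k) y $ i"
          by (simp add: w_def)
        then show ?thesis using x y by blast
      qed
      then obtain x y where xy: "\<And>k. x k \<in> {0..1}" "\<And>k. y k \<in> {0..1}" "\<And>k. \<bar>x k - v\<bar> \<le> \<bar>s k - v\<bar>" "\<And>k. \<bar>y k - v\<bar> \<le> \<bar>t k - v\<bar>"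
        "\<And>k. w k * At (l k) (x k) $ i = (1 - w k) * Bt (l k) (y k) $ i" by metis
      have sq: "(\<lambda>k. g (r k)) \<longlonglongrightarrow> v" if "\<And>k. \<bar>g k - v\<bar> \<le> \<bar>h k - v\<bar>" "(\<lambda>k. h (r k)) \<longlonglongrightarrow> v" for g h :: "nat \<Rightarrow> real"
      proof -
        have "(\<lambda>k. g (r k) - v) \<longlonglongrightarrow> 0"
        proof (rule Lim_null_comparison)
          show "\<forall>\<^sub>F k in sequentially. norm (g (r k) - v) \<le> \<bar>h (r k) - v\<bar>" using that(1) by simp
          have "(\<lambda>k. \<bar>h (r k) - v\<bar>) \<longlonglongrightarrow> \<bar>v - v\<bar>" by (intro tendsto_intros that)
          then show "(\<lambda>k. \<bar>h (r k) - v\<bar>) \<longlonglongrightarrow> 0" by simp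
        qed
        from tendsto_add[OF this tendsto_const[of v]] show ?thesis by simp
      qed
      have xl: "(\<lambda>k. x (r k)) \<longlonglongrightarrow> v" by (rule sq[OF xy(3) limr(2)])
      have yl: "(\<lambda>k. y (r k)) \<longlonglongrightarrow> v" by (rule sq[OF xy(4) limr(3)])
      have "(\<lambda>k. w (r k) * At (l (r k)) (x (r k)) $ i) \<longlonglongrightarrow> c * At l0 v $ i"
        by (intro tendsto_mult limr tendsto_vec_nth A.tendsto_at_point(2) z01 lst xy xl v01)
      moreover have "(\<lambda>k. (1 - w (r k)) * Bt (l (r k)) (y (r k)) $ i) \<longlonglongrightarrow> (1 - c) * Bt l0 v $ i"
        by (intro tendsto_mult tendsto_diff tendsto_const limr tendsto_vec_nth B.tendsto_at_point(2) z01 lst xy yl v01)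
      ultimately show ?thesis unfolding xy(5) by (rule LIMSEQ_unique)
    qed
    have nzA: "At l0 v $ 1 \<noteq> 0 \<or> At l0 v $ 2 \<noteq> 0" and nzB: "Bt l0 v $ 1 \<noteq> 0 \<or> Bt l0 v $ 2 \<noteq> 0"
      using legendrian_vel_nonzero[OF legA[OF z01(1)] v01] legendrian_vel_nonzero[OF legB[OF z01(1)] v01]
      by (simp_all add: A.vel_eq[OF z01(1) v01] B.vel_eq[OF z01(1) v01])
    have "c \<noteq> 0" "c \<noteq> 1" using rel[of 1] rel[of 2] nzA nzB by auto
    then have "0 < c" "c < 1" using c(1) by auto
    then have c2: "0 < (1 - c) / c" by simp
    have comp: "At l0 v $ i = (1 - c) / c * Bt l0 v $ i" if "i = 1 \<or> i = 2" for i
      using rel[OF that] \<open>0 < c\<close> by (simp add: field_simps)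
    have "sgn (vel (A l0) v) = sgn (vel (B l0) v)"
    proof (rule xi_std_sgn_eq[of _ "A l0 v" _ "(1 - c) / c"])
      show "vel (A l0) v \<in> xi_std (A l0 v)" using legA[OF z01(1)] v01 by (simp add: legendrian_arc_def)
      show "vel (B l0) v \<in> xi_std (A l0 v)" using legB[OF z01(1)] v01 ends[OF z01(1) v] by (simp add: legendrian_arc_def)
    qed (use c2 comp[of 1] comp[of 2] in \<open>simp_all add: A.vel_eq[OF z01(1) v01] B.vel_eq[OF z01(1) v01]\<close>)
    then show False using tang[OF z01(1) v] by blast
  qed
qed

lemma eventually_avoids_cube:
  fixes d :: "'a :: metric_space \<Rightarrow> real^3"
  assumes "compact S" "continuous_on S d" "\<And>z. z \<in> S \<Longrightarrow> d z \<noteq> 0"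
  shows "\<forall>\<^sub>F \<kappa> in at_right 0. \<forall>z\<in>S. avoids_cube \<kappa> (d z)"
proof (cases "S = {}")
  case False
  define m where "m z = max \<bar>d z $ 1\<bar> (max \<bar>d z $ 2\<bar> \<bar>d z $ 3\<bar>)" for z
  have "continuous_on S m" unfolding m_def by (intro continuous_intros assms)
  then obtain y where y: "y \<in> S" "\<And>z. z \<in> S \<Longrightarrow> m y \<le> m z"
    using continuous_attains_inf[OF assms(1) False] by blast
  have "m y > 0" using assms(3)[OF y(1)] by (auto simp: m_def vec3_eq_iff less_max_iff_disj)
  moreover have "avoids_cube \<kappa> (d z)" if "z \<in> S" "\<kappa> < m y" for \<kappa> z
    using y(2)[OF that(1)] that(2) unfolding avoids_cube_def m_def by linarith
  ultimately show ?thesis by (auto simp: eventually_at_right_field intro!: exI[of _ "m y"])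
qed simp

section \<open>Tangent angles\<close>

lemma angle_lift:
  fixes F :: "real \<Rightarrow> real \<Rightarrow> real^3"
  assumes "arc_homotopy F Ft Fl Flt" and leg: "\<And>l. l \<in> {0..1} \<Longrightarrow> legendrian_arc (F l)"
  obtains \<theta> r where "continuous_on ({0..1} \<times> {0..1}) (\<lambda>z. \<theta> (fst z) (snd z))"
    "\<And>l t. l \<in> {0..1} \<Longrightarrow> t \<in> {0..1} \<Longrightarrow> 0 < r l t \<and>
       vel (F l) t $ 1 = r l t * cos (\<theta> l t) \<and> vel (F l) t $ 2 = r l t * sin (\<theta> l t)"
proof -
  interpret arc_homotopy F Ft Fl Flt by fact
  define \<zeta> where "\<zeta> z = Complex (Ft (fst z) (snd z) $ 1) (Ft (fst z) (snd z) $ 2)" for z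
  have "continuous_on ({0..1} \<times> {0..1}) \<zeta>"
    unfolding \<zeta>_def[abs_def] Complex_eq by (intro continuous_intros cont)
  moreover have "contractible ({0..1::real} \<times> {0..1::real})"
    by (intro convex_imp_contractible convex_Times convex_real_interval)
  moreover have "\<zeta> z \<noteq> 0" if "z \<in> {0..1} \<times> {0..1}" for z
    using legendrian_vel_nonzero[OF leg, of "fst z" "snd z"] that
    by (auto simp: \<zeta>_def complex_eq_iff vel_eq)
  ultimately obtain g where g: "continuous_on ({0..1} \<times> {0..1}) g" "\<And>z. z \<in> {0..1} \<times> {0..1} \<Longrightarrow> \<zeta> z = exp (g z)"
    using continuous_logarithm_on_contractible by metis
  define \<theta> where "\<theta> l t = Im (g (l, t))" for l t
  define r where "r l t = exp (Re (g (l, t)))" for l t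
  show thesis
  proof (rule that[of \<theta> r])
    show "continuous_on ({0..1} \<times> {0..1}) (\<lambda>z. \<theta> (fst z) (snd z))"
      using continuous_on_Im[OF g(1)] by (simp add: \<theta>_def)
    fix l t :: real assume lt: "l \<in> {0..1}" "t \<in> {0..1}"
    have "\<zeta> (l, t) = exp (g (l, t))" using g(2) lt by simp
    then have "Re (\<zeta> (l, t)) = r l t * cos (\<theta> l t)" "Im (\<zeta> (l, t)) = r l t * sin (\<theta> l t)"
      by (simp_all add: r_def \<theta>_def Re_exp Im_exp)
    then show "0 < r l t \<and> vel (F l) t $ 1 = r l t * cos (\<theta> l t) \<and> vel (F l) t $ 2 = r l t * sin (\<theta> l t)"
      by (simp add: r_def \<zeta>_def vel_eq[OF lt])
  qed
qed

lemma floor_constant: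
  fixes f :: "real \<Rightarrow> real"
  assumes cont: "continuous_on {0..1} f" and nonint: "\<And>s. s \<in> {0..1} \<Longrightarrow> f s \<notin> \<int>"
  shows "\<lfloor>f 0\<rfloor> = \<lfloor>f 1\<rfloor>"
proof (rule ccontr)
  assume "\<lfloor>f 0\<rfloor> \<noteq> \<lfloor>f 1\<rfloor>"
  then consider "f 0 < of_int \<lfloor>f 1\<rfloor>" | "f 1 < of_int \<lfloor>f 0\<rfloor>" by linarith
  then show False
  proof cases
    case 1
    then have "\<exists>s\<ge>0. s \<le> 1 \<and> f s = of_int \<lfloor>f 1\<rfloor>" by (intro IVT') (use cont in auto)
    then show False using nonint by (metis Ints_of_int atLeastAtMost_iff)
  next
    case 2
    then have "\<exists>s\<ge>0. s \<le> 1 \<and> f s = of_int \<lfloor>f 0\<rfloor>" by (intro IVT2') (use cont in auto)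
    then show False using nonint by (metis Ints_of_int atLeastAtMost_iff)
  qed
qed

lemma integer_valued_constant:
  fixes f :: "real \<Rightarrow> real"
  assumes "continuous_on {0..1} f" "\<And>t. t \<in> {0..1} \<Longrightarrow> f t \<in> \<int>"
  shows "f 0 = f 1"
proof -
  have "f s + 1 / 2 \<notin> \<int>" if "s \<in> {0..1}" for s
  proof
    assume "f s + 1 / 2 \<in> \<int>"
    from Ints_diff[OF this assms(2)[OF that]] have "1 / 2 \<in> (\<int> :: real set)" by simp
    then obtain k :: int where "1 / 2 = (of_int k :: real)" by (elim Ints_cases)
    then have "(1::real) = of_int (2 * k)" by simp
    then have "1 = 2 * k" by linarith
    then show False by presburger
  qed
  from floor_constant[of "\<lambda>s. f s + 1/2", OF continuous_on_add[OF assms(1) continuous_on_const] this]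
  have "\<lfloor>f 0 + 1 / 2\<rfloor> = \<lfloor>f 1 + 1 / 2\<rfloor>" .
  moreover obtain a b :: int where "f 0 = of_int a" "f 1 = of_int b"
    using assms(2)[of 0] assms(2)[of 1] by (auto elim!: Ints_cases)
  ultimately show ?thesis by (simp add: floor_eq_iff; linarith)
qed

text \<open>
  The arc \<open>a\<close> runs along the lift of \<open>f\<close>, in either direction and with any parametrisation.
\<close>

definition traces :: "real poly \<Rightarrow> (real \<Rightarrow> real^3) \<Rightarrow> bool" where
  "traces f a \<longleftrightarrow> (\<forall>t\<in>{0..1}. a t $ 1 \<in> {0..1} \<and> a t = front_lift f (a t $ 1))"

lemma traces_vel:
  assumes tr: "traces f a" and d: "(a has_vector_derivative vel a t) (at t within {0..1})" and t: "t \<in> {0..1}"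
  shows "vel a t = pt (vel a t $ 1) (vel a t $ 1 * poly (pderiv (pderiv f)) (a t $ 1)) (vel a t $ 1 * poly (pderiv f) (a t $ 1))"
proof -
  note u = has_real_derivative_component[OF d, of 1]
  have "((\<lambda>t. front_lift f (a t $ 1)) has_vector_derivative
     pt (vel a t $ 1) (vel a t $ 1 * poly (pderiv (pderiv f)) (a t $ 1)) (vel a t $ 1 * poly (pderiv f) (a t $ 1))) (at t within {0..1})"
    unfolding front_lift_def
    by (intro has_vector_derivative_pt u)
       (use DERIV_chain2[OF poly_DERIV u] in \<open>simp_all add: mult.commute\<close>)
  then have "(a has_vector_derivative
     pt (vel a t $ 1) (vel a t $ 1 * poly (pderiv (pderiv f)) (a t $ 1)) (vel a t $ 1 * poly (pderiv f) (a t $ 1))) (at t within {0..1})"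
    by (rule has_vector_derivative_transform[OF t, rotated]) (use tr in \<open>auto simp: traces_def\<close>)
  from vel_eqI[OF t this] show ?thesis .
qed

lemma same_direction_angle:
  assumes "0 < r" "0 < r'" "r * cos x = r' * cos y" "r * sin x = r' * sin y"
  shows "(x - y) / (2 * pi) \<in> \<int>"
proof -
  have "r\<^sup>2 = (r * cos x)\<^sup>2 + (r * sin x)\<^sup>2" by (simp add: power_mult_distrib distrib_left[symmetric])
  also have "\<dots> = r'\<^sup>2" unfolding assms(3,4) by (simp add: power_mult_distrib distrib_left[symmetric])
  finally have "r = r'" using assms(1,2) by simp
  then have "sin x = sin y \<and> cos x = cos y" using assms by auto
  then obtain n :: int where "x = y + 2 * pi * n" using sin_cos_eq_iff by blast
  then show ?thesis by simp
qed

text \<open>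
  Along a lift the \<open>x\<close>-velocity never vanishes, so the angle stays in one half plane: up to whole
  turns it is the arctangent of \<open>f''\<close>, increased by \<open>\<pi>\<close> if the lift is traversed backwards. The number
  of whole turns is the same at both ends.
\<close>

lemma traces_angle:
  assumes tr: "traces f a"
    and d: "\<And>t. t \<in> {0..1} \<Longrightarrow> (a has_vector_derivative vel a t) (at t within {0..1})"
    and cv: "continuous_on {0..1} (vel a)"
    and c\<theta>: "continuous_on {0..1} \<theta>"
    and pol: "\<And>t. t \<in> {0..1} \<Longrightarrow> 0 < r t \<and> vel a t $ 1 = r t * cos (\<theta> t) \<and> vel a t $ 2 = r t * sin (\<theta> t)"
  obtains m :: int where "\<And>t. t = 0 \<or> t = 1 \<Longrightarrow> \<theta> t = arctan (poly (pderiv (pderiv f)) (a t $ 1)) + (if a 0 $ 1 \<le> a 1 $ 1 then 0 else pi) + 2 * pi * m"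
proof -
  define y where "y t = poly (pderiv (pderiv f)) (a t $ 1)" for t
  have v: "vel a t $ 2 = vel a t $ 1 * y t" if "t \<in> {0..1}" for t
    using traces_vel[OF tr d[OF that] that] unfolding y_def by (metis pt_nth(2))
  have nz: "vel a t $ 1 \<noteq> 0" if "t \<in> {0..1}" for t
  proof
    assume 0: "vel a t $ 1 = 0"
    then have "cos (\<theta> t) = 0" "sin (\<theta> t) = 0" using pol[OF that] v[OF that] by auto
    then show False using sin_cos_squared_add[of "\<theta> t"] by simp
  qed
  have ca: "continuous_on {0..1} a"
    using d by (meson continuous_on_eq_continuous_within has_vector_derivative_continuous)
  have "\<exists>\<sigma>. (\<sigma> = 1 \<or> \<sigma> = -1) \<and> (\<forall>t\<in>{0..1}. 0 < \<sigma> * vel a t $ 1)"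
  proof (cases "vel a 0 $ 1 > 0")
    case True
    have "vel a t $ 1 > 0" if "t \<in> {0..1}" for t
    proof (rule ccontr)
      assume "\<not> ?thesis"
      then have "\<exists>s\<ge>0. s \<le> t \<and> vel a s $ 1 = 0"
        using True that by (intro IVT2') (auto intro!: continuous_intros continuous_on_subset[OF cv])
      then show False using nz that by force
    qed
    then show ?thesis by (intro exI[of _ 1]) auto
  next
    case False
    have "vel a t $ 1 < 0" if "t \<in> {0..1}" for t
    proof (rule ccontr)
      assume "\<not> ?thesis"
      then have "\<exists>s\<ge>0. s \<le> t \<and> vel a s $ 1 = 0"
        using False that by (intro IVT') (auto intro!: continuous_intros continuous_on_subset[OF cv])
      then show False using nz that by force
    qed
    then show ?thesis by (intro exI[of _ "-1"]) auto
  qed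
  then obtain \<sigma> :: real where \<sigma>: "\<sigma> = 1 \<or> \<sigma> = -1" "\<And>t. t \<in> {0..1} \<Longrightarrow> 0 < \<sigma> * vel a t $ 1" by blast
  have "\<exists>x\<in>{0<..<1}. a 1 $ 1 - a 0 $ 1 = vel a x $ 1 * (1 - 0)"
    by (rule mvt_simple[of 0 1 "\<lambda>t. a t $ 1" "\<lambda>x. (*) (vel a x $ 1)"])
       (use has_real_derivative_component[OF d] in \<open>auto simp: has_field_derivative_def\<close>)
  then obtain x where "x \<in> {0<..<1}" "a 1 $ 1 - a 0 $ 1 = vel a x $ 1 * (1 - 0)" by blast
  then have x: "x \<in> {0..1}" "a 1 $ 1 - a 0 $ 1 = vel a x $ 1" by auto
  then have s1: "(if a 0 $ 1 \<le> a 1 $ 1 then 0 else pi) = (if \<sigma> = 1 then 0 else pi)"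
    using \<sigma>(1) \<sigma>(2)[OF x(1)] by auto
  define \<psi> where "\<psi> t = arctan (y t) + (if \<sigma> = 1 then 0 else pi)" for t
  have cos\<psi>: "cos (\<psi> t) = \<sigma> * (1 / sqrt (1 + (y t)\<^sup>2))" "sin (\<psi> t) = \<sigma> * (y t / sqrt (1 + (y t)\<^sup>2))" for t
    using \<sigma>(1) by (auto simp: \<psi>_def cos_arctan sin_arctan)
  have "(\<theta> t - \<psi> t) / (2 * pi) \<in> \<int>" if t: "t \<in> {0..1}" for t
  proof (rule same_direction_angle)
    have p: "0 < sqrt (1 + (y t)\<^sup>2)" by (simp add: add_pos_nonneg)
    show "0 < r t" using pol[OF t] by blast
    show "0 < \<sigma> * vel a t $ 1 * sqrt (1 + (y t)\<^sup>2)" using \<sigma>(2)[OF t] p by simp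
    have s2: "\<sigma> * \<sigma> = 1" using \<sigma>(1) by auto
    have "\<sigma> * vel a t $ 1 * sqrt (1 + (y t)\<^sup>2) * cos (\<psi> t) = (\<sigma> * \<sigma>) * vel a t $ 1 * (sqrt (1 + (y t)\<^sup>2) / sqrt (1 + (y t)\<^sup>2))"
      by (simp add: cos\<psi> algebra_simps)
    also have "\<dots> = vel a t $ 1" using p s2 by simp
    finally show "r t * cos (\<theta> t) = \<sigma> * vel a t $ 1 * sqrt (1 + (y t)\<^sup>2) * cos (\<psi> t)" using pol[OF t] by simp
    have "\<sigma> * vel a t $ 1 * sqrt (1 + (y t)\<^sup>2) * sin (\<psi> t) = (\<sigma> * \<sigma>) * (vel a t $ 1 * y t) * (sqrt (1 + (y t)\<^sup>2) / sqrt (1 + (y t)\<^sup>2))"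
      by (simp add: cos\<psi> algebra_simps)
    also have "\<dots> = vel a t $ 2" using p s2 v[OF t] by simp
    finally show "r t * sin (\<theta> t) = \<sigma> * vel a t $ 1 * sqrt (1 + (y t)\<^sup>2) * sin (\<psi> t)" using pol[OF t] by simp
  qed
  moreover have "continuous_on {0..1} (\<lambda>t. (\<theta> t - \<psi> t) / (2 * pi))"
    unfolding \<psi>_def y_def by (intro continuous_intros continuous_on_arctan c\<theta> ca) auto
  ultimately have eq: "(\<theta> 0 - \<psi> 0) / (2 * pi) = (\<theta> 1 - \<psi> 1) / (2 * pi)" and "(\<theta> 0 - \<psi> 0) / (2 * pi) \<in> \<int>"
    using integer_valued_constant[of "\<lambda>t. (\<theta> t - \<psi> t) / (2 * pi)"] by auto
  then obtain m :: int where m: "(\<theta> 0 - \<psi> 0) / (2 * pi) = m" by (auto elim: Ints_cases)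
  have "\<theta> t = \<psi> t + 2 * pi * m" if "t = 0 \<or> t = 1" for t
    using that m eq by (auto simp: field_simps)
  then show thesis using s1 that[of m] by (simp add: \<psi>_def y_def)
qed

lemma floor_angle_difference:
  fixes m :: int
  assumes "\<bar>a\<bar> < 2 * pi" "a \<noteq> 0"
  shows "\<lfloor>(a + 2 * pi * m) / (2 * pi)\<rfloor> = (if 0 < a then m else m - 1)"
proof -
  have "(a + 2 * pi * m) / (2 * pi) = a / (2 * pi) + m" by (simp add: add_divide_distrib)
  moreover have "-1 < a / (2 * pi)" "a / (2 * pi) < 1" using assms by (auto simp: field_simps)
  moreover have "0 < a / (2 * pi) \<longleftrightarrow> 0 < a" "a / (2 * pi) < 0 \<longleftrightarrow> a < 0" by (simp_all add: zero_less_divide_iff divide_less_0_iff)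
  ultimately show ?thesis using assms(2) by (auto simp: floor_eq_iff)
qed

section \<open>Humps of a function\<close>

text \<open>
  What the linking integrand becomes for the difference \<open>e\<close> of two fronts after one of the two
  integrations. It is the derivative of \<open>smooth_step\<close> along the slope of \<open>e\<close>, weighted by a factor that
  is constant below the level \<open>-\<epsilon> - \<kappa>\<close> and zero above \<open>-\<epsilon> + \<kappa>\<close>.
\<close>

definition hump_form :: "real \<Rightarrow> real \<Rightarrow> real poly \<Rightarrow> real \<Rightarrow> real" where
  "hump_form \<kappa> \<epsilon> e x = (step_height \<kappa> - smooth_step \<kappa> (poly e x + \<epsilon>)) *
     (bump \<kappa> (poly (pderiv e) x) * poly (pderiv (pderiv e)) x)"

lemma continuous_on_hump_form: "continuous_on S u \<Longrightarrow> continuous_on S (\<lambda>x. hump_form \<kappa> \<epsilon> e (u x))"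
  unfolding hump_form_def by (intro continuous_intros continuous_on_spline)

lemma continuous_on_real_poly: "continuous_on S (poly (e :: real poly))"
  by (rule continuous_on_poly[OF continuous_on_id])

lemma eventually_at_right_less: "0 < (b::real) \<Longrightarrow> \<forall>\<^sub>F x in at_right 0. 0 < x \<and> x < b"
  by (auto simp: eventually_at_right_field)

lemma eventually_regular_level:
  assumes "pderiv e \<noteq> (0 :: real poly)"
  shows "\<forall>\<^sub>F \<epsilon> in at_right 0. \<forall>x. poly (pderiv e) x = 0 \<longrightarrow> poly e x \<noteq> - \<epsilon>"
proof -
  have "finite ((\<lambda>x. - poly e x) ` {x. poly (pderiv e) x = 0})"
    using poly_roots_finite[OF assms] by simp
  from finite_set_avoid[OF this, of 0] obtain d where d: "d > 0"
    "\<And>x. poly (pderiv e) x = 0 \<Longrightarrow> - poly e x \<noteq> 0 \<Longrightarrow> d \<le> dist 0 (- poly e x)" by auto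
  have "\<forall>x. poly (pderiv e) x = 0 \<longrightarrow> poly e x \<noteq> - \<epsilon>" if "0 < \<epsilon> \<and> \<epsilon> < d" for \<epsilon>
    using d(2) that by force
  then show ?thesis using eventually_at_right_less[OF d(1)] by (auto elim: eventually_mono)
qed

text \<open>
  For small \<open>\<epsilon>\<close> the graph is below \<open>-\<epsilon>\<close> exactly between two points \<open>p < q\<close>: near the ends
  \<open>e\<close> is strictly monotone, and in between it is bounded away from \<open>0\<close>. For small \<open>\<kappa>\<close> the weight is constant
  wherever the bump is nonzero, so the integral is the increment of the step between a
  steep descent at \<open>p\<close> and a steep ascent at \<open>q\<close>.
\<close>

lemma negative_hump_integral:
  fixes e :: "real poly"
  assumes ab: "a < b" and ends: "poly e a = 0" "poly e b = 0" and neg: "\<And>x. a < x \<Longrightarrow> x < b \<Longrightarrow> poly e x < 0"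
  shows "\<forall>\<^sub>F \<epsilon> in at_right 0. \<forall>\<^sub>F \<kappa> in at_right 0. integral {a..b} (hump_form \<kappa> \<epsilon> e) = (step_height \<kappa>)\<^sup>2"
proof -
  have nz: "pderiv e \<noteq> 0"
  proof
    assume "pderiv e = 0"
    then obtain c where "e = [:c:]" using pderiv_iszero by blast
    then show False using ends(1) neg[of "(a + b) / 2"] ab by auto
  qed
  have fin: "finite {x. poly (pderiv e) x = 0}" by (rule poly_roots_finite[OF nz])
  obtain da where da: "da > 0" "\<And>x. poly (pderiv e) x = 0 \<Longrightarrow> x \<noteq> a \<Longrightarrow> da \<le> dist a x"
    using finite_set_avoid[OF fin, of a] by auto
  obtain db where db: "db > 0" "\<And>x. poly (pderiv e) x = 0 \<Longrightarrow> x \<noteq> b \<Longrightarrow> db \<le> dist b x"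
    using finite_set_avoid[OF fin, of b] by auto
  \<comment> \<open>no critical point within \<open>\<eta>\<close> of either end, so that \<open>e\<close> is monotone there\<close>
  define \<eta> where "\<eta> = min (min da db) ((b - a) / 2)"
  have \<eta>: "0 < \<eta>" "\<eta> \<le> da" "\<eta> \<le> db" "a + \<eta> \<le> b - \<eta>" using da(1) db(1) ab unfolding \<eta>_def by (simp, linarith, linarith, simp add: min_def field_simps)
  have nra: "poly (pderiv e) x \<noteq> 0" if "a < x" "x < a + \<eta>" for x
    using da(2)[of x] that \<eta> by (auto simp: dist_real_def)
  have nrb: "poly (pderiv e) x \<noteq> 0" if "b - \<eta> < x" "x < b" for x
    using db(2)[of x] that \<eta> by (auto simp: dist_real_def)
  have sa: "poly (pderiv e) x < 0" if x: "a < x" "x < a + \<eta>" for x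
  proof (rule ccontr)
    assume "\<not> ?thesis"
    then have pos: "poly (pderiv e) x > 0" using nra[OF x] by simp
    have "poly (pderiv e) y > 0" if "a < y" "y < x" for y
    proof (rule ccontr)
      assume "\<not> ?thesis"
      then have "\<exists>z\<ge>y. z \<le> x \<and> poly (pderiv e) z = 0"
        using pos that by (intro IVT') (auto intro!: continuous_intros)
      then show False using nra that x by force
    qed
    then have "poly e a < poly e x"
      by (intro DERIV_pos_imp_increasing_open[of a x "poly e"]) (use x in \<open>auto intro!: exI poly_DERIV continuous_intros\<close>)
    then show False using ends neg[of x] x \<eta> by simp
  qed
  have sb: "poly (pderiv e) x > 0" if x: "b - \<eta> < x" "x < b" for x
  proof (rule ccontr)
    assume "\<not> ?thesis"
    then have pos: "poly (pderiv e) x < 0" using nrb[OF x] by simp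
    have "poly (pderiv e) y < 0" if "x < y" "y < b" for y
    proof (rule ccontr)
      assume "\<not> ?thesis"
      then have "\<exists>z\<ge>x. z \<le> y \<and> poly (pderiv e) z = 0"
        using pos that by (intro IVT') (auto intro!: continuous_intros)
      then show False using nrb that x by force
    qed
    then have "poly e b < poly e x"
      by (intro DERIV_neg_imp_decreasing_open[of x b "poly e"]) (use x in \<open>auto intro!: exI poly_DERIV continuous_intros\<close>)
    then show False using ends neg[of x] x \<eta> by simp
  qed
  obtain y where y: "y \<in> {a + \<eta>..b - \<eta>}" "\<And>x. x \<in> {a + \<eta>..b - \<eta>} \<Longrightarrow> poly e x \<le> poly e y"
    using continuous_attains_sup[OF compact_Icc _ continuous_on_real_poly, of "a + \<eta>" "b - \<eta>" e] \<eta> by auto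
  define m where "m = - poly e y"
  have m: "m > 0" using neg[of y] y(1) \<eta> by (auto simp: m_def)
  have main: "\<forall>\<^sub>F \<kappa> in at_right 0. integral {a..b} (hump_form \<kappa> \<epsilon> e) = (step_height \<kappa>)\<^sup>2"
    if \<epsilon>: "0 < \<epsilon> \<and> \<epsilon> < m" and reg: "\<forall>x. poly (pderiv e) x = 0 \<longrightarrow> poly e x \<noteq> - \<epsilon>" for \<epsilon>
  proof -
    have mid: "poly e x < - \<epsilon>" if "x \<in> {a + \<eta>..b - \<eta>}" for x
      using y(2)[OF that] \<epsilon> by (simp add: m_def)
    have ea: "poly e (a + \<eta>) < - \<epsilon>" "poly e (b - \<eta>) < - \<epsilon>" using mid \<eta> by auto
    have "\<exists>p\<ge>a. p \<le> a + \<eta> \<and> poly e p = - \<epsilon>"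
      by (rule IVT2') (use ea ends \<epsilon> \<eta> in \<open>auto intro!: continuous_intros\<close>)
    then obtain p where p: "a \<le> p" "p \<le> a + \<eta>" "poly e p = - \<epsilon>" by blast
    have "\<exists>q\<ge>b - \<eta>. q \<le> b \<and> poly e q = - \<epsilon>"
      by (rule IVT') (use ea ends \<epsilon> \<eta> in \<open>auto intro!: continuous_intros\<close>)
    then obtain q where q: "b - \<eta> \<le> q" "q \<le> b" "poly e q = - \<epsilon>" by blast
    have p': "a < p" "p < a + \<eta>" using p ends \<epsilon> ea by (auto simp: order_less_le)
    have q': "b - \<eta> < q" "q < b" using q ends \<epsilon> ea by (auto simp: order_less_le)
    have decr: "poly e z < poly e x" if "a \<le> x" "x < z" "z \<le> a + \<eta>" for x z
      by (rule DERIV_neg_imp_decreasing_open[of x z "poly e"])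
        (use that sa in \<open>auto intro!: exI poly_DERIV continuous_intros\<close>)
    have incr: "poly e x < poly e z" if "b - \<eta> \<le> x" "x < z" "z \<le> b" for x z
      by (rule DERIV_pos_imp_increasing_open[of x z "poly e"])
        (use that sb in \<open>auto intro!: exI poly_DERIV continuous_intros\<close>)
    have above: "poly e x \<ge> - \<epsilon>" if "x \<in> {a..p} \<or> x \<in> {q..b}" for x
      using that decr[of x p] incr[of q x] p q p' q' by (cases "x = p"; cases "x = q") auto
    have below: "poly e x \<le> - \<epsilon>" if "x \<in> {p..q}" for x
    proof -
      consider "x \<le> a + \<eta>" | "x \<in> {a + \<eta>..b - \<eta>}" | "x \<ge> b - \<eta>" by force
      then show ?thesis
        using that decr[of p x] incr[of x q] p q p' q' mid[of x] by cases (cases "x = p"; cases "x = q"; force)+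
    qed
    define D where "D x = pt (poly (pderiv e) x) 0 (poly e x + \<epsilon>)" for x
    have "\<forall>\<^sub>F \<kappa> in at_right 0. \<forall>x\<in>{a..b}. avoids_cube \<kappa> (D x)"
      by (rule eventually_avoids_cube) (use reg in \<open>auto simp: D_def[abs_def] vec3_eq_iff intro!: continuous_intros\<close>)
    moreover have "\<forall>\<^sub>F \<kappa> in at_right (0::real). 0 < \<kappa> \<and> \<kappa> < 1" by (rule eventually_at_right_less) simp
    ultimately show ?thesis
    proof eventually_elim
      case (elim \<kappa>)
      then have \<kappa>: "0 < \<kappa>" and av: "\<And>x. x \<in> {a..b} \<Longrightarrow> \<kappa> \<le> \<bar>poly (pderiv e) x\<bar> \<or> \<kappa> \<le> \<bar>poly e x + \<epsilon>\<bar>"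
        by (auto simp: avoids_cube_def D_def)
      have out: "hump_form \<kappa> \<epsilon> e x = 0" if "x \<in> {a..p} \<or> x \<in> {q..b}" for x
      proof -
        have "x \<in> {a..b}" using that p q p' q' \<eta> by auto
        from av[OF this] above[OF that] show ?thesis
          using bump_outside[OF \<kappa>, of "poly (pderiv e) x"] smooth_step_right[OF \<kappa>, of "poly e x + \<epsilon>"]
          by (auto simp: hump_form_def)
      qed
      have ins: "hump_form \<kappa> \<epsilon> e x = step_height \<kappa> * (bump \<kappa> (poly (pderiv e) x) * poly (pderiv (pderiv e)) x)"
        if "x \<in> {p..q}" for x
      proof -
        have "x \<in> {a..b}" using that p q p' q' \<eta> by auto
        from av[OF this] below[OF that] show ?thesis
          using bump_outside[OF \<kappa>, of "poly (pderiv e) x"] smooth_step_left[OF \<kappa>, of "poly e x + \<epsilon>"]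
          by (auto simp: hump_form_def)
      qed
      have pq: "p \<le> q" using p' q' \<eta> by simp
      have I1: "(hump_form \<kappa> \<epsilon> e has_integral 0) {a..p}"
        by (rule has_integral_is_0) (use out in auto)
      have I3: "(hump_form \<kappa> \<epsilon> e has_integral 0) {q..b}"
        by (rule has_integral_is_0) (use out in auto)
      have "((\<lambda>x. step_height \<kappa> * (bump \<kappa> (poly (pderiv e) x) * poly (pderiv (pderiv e)) x)) has_integral
         step_height \<kappa> * smooth_step \<kappa> (poly (pderiv e) q) - step_height \<kappa> * smooth_step \<kappa> (poly (pderiv e) p)) {p..q}"
      proof (rule fundamental_theorem_of_calculus[OF pq])
        fix x
        have "((\<lambda>x. step_height \<kappa> * smooth_step \<kappa> (poly (pderiv e) x)) has_real_derivative
           step_height \<kappa> * (bump \<kappa> (poly (pderiv e) x) * poly (pderiv (pderiv e)) x)) (at x within {p..q})"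
          by (intro DERIV_cmult DERIV_chain2[OF DERIV_smooth_step] has_field_derivative_at_within[OF poly_DERIV])
        then show "((\<lambda>x. step_height \<kappa> * smooth_step \<kappa> (poly (pderiv e) x)) has_vector_derivative
           step_height \<kappa> * (bump \<kappa> (poly (pderiv e) x) * poly (pderiv (pderiv e)) x)) (at x within {p..q})"
          by (simp add: has_real_derivative_iff_has_vector_derivative)
      qed
      then have I2: "(hump_form \<kappa> \<epsilon> e has_integral
         step_height \<kappa> * smooth_step \<kappa> (poly (pderiv e) q) - step_height \<kappa> * smooth_step \<kappa> (poly (pderiv e) p)) {p..q}"
        by (rule has_integral_eq[rotated]) (use ins in auto)
      have "smooth_step \<kappa> (poly (pderiv e) q) = step_height \<kappa>"
        using av[of q] q q' p' \<eta> sb[OF q'] \<kappa> by (intro smooth_step_right) auto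
      moreover have "smooth_step \<kappa> (poly (pderiv e) p) = 0"
        using av[of p] p q' p' \<eta> sa[OF p'] \<kappa> by (intro smooth_step_left) auto
      ultimately have "(hump_form \<kappa> \<epsilon> e has_integral 0 + (step_height \<kappa>)\<^sup>2 + 0) {a..b}"
        using has_integral_combine[OF _ _ has_integral_combine[OF _ _ I1 I2] I3] p' q' pq
        by (simp add: power2_eq_square)
      then show ?case by (simp add: integral_unique)
    qed
  qed
  from eventually_at_right_less[OF m] eventually_regular_level[OF nz] show ?thesis
    by eventually_elim (rule main)
qed

lemma nonneg_hump_integral:
  fixes e :: "real poly"
  assumes "\<And>x. x \<in> {a..b} \<Longrightarrow> 0 \<le> poly e x"
  shows "\<forall>\<^sub>F \<epsilon> in at_right 0. \<forall>\<^sub>F \<kappa> in at_right 0. integral {a..b} (hump_form \<kappa> \<epsilon> e) = 0"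
proof -
  have main: "\<forall>\<^sub>F \<kappa> in at_right 0. integral {a..b} (hump_form \<kappa> \<epsilon> e) = 0" if "0 < \<epsilon> \<and> \<epsilon> < 1" for \<epsilon>
  proof -
    have "0 < \<epsilon>" using that by simp
    from eventually_at_right_less[OF this] show ?thesis
    proof eventually_elim
      case (elim \<kappa>)
      have "hump_form \<kappa> \<epsilon> e x = 0" if "x \<in> {a..b}" for x
        using assms[OF that] elim smooth_step_right[of \<kappa> "poly e x + \<epsilon>"] by (simp add: hump_form_def)
      then show ?case by (metis has_integral_is_0 integral_unique)
    qed
  qed
  from eventually_at_right_less[OF zero_less_one] show ?thesis by eventually_elim (rule main)
qed

lemma constant_sign_integral:
  fixes e :: "real poly"
  assumes ab: "a < b" and ends: "poly e a = 0" "poly e b = 0" and sgn: "\<And>x. a < x \<Longrightarrow> x < b \<Longrightarrow> poly e x \<noteq> 0"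
  shows "\<forall>\<^sub>F \<epsilon> in at_right 0. \<forall>\<^sub>F \<kappa> in at_right 0.
    integral {a..b} (hump_form \<kappa> \<epsilon> e) + integral {a..b} (hump_form \<kappa> \<epsilon> (- e)) = (step_height \<kappa>)\<^sup>2"
proof -
  have neg: "\<forall>\<^sub>F \<epsilon> in at_right 0. \<forall>\<^sub>F \<kappa> in at_right 0.
    integral {a..b} (hump_form \<kappa> \<epsilon> e) + integral {a..b} (hump_form \<kappa> \<epsilon> (- e)) = (step_height \<kappa>)\<^sup>2"
    if "poly e a = 0" "poly e b = 0" "\<And>x. a < x \<Longrightarrow> x < b \<Longrightarrow> poly e x < 0" for e :: "real poly"
  proof -
    have nn: "0 \<le> poly (- e) x" if "x \<in> {a..b}" for x
      using \<open>poly e a = 0\<close> \<open>poly e b = 0\<close> \<open>\<And>x. a < x \<Longrightarrow> x < b \<Longrightarrow> poly e x < 0\<close>[of x] that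
      by (cases "x = a"; cases "x = b") auto
    have "\<forall>\<^sub>F \<epsilon> in at_right 0. \<forall>\<^sub>F \<kappa> in at_right 0. integral {a..b} (hump_form \<kappa> \<epsilon> e) = (step_height \<kappa>)\<^sup>2"
      by (rule negative_hump_integral[OF ab that(1,2)]) (rule that(3))
    moreover have "\<forall>\<^sub>F \<epsilon> in at_right 0. \<forall>\<^sub>F \<kappa> in at_right 0. integral {a..b} (hump_form \<kappa> \<epsilon> (- e)) = 0"
      by (rule nonneg_hump_integral) (rule nn)
    ultimately show ?thesis
    proof eventually_elim
      case (elim \<epsilon>)
      from elim show ?case by eventually_elim simp
    qed
  qed
  have "(\<forall>x. a < x \<and> x < b \<longrightarrow> poly e x < 0) \<or> (\<forall>x. a < x \<and> x < b \<longrightarrow> poly e x > 0)"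
  proof (rule ccontr)
    assume "\<not> ?thesis"
    then obtain x y where xy: "a < x" "x < b" "a < y" "y < b" "poly e x > 0" "poly e y < 0"
      using sgn by (metis linorder_neqE)
    have "\<exists>z. min x y \<le> z \<and> z \<le> max x y \<and> poly e z = 0"
    proof (cases "x \<le> y")
      case True
      then show ?thesis using IVT2'[of "poly e" y 0 x] xy continuous_on_real_poly[of _ e] by (simp add: min_def max_def)
    next
      case False
      then show ?thesis using IVT'[of "poly e" y 0 x] xy continuous_on_real_poly[of _ e] by (simp add: min_def max_def)
    qed
    then show False using sgn xy by (metis less_max_iff_disj max_less_iff_conj min_less_iff_conj order_less_le_trans order_le_less_trans)
  qed
  then show ?thesis
  proof
    assume "\<forall>x. a < x \<and> x < b \<longrightarrow> poly e x < 0"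
    then show ?thesis using neg[of e] ends by auto
  next
    assume "\<forall>x. a < x \<and> x < b \<longrightarrow> poly e x > 0"
    then have "\<forall>\<^sub>F \<epsilon> in at_right 0. \<forall>\<^sub>F \<kappa> in at_right 0.
      integral {a..b} (hump_form \<kappa> \<epsilon> (- e)) + integral {a..b} (hump_form \<kappa> \<epsilon> (- (- e))) = (step_height \<kappa>)\<^sup>2"
      using ends by (intro neg) auto
    then show ?thesis by (simp add: add.commute)
  qed
qed

section \<open>The linking integral of front lifts\<close>

lemma link_square_cong:
  assumes "\<And>t. t \<in> {0..1} \<Longrightarrow> a t = a' t" "\<And>t. t \<in> {0..1} \<Longrightarrow> b t = b' t"
  shows "link_square \<kappa> \<epsilon> a b = link_square \<kappa> \<epsilon> a' b'"
proof -
  have v: "vel c t = vel c' t" if "\<And>t. t \<in> {0..1} \<Longrightarrow> c t = c' t" "t \<in> {0..1}" for c c' t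
    unfolding vel_def vector_derivative_def
    by (rule arg_cong[where f = Eps], rule ext, rule has_vector_derivative_cong_ev)
       (use that in \<open>auto intro!: always_eventually\<close>)
  show ?thesis unfolding link_square_def
    by (rule integral_cong) (use assms v[OF assms(1)] v[OF assms(2)] in \<open>auto simp: cbox_Pair_eq\<close>)
qed

text \<open>
  The deformation of a lift of \<open>p\<close> that subtracts a growing multiple of \<open>q\<close> from its front.
\<close>

lemma arc_homotopy_of_trace:
  fixes p q :: "real poly"
  assumes du: "\<And>t. t \<in> {0..1} \<Longrightarrow> (u has_real_derivative u' t) (at t within {0..1})" and cu: "continuous_on {0..1} u'"
  shows "arc_homotopy (\<lambda>l t. pt (u t) (poly (pderiv p) (u t) - l * poly (pderiv q) (u t)) (poly p (u t) - l * poly q (u t)))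
    (\<lambda>l t. pt (u' t) (u' t * poly (pderiv (pderiv p)) (u t) - l * (u' t * poly (pderiv (pderiv q)) (u t))) (u' t * poly (pderiv p) (u t) - l * (u' t * poly (pderiv q) (u t))))
    (\<lambda>l t. pt 0 (- poly (pderiv q) (u t)) (- poly q (u t)))
    (\<lambda>l t. pt 0 (- (u' t * poly (pderiv (pderiv q)) (u t))) (- (u' t * poly (pderiv q) (u t))))"
proof -
  have pu: "((\<lambda>t. poly r (u t)) has_real_derivative u' t * poly (pderiv r) (u t)) (at t within {0..1})" if "t \<in> {0..1}" for r t
    using DERIV_chain2[OF poly_DERIV du[OF that]] by (simp add: mult.commute)
  have lin: "((\<lambda>l. x - l * y) has_real_derivative - y) (at l within {0..1})" for x y l
    by (auto intro!: derivative_eq_intros)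
  have "continuous_on {0..1} u" using du by (rule DERIV_continuous_on)
  then have c: "continuous_on ({0..1} \<times> {0..1}) (\<lambda>z :: real \<times> real. u (snd z))" "continuous_on ({0..1} \<times> {0..1}) (\<lambda>z :: real \<times> real. u' (snd z))"
    using cu by (auto intro!: continuous_on_compose2[OF _ continuous_on_snd[OF continuous_on_id]])
  show ?thesis
    by unfold_locales
      ((intro has_vector_derivative_pt du DERIV_diff DERIV_cmult DERIV_minus DERIV_const pu lin; assumption)
       | (intro continuous_intros c))+
qed

text \<open>
  Parametrisations \<open>u\<close>, \<open>v\<close> of the \<open>x\<close>-interval by two arcs with common ends, and the difference \<open>d\<close>
  of their fronts. Both arcs run to the right or both run to the left.
\<close>

locale parallel_traces =
  fixes u u' v v' :: "real \<Rightarrow> real" and d :: "real poly"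
  assumes du: "\<And>t. t \<in> {0..1} \<Longrightarrow> (u has_real_derivative u' t) (at t within {0..1})" and cu: "continuous_on {0..1} u'"
    and dv: "\<And>t. t \<in> {0..1} \<Longrightarrow> (v has_real_derivative v' t) (at t within {0..1})" and cv: "continuous_on {0..1} v'"
    and u01: "\<And>t. t \<in> {0..1} \<Longrightarrow> u t \<in> {0..1}"
    and ends: "(u 0 = 0 \<and> u 1 = 1 \<and> v 0 = 0 \<and> v 1 = 1) \<or> (u 0 = 1 \<and> u 1 = 0 \<and> v 0 = 1 \<and> v 1 = 0)"
    and d_ends: "poly d 0 = 0" "poly d 1 = 0"
begin

lemma continuous_on_params: "continuous_on {0..1} u" "continuous_on {0..1} v"
  using DERIV_continuous_on[OF du] DERIV_continuous_on[OF dv] by blast+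

text \<open>
  The hump form vanishes unless \<open>u s\<close> has distance more than \<open>\<kappa>\<close> from both ends, since closer to them
  \<open>e\<close> is at least \<open>-\<epsilon> + \<kappa>\<close>. So the difference of steps is the full height, with the sign of
  the direction of travel. Substituting \<open>x = u s\<close> produces the same sign once more.
\<close>

lemma hump_pullback:
  assumes e: "e = d \<or> e = - d" and \<kappa>: "0 < \<kappa>" "\<kappa> < 1 / 2"
    and lip: "\<And>x y. x \<in> {0..1} \<Longrightarrow> y \<in> {0..1} \<Longrightarrow> \<bar>poly e x - poly e y\<bar> \<le> M * \<bar>x - y\<bar>" and M: "0 \<le> M"
    and small: "\<kappa> \<le> \<epsilon> - M * \<kappa>"
  shows "integral {0..1} (\<lambda>s. hump_form \<kappa> \<epsilon> e (u s) * u' s * (smooth_step \<kappa> (u s - v 0) - smooth_step \<kappa> (u s - v 1)))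
     = step_height \<kappa> * integral {0..1} (hump_form \<kappa> \<epsilon> e)"
proof -
  \<comment> \<open>the direction of travel\<close>
  define \<sigma> :: real where "\<sigma> = (if v 0 = 0 then 1 else -1)"
  have F: "hump_form \<kappa> \<epsilon> e (u s) * (smooth_step \<kappa> (u s - v 0) - smooth_step \<kappa> (u s - v 1)) = \<sigma> * step_height \<kappa> * hump_form \<kappa> \<epsilon> e (u s)"
    if s: "s \<in> {0..1}" for s
  proof (cases "hump_form \<kappa> \<epsilon> e (u s) = 0")
    case False
    have x: "u s \<in> {0..1}" by (rule u01[OF s])
    have lt: "poly e (u s) + \<epsilon> < \<kappa>"
      using False smooth_step_right[OF \<kappa>(1), of "poly e (u s) + \<epsilon>"] by (fastforce simp: hump_form_def)
    have "poly e 0 = 0" "poly e 1 = 0" using e d_ends by auto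
    then have "\<bar>poly e (u s)\<bar> \<le> M * u s" "\<bar>poly e (u s)\<bar> \<le> M * (1 - u s)"
      using lip[OF x, of 0] lip[OF x, of 1] x by auto
    then have "M * \<kappa> < M * u s" "M * \<kappa> < M * (1 - u s)" using lt small by linarith+
    then have "\<kappa> < u s" "\<kappa> < 1 - u s" using M mult_less_cancel_left_disj by (metis not_less)+
    then show ?thesis using ends \<kappa> x
      by (auto simp: \<sigma>_def smooth_step_left smooth_step_right)
  qed simp
  have "integral {0..1} (\<lambda>s. hump_form \<kappa> \<epsilon> e (u s) * u' s * (smooth_step \<kappa> (u s - v 0) - smooth_step \<kappa> (u s - v 1)))
     = integral {0..1} (\<lambda>s. \<sigma> * step_height \<kappa> * (u' s * hump_form \<kappa> \<epsilon> e (u s)))"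
    by (rule integral_cong) (use F in \<open>simp add: algebra_simps\<close>)
  also have "\<dots> = \<sigma> * step_height \<kappa> * integral {0..1} (\<lambda>s. u' s * hump_form \<kappa> \<epsilon> e (u s))" by simp
  also have "integral {0..1} (\<lambda>s. u' s * hump_form \<kappa> \<epsilon> e (u s)) =
     integral {u 0..u 1} (hump_form \<kappa> \<epsilon> e) - integral {u 1..u 0} (hump_form \<kappa> \<epsilon> e)"
  proof (rule integral_unique)
    have "u ` {0..1} \<subseteq> {0..1}" using u01 by blast
    from has_integral_substitution_general[OF finite.emptyI zero_le_one this
        continuous_on_hump_form[OF continuous_on_id] continuous_on_params(1), of u' \<kappa> \<epsilon> e] du
    show "((\<lambda>s. u' s * hump_form \<kappa> \<epsilon> e (u s)) has_integral
       integral {u 0..u 1} (hump_form \<kappa> \<epsilon> e) - integral {u 1..u 0} (hump_form \<kappa> \<epsilon> e)) {0..1}" by simp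
  qed
  also have "\<sigma> * step_height \<kappa> * \<dots> = step_height \<kappa> * integral {0..1} (hump_form \<kappa> \<epsilon> e)"
    using ends by (auto simp: \<sigma>_def)
  finally show ?thesis .
qed

text \<open>
  If the second front is flat, the square of the second arc with itself has no horizontal area. The square of the first arc with
  itself contributes nothing because points of it with almost equal \<open>x\<close> have almost equal \<open>z\<close>. In the two mixed
  squares the integrand is a product, and one of the two integrations is elementary.
\<close>

lemma push_off_linking_over_flat:
  "\<forall>\<^sub>F \<epsilon> in at_right 0. \<forall>\<^sub>F \<kappa> in at_right 0.
    push_off_linking \<kappa> \<epsilon> (\<lambda>t. pt (u t) (poly (pderiv d) (u t)) (poly d (u t))) (\<lambda>t. pt (v t) 0 0)
     = - step_height \<kappa> * (integral {0..1} (hump_form \<kappa> \<epsilon> d) + integral {0..1} (hump_form \<kappa> \<epsilon> (- d)))"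
proof -
  define a where "a t = pt (u t) (poly (pderiv d) (u t)) (poly d (u t))" for t
  define b where "b t = pt (v t) 0 0" for t
  have pu: "((\<lambda>t. poly r (u t)) has_real_derivative u' t * poly (pderiv r) (u t)) (at t within {0..1})" if "t \<in> {0..1}" for r t
    using DERIV_chain2[OF poly_DERIV du[OF that]] by (simp add: mult.commute)
  have va: "vel a t = pt (u' t) (u' t * poly (pderiv (pderiv d)) (u t)) (u' t * poly (pderiv d) (u t))" if "t \<in> {0..1}" for t
    unfolding a_def[abs_def] by (rule vel_eqI[OF that]) (intro has_vector_derivative_pt du pu that)
  have vb: "vel b t = pt (v' t) 0 0" if "t \<in> {0..1}" for t
    unfolding b_def[abs_def] by (rule vel_eqI[OF that]) (intro has_vector_derivative_pt dv DERIV_const that)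
  have "\<exists>M\<ge>0. \<forall>x\<in>{0..1}. \<forall>y\<in>{0..1}. \<bar>poly d x - poly d y\<bar> \<le> M * \<bar>x - y\<bar>"
  proof -
    have "bounded ((\<lambda>x. poly (pderiv d) x) ` {0..1})"
      by (intro compact_imp_bounded compact_continuous_image) (auto intro: continuous_intros)
    then obtain M where M: "\<And>x. x \<in> {0..1} \<Longrightarrow> \<bar>poly (pderiv d) x\<bar> \<le> M"
      unfolding bounded_iff by (metis imageI real_norm_def)
    have "norm (poly d x - poly d y) \<le> M * norm (x - y)" if "x \<in> {0..1}" "y \<in> {0..1}" for x y
      by (rule field_differentiable_bound[of "{0..1}" "poly d" "poly (pderiv d)"])
         (use M that in \<open>auto intro: has_field_derivative_at_within[OF poly_DERIV]\<close>)
    moreover have "0 \<le> M" using M[of 0] by force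
    ultimately show ?thesis by auto
  qed
  then obtain M where M: "0 \<le> M" "\<And>x y. x \<in> {0..1} \<Longrightarrow> y \<in> {0..1} \<Longrightarrow> \<bar>poly d x - poly d y\<bar> \<le> M * \<bar>x - y\<bar>" by blast
  have box: "cbox (0, 0) (1, 1 :: real) = {0..1 :: real} \<times> {0..1}" by (simp add: cbox_Pair_eq)
  have main: "push_off_linking \<kappa> \<epsilon> a b = - step_height \<kappa> * (integral {0..1} (hump_form \<kappa> \<epsilon> d) + integral {0..1} (hump_form \<kappa> \<epsilon> (- d)))"
    if \<kappa>: "0 < \<kappa>" "\<kappa> < 1 / 2" "\<kappa> \<le> \<epsilon> - M * \<kappa>" for \<kappa> \<epsilon>
  proof -
    have bb: "link_square \<kappa> \<epsilon> b b = 0"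
    proof -
      have "link_square \<kappa> \<epsilon> b b = integral (cbox (0, 0) (1, 1)) (\<lambda>z :: real \<times> real. 0 :: real)"
        unfolding link_square_def by (rule integral_cong) (auto simp: vb box)
      then show ?thesis by simp
    qed
    have aa: "link_square \<kappa> \<epsilon> a a = 0"
    proof -
      have "link_density \<kappa> (a s - a t + pt 0 0 \<epsilon>) = 0" if st: "s \<in> {0..1}" "t \<in> {0..1}" for s t
      proof (cases "\<bar>u s - u t\<bar> < \<kappa>")
        case True
        have "\<bar>poly d (u s) - poly d (u t)\<bar> \<le> M * \<bar>u s - u t\<bar>" using M u01 st by blast
        also have "\<dots> \<le> M * \<kappa>" using True M(1) by (intro mult_left_mono) auto
        finally have "\<kappa> \<le> poly d (u s) - poly d (u t) + \<epsilon>" using \<kappa> by linarith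
        then show ?thesis using smooth_step_right[OF \<kappa>(1)] by (simp add: link_density_def a_def)
      next
        case False
        then show ?thesis using bump_outside[OF \<kappa>(1), of "u s - u t"] by (simp add: link_density_def a_def)
      qed
      then have "link_square \<kappa> \<epsilon> a a = integral (cbox (0, 0) (1, 1)) (\<lambda>z :: real \<times> real. 0 :: real)"
        unfolding link_square_def by (intro integral_cong) (auto simp: box)
      then show ?thesis by simp
    qed
    note cs = continuous_on_compose2[OF continuous_on_params(1) _] continuous_on_compose2[OF continuous_on_params(2) _]
       continuous_on_compose2[OF cu _] continuous_on_compose2[OF cv _]
    have st: "((\<lambda>t. smooth_step \<kappa> (c - v t)) has_real_derivative - (bump \<kappa> (c - v t) * v' t)) (at t within {0..1})"
      "((\<lambda>t. smooth_step \<kappa> (v t - c)) has_real_derivative bump \<kappa> (v t - c) * v' t) (at t within {0..1})" if "t \<in> {0..1}" for c t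
      using DERIV_chain2[OF DERIV_smooth_step DERIV_diff[OF DERIV_const dv[OF that]], of \<kappa> c]
        DERIV_chain2[OF DERIV_smooth_step DERIV_diff[OF dv[OF that] DERIV_const], of \<kappa> c] by simp_all
    have ab: "link_square \<kappa> \<epsilon> a b = step_height \<kappa> * integral {0..1} (hump_form \<kappa> \<epsilon> d)"
    proof -
      define f where "f s t = hump_form \<kappa> \<epsilon> d (u s) * u' s * (bump \<kappa> (u s - v t) * v' t)" for s t
      have "link_square \<kappa> \<epsilon> a b = integral (cbox (0, 0) (1, 1)) (\<lambda>(s, t). f s t)"
        unfolding link_square_def
        by (rule integral_cong) (auto simp: va vb box a_def b_def f_def link_density_def hump_form_def)
      also have "\<dots> = integral {0..1} (\<lambda>s. integral {0..1} (f s))"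
      proof -
        have "continuous_on (cbox (0, 0) (1, 1)) (\<lambda>(s, t). f s t)"
          unfolding f_def case_prod_unfold
          by (intro continuous_intros continuous_on_hump_form continuous_on_spline cs) (auto simp: box)
        from integral_prod_continuous[OF this] show ?thesis by simp
      qed
      also have "\<dots> = integral {0..1} (\<lambda>s. hump_form \<kappa> \<epsilon> d (u s) * u' s * (smooth_step \<kappa> (u s - v 0) - smooth_step \<kappa> (u s - v 1)))"
      proof (rule integral_cong)
        fix s :: real
        have "((\<lambda>t. - (bump \<kappa> (u s - v t) * v' t)) has_integral smooth_step \<kappa> (u s - v 1) - smooth_step \<kappa> (u s - v 0)) {0..1}"
          using st(1) by (intro fundamental_theorem_of_calculus) (auto simp: has_real_derivative_iff_has_vector_derivative)
        from has_integral_mult_right[OF has_integral_neg[OF this], of "hump_form \<kappa> \<epsilon> d (u s) * u' s"]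
        show "integral {0..1} (f s) = hump_form \<kappa> \<epsilon> d (u s) * u' s * (smooth_step \<kappa> (u s - v 0) - smooth_step \<kappa> (u s - v 1))"
          unfolding f_def by (intro integral_unique) simp
      qed
      also have "\<dots> = step_height \<kappa> * integral {0..1} (hump_form \<kappa> \<epsilon> d)"
        by (rule hump_pullback[of d]) (use \<kappa> M in auto)
      finally show ?thesis .
    qed
    have ba: "link_square \<kappa> \<epsilon> b a = step_height \<kappa> * integral {0..1} (hump_form \<kappa> \<epsilon> (- d))"
    proof -
      define f where "f s t = hump_form \<kappa> \<epsilon> (- d) (u t) * u' t * (bump \<kappa> (v s - u t) * v' s)" for s t
      have c: "continuous_on (cbox (0, 0) (1, 1)) (\<lambda>(s, t). f s t)"
        unfolding f_def case_prod_unfold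
        by (intro continuous_intros continuous_on_hump_form continuous_on_spline cs) (auto simp: box)
      have "link_square \<kappa> \<epsilon> b a = integral (cbox (0, 0) (1, 1)) (\<lambda>(s, t). f s t)"
        unfolding link_square_def
        by (rule integral_cong) (auto simp: va vb box a_def b_def f_def link_density_def hump_form_def pderiv_minus)
      also have "\<dots> = integral {0..1} (\<lambda>t. integral {0..1} (\<lambda>s. f s t))"
        using integral_prod_continuous[OF c] integral_swap_continuous[OF c] by simp
      also have "\<dots> = integral {0..1} (\<lambda>t. hump_form \<kappa> \<epsilon> (- d) (u t) * u' t * (smooth_step \<kappa> (u t - v 0) - smooth_step \<kappa> (u t - v 1)))"
      proof (rule integral_cong)
        fix t :: real assume t: "t \<in> {0..1}"
        have "((\<lambda>s. bump \<kappa> (v s - u t) * v' s) has_integral smooth_step \<kappa> (v 1 - u t) - smooth_step \<kappa> (v 0 - u t)) {0..1}"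
          using st(2) by (intro fundamental_theorem_of_calculus) (auto simp: has_real_derivative_iff_has_vector_derivative)
        from has_integral_mult_right[OF this, of "hump_form \<kappa> \<epsilon> (- d) (u t) * u' t"]
        have "integral {0..1} (\<lambda>s. f s t) = hump_form \<kappa> \<epsilon> (- d) (u t) * u' t * (smooth_step \<kappa> (v 1 - u t) - smooth_step \<kappa> (v 0 - u t))"
          unfolding f_def by (intro integral_unique) simp
        moreover from smooth_step_uminus[of \<kappa> "u t - v 0"] smooth_step_uminus[of \<kappa> "u t - v 1"]
        have "smooth_step \<kappa> (v 1 - u t) - smooth_step \<kappa> (v 0 - u t) = smooth_step \<kappa> (u t - v 0) - smooth_step \<kappa> (u t - v 1)" by simp
        ultimately show "integral {0..1} (\<lambda>s. f s t) = hump_form \<kappa> \<epsilon> (- d) (u t) * u' t * (smooth_step \<kappa> (u t - v 0) - smooth_step \<kappa> (u t - v 1))" by simp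
      qed
      also have "\<dots> = step_height \<kappa> * integral {0..1} (hump_form \<kappa> \<epsilon> (- d))"
        by (rule hump_pullback[of "- d"]) (use \<kappa> M in \<open>auto simp: abs_minus_commute\<close>)
      finally show ?thesis .
    qed
    show ?thesis unfolding push_off_linking_def aa ab ba bb by (simp add: algebra_simps)
  qed
  have ev: "\<forall>\<^sub>F \<kappa> in at_right 0. 0 < \<kappa> \<and> \<kappa> < 1 / 2 \<and> \<kappa> \<le> \<epsilon> - M * \<kappa>" if "0 < \<epsilon>" for \<epsilon>
  proof -
    have "0 < min (1 / 2) (\<epsilon> / (1 + M))" using that M(1) by simp
    from eventually_at_right_less[OF this] show ?thesis
    proof eventually_elim
      case (elim \<kappa>)
      then have "\<kappa> * (1 + M) < \<epsilon>" using M(1) by (simp add: pos_less_divide_eq)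
      then show ?case using elim by (simp add: algebra_simps)
    qed
  qed
  have E: "\<forall>\<^sub>F \<kappa> in at_right 0. push_off_linking \<kappa> \<epsilon> a b =
     - step_height \<kappa> * (integral {0..1} (hump_form \<kappa> \<epsilon> d) + integral {0..1} (hump_form \<kappa> \<epsilon> (- d)))" if "0 < \<epsilon>" for \<epsilon>
    using ev[OF that] by eventually_elim (use main in blast)
  from eventually_at_right_less[OF zero_less_one]
  have "\<forall>\<^sub>F \<epsilon> in at_right 0. \<forall>\<^sub>F \<kappa> in at_right 0. push_off_linking \<kappa> \<epsilon> a b =
     - step_height \<kappa> * (integral {0..1} (hump_form \<kappa> \<epsilon> d) + integral {0..1} (hump_form \<kappa> \<epsilon> (- d)))"
    by eventually_elim (use E in blast)
  then show ?thesis unfolding a_def[abs_def] b_def[abs_def] .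
qed

end


lemma push_off_linking_cong:
  assumes "\<And>t. t \<in> {0..1} \<Longrightarrow> a t = a' t" "\<And>t. t \<in> {0..1} \<Longrightarrow> b t = b' t"
  shows "push_off_linking \<kappa> \<epsilon> a b = push_off_linking \<kappa> \<epsilon> a' b'"
  unfolding push_off_linking_def using assms
  by (intro arg_cong2[of _ _ _ _ "(+)"] arg_cong2[of _ _ _ _ "(-)"] link_square_cong) auto

lemma push_off_linking_homotopy_eventually:
  assumes hA: "arc_homotopy A At Al Alt" and hB: "arc_homotopy B Bt Bl Blt"
    and ends: "\<And>l. l \<in> {0..1} \<Longrightarrow> A l 0 = B l 0" "\<And>l. l \<in> {0..1} \<Longrightarrow> A l 1 = B l 1"
    and nonzero: "\<And>P Q l s t. P \<in> {A, B} \<Longrightarrow> Q \<in> {A, B} \<Longrightarrow> l \<in> {0..1} \<Longrightarrow> s \<in> {0..1} \<Longrightarrow> t \<in> {0..1} \<Longrightarrow>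
      P l s - Q l t + pt 0 0 \<epsilon> \<noteq> 0"
  shows "\<forall>\<^sub>F \<kappa> in at_right 0. push_off_linking \<kappa> \<epsilon> (A 0) (B 0) = push_off_linking \<kappa> \<epsilon> (A 1) (B 1)"
proof -
  interpret A: arc_homotopy A At Al Alt by fact
  interpret B: arc_homotopy B Bt Bl Blt by fact
  define S where "S = {0..1::real} \<times> {0..1::real} \<times> {0..1::real}"
  have av: "\<forall>\<^sub>F \<kappa> in at_right 0. \<forall>z\<in>S. avoids_cube \<kappa> (P (fst z) (fst (snd z)) - Q (fst z) (snd (snd z)) + pt 0 0 \<epsilon>)"
    if PQ: "P \<in> {A, B}" "Q \<in> {A, B}" for P Q
  proof (rule eventually_avoids_cube)
    show "compact S" unfolding S_def by (intro compact_Times compact_Icc)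
    have c: "continuous_on S (\<lambda>z. P (fst z) (fst (snd z)))" "continuous_on S (\<lambda>z. P (fst z) (snd (snd z)))" if "P \<in> {A, B}" for P
    proof -
      have "continuous_on S (\<lambda>z. A (fst z) (fst (snd z)))" "continuous_on S (\<lambda>z. A (fst z) (snd (snd z)))"
        "continuous_on S (\<lambda>z. B (fst z) (fst (snd z)))" "continuous_on S (\<lambda>z. B (fst z) (snd (snd z)))"
        by (intro A.cont2 B.cont2 continuous_intros; force simp: S_def)+
      then show "continuous_on S (\<lambda>z. P (fst z) (fst (snd z)))" "continuous_on S (\<lambda>z. P (fst z) (snd (snd z)))"
        using that by blast+
    qed
    show "continuous_on S (\<lambda>z. P (fst z) (fst (snd z)) - Q (fst z) (snd (snd z)) + pt 0 0 \<epsilon>)"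
      by (intro continuous_on_add continuous_on_diff continuous_on_const c PQ)
    show "P (fst z) (fst (snd z)) - Q (fst z) (snd (snd z)) + pt 0 0 \<epsilon> \<noteq> 0" if "z \<in> S" for z
      using that by (intro nonzero PQ) (auto simp: S_def)
  qed
  have "\<forall>\<^sub>F \<kappa> in at_right 0. \<forall>P\<in>{A, B}. \<forall>Q\<in>{A, B}. \<forall>z\<in>S. avoids_cube \<kappa> (P (fst z) (fst (snd z)) - Q (fst z) (snd (snd z)) + pt 0 0 \<epsilon>)"
    by (intro eventually_ball_finite ballI av) auto
  moreover have "\<forall>\<^sub>F \<kappa> in at_right (0::real). 0 < \<kappa> \<and> \<kappa> < 1" by (rule eventually_at_right_less) simp
  ultimately show ?thesis
  proof eventually_elim
    case (elim \<kappa>)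
    show ?case
    proof (rule push_off_linking_homotopy_invariant[OF hA hB _ ends])
      show "0 < \<kappa>" using elim by blast
      fix P Q l s t assume "P \<in> {A, B}" "Q \<in> {A, B}" "l \<in> {0..1::real}" "s \<in> {0..1::real}" "t \<in> {0..1::real}"
      moreover from this have "(l, s, t) \<in> S" by (simp add: S_def)
      ultimately show "avoids_cube \<kappa> (P l s - Q l t + pt 0 0 \<epsilon>)" using elim(1) by fastforce
    qed
  qed
qed

text \<open>
  Subtracting a growing multiple of \<open>g\<close> from both fronts keeps their difference. A point and
  a point of the push-off can only meet over the same \<open>x\<close>, where the horizontal and vertical
  differences depend only on \<open>f - g\<close>. Hence no intersection arises before the second front is flat, provided that
  \<open>\<epsilon>\<close> avoids the critical values.
\<close>

lemma push_off_linking_of_traces: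
  fixes f g :: "real poly"
  assumes trA: "traces f a" and trB: "traces g b"
    and da: "\<And>t. t \<in> {0..1} \<Longrightarrow> (a has_vector_derivative vel a t) (at t within {0..1})" and ca: "continuous_on {0..1} (vel a)"
    and db: "\<And>t. t \<in> {0..1} \<Longrightarrow> (b has_vector_derivative vel b t) (at t within {0..1})" and cb: "continuous_on {0..1} (vel b)"
    and ends: "(a 0 $ 1 = 0 \<and> a 1 $ 1 = 1 \<and> b 0 $ 1 = 0 \<and> b 1 $ 1 = 1) \<or> (a 0 $ 1 = 1 \<and> a 1 $ 1 = 0 \<and> b 0 $ 1 = 1 \<and> b 1 $ 1 = 0)"
    and fg: "\<And>x. x = 0 \<or> x = 1 \<Longrightarrow> poly f x = poly g x" "\<And>x. x = 0 \<or> x = 1 \<Longrightarrow> poly (pderiv f) x = poly (pderiv g) x"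
    and nz: "pderiv (f - g) \<noteq> 0"
  shows "\<forall>\<^sub>F \<epsilon> in at_right 0. \<forall>\<^sub>F \<kappa> in at_right 0. push_off_linking \<kappa> \<epsilon> a b
     = - step_height \<kappa> * (integral {0..1} (hump_form \<kappa> \<epsilon> (f - g)) + integral {0..1} (hump_form \<kappa> \<epsilon> (- (f - g))))"
proof -
  define d where "d = f - g"
  define u where "u t = a t $ 1" for t
  define v where "v t = b t $ 1" for t
  have du: "(u has_real_derivative vel a t $ 1) (at t within {0..1})" if "t \<in> {0..1}" for t
    unfolding u_def[abs_def] by (rule has_real_derivative_component[OF da[OF that]])
  have dv: "(v has_real_derivative vel b t $ 1) (at t within {0..1})" if "t \<in> {0..1}" for t
    unfolding v_def[abs_def] by (rule has_real_derivative_component[OF db[OF that]])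
  have cu: "continuous_on {0..1} (\<lambda>t. vel a t $ 1)" "continuous_on {0..1} (\<lambda>t. vel b t $ 1)"
    by (intro continuous_intros ca cb)+
  define A where "A l t = pt (u t) (poly (pderiv f) (u t) - l * poly (pderiv g) (u t)) (poly f (u t) - l * poly g (u t))" for l t
  define B where "B l t = pt (v t) (poly (pderiv g) (v t) - l * poly (pderiv g) (v t)) (poly g (v t) - l * poly g (v t))" for l t
  note hA = arc_homotopy_of_trace[OF du cu(1), of f g, folded A_def]
  note hB = arc_homotopy_of_trace[OF dv cu(2), of g g, folded B_def]
  have uv: "u 0 = v 0" "u 1 = v 1" "u 0 = 0 \<or> u 0 = 1" "u 1 = 0 \<or> u 1 = 1" using ends by (auto simp: u_def v_def)
  have e0: "A l 0 = B l 0" "A l 1 = B l 1" for l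
    using fg(1)[OF uv(3)] fg(2)[OF uv(3)] fg(1)[OF uv(4)] fg(2)[OF uv(4)] uv(1,2) by (simp_all add: A_def B_def)
  have "A 0 t = front_lift f (a t $ 1)" "B 0 t = front_lift g (b t $ 1)" for t
    by (simp_all add: A_def B_def u_def v_def front_lift_def)
  then have A0: "a t = A 0 t" and B0: "b t = B 0 t" if "t \<in> {0..1}" for t
    using trA trB that unfolding traces_def by metis+
  interpret parallel_traces u "\<lambda>t. vel a t $ 1" v "\<lambda>t. vel b t $ 1" d
    by standard (use du dv cu trA ends fg in \<open>auto simp: traces_def u_def v_def d_def\<close>)
  have reg: "\<forall>\<^sub>F \<epsilon> in at_right 0. \<forall>x. poly (pderiv d) x = 0 \<longrightarrow> poly d x \<noteq> - \<epsilon>"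
    "\<forall>\<^sub>F \<epsilon> in at_right 0. \<forall>x. poly (pderiv (- d)) x = 0 \<longrightarrow> poly (- d) x \<noteq> - \<epsilon>"
    by (rule eventually_regular_level, use nz[folded d_def] in \<open>simp add: pderiv_minus\<close>)+
  have pos: "\<forall>\<^sub>F \<epsilon> in at_right (0::real). 0 < \<epsilon> \<and> \<epsilon> < 1" by (rule eventually_at_right_less) simp
  show ?thesis
    using reg pos push_off_linking_over_flat
  proof eventually_elim
    case (elim \<epsilon>)
    have "P l s - Q l t + pt 0 0 \<epsilon> \<noteq> 0" if "P \<in> {A, B}" "Q \<in> {A, B}" for P Q l s t
    proof
      assume 0: "P l s - Q l t + pt 0 0 \<epsilon> = 0"
      have pd: "poly (pderiv d) x = poly (pderiv f) x - poly (pderiv g) x" "poly d x = poly f x - poly g x" for x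
        by (simp_all add: d_def pderiv_diff)
      consider "P = A" "Q = A" | "P = A" "Q = B" | "P = B" "Q = A" | "P = B" "Q = B" using \<open>P \<in> {A, B}\<close> \<open>Q \<in> {A, B}\<close> by blast
      then show False
      proof cases
        case 1 then show ?thesis using 0 elim(3) by (auto simp: vec3_eq_iff A_def)
      next
        case 2
        then have "u s = v t" "poly (pderiv d) (u s) = 0" "poly d (u s) = - \<epsilon>"
          using 0 by (auto simp: vec3_eq_iff A_def B_def pd)
        then show ?thesis using elim(1) by blast
      next
        case 3
        then have "v s = u t" "poly (pderiv (- d)) (u t) = 0" "poly (- d) (u t) = - \<epsilon>"
          using 0 by (auto simp: vec3_eq_iff A_def B_def pd pderiv_minus)
        then show ?thesis using elim(2) by blast
      next
        case 4 then show ?thesis using 0 elim(3) by (auto simp: vec3_eq_iff B_def)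
      qed
    qed
    then have "\<forall>\<^sub>F \<kappa> in at_right 0. push_off_linking \<kappa> \<epsilon> (A 0) (B 0) = push_off_linking \<kappa> \<epsilon> (A 1) (B 1)"
      by (intro push_off_linking_homotopy_eventually[OF hA hB e0])
    with elim(4) show ?case
    proof eventually_elim
      case (elim \<kappa>)
      have "push_off_linking \<kappa> \<epsilon> a b = push_off_linking \<kappa> \<epsilon> (A 0) (B 0)"
        by (rule push_off_linking_cong) (use A0 B0 in auto)
      moreover have "A 1 = (\<lambda>t. pt (u t) (poly (pderiv d) (u t)) (poly d (u t)))" "B 1 = (\<lambda>t. pt (v t) 0 0)"
        by (simp_all add: fun_eq_iff A_def B_def d_def pderiv_diff)
      ultimately show ?case using elim by (simp add: d_def)
    qed
  qed
qed

section \<open>A cubic crossing a pencil of lines\<close>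

text \<open>
  In the coordinate \<open>u = 2 t - 1\<close> on \<open>[-1, 1]\<close> this is \<open>4 u\<^sup>3 - u\<close>, with roots \<open>0\<close> and \<open>\<plusminus>1/2\<close>.
\<close>

definition wiggle :: "real poly" where
  "wiggle = pcompose [:0, -1, 0, 4:] [:-1, 2:]"

text \<open>
  The intercept is a quadratic function of the slope, so two lines meet at a point whose abscissa
  determines the sum of their slopes. Hence no three lines are concurrent. The coefficients
  are chosen such that all these points lie in the interval for the slopes used here.
\<close>

definition line :: "real \<Rightarrow> real poly" where
  "line p = pcompose [:(p\<^sup>2 + 5 * p) / 8, p:] [:-1, 2:]"

lemma poly_wiggle: "poly wiggle t = 4 * (2 * t - 1) ^ 3 - (2 * t - 1)"
  by (simp add: wiggle_def poly_pcompose power3_eq_cube algebra_simps)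

lemma poly_pderiv_wiggle: "poly (pderiv wiggle) t = 2 * (12 * (2 * t - 1)\<^sup>2 - 1)"
  by (simp add: wiggle_def pderiv_pcompose pderiv_pCons poly_pcompose power2_eq_square algebra_simps)

lemma poly_line: "poly (line p) t = p * (2 * t - 1) + (p\<^sup>2 + 5 * p) / 8"
  by (simp add: line_def poly_pcompose algebra_simps)

lemma poly_pderiv_line: "poly (pderiv (line p)) t = 2 * p"
  by (simp add: line_def pderiv_pcompose pderiv_pCons poly_pcompose algebra_simps)

lemma line_eq_iff:
  assumes "p \<noteq> p'"
  shows "poly (line p) t = poly (line p') t \<longleftrightarrow> 2 * t - 1 = - (p + p' + 5) / 8"
proof -
  have "poly (line p) t - poly (line p') t = (p - p') * ((2 * t - 1) + (p + p' + 5) / 8)"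
    by (simp add: poly_line power2_eq_square field_simps)
  then have "poly (line p) t = poly (line p') t \<longleftrightarrow> (2 * t - 1) + (p + p' + 5) / 8 = 0"
    using assms by (metis diff_eq_diff_eq eq_iff_diff_eq_0 mult_eq_0_iff)
  then show ?thesis by (simp add: field_simps)
qed

lemma unique_root:
  fixes e :: "real poly"
  assumes c: "0 \<le> c" "c < 1" and neg: "\<And>t. t \<in> {0..c} \<Longrightarrow> poly e t < 0"
    and incr: "\<And>t. c < t \<Longrightarrow> t < 1 \<Longrightarrow> 0 < poly (pderiv e) t" and pos: "0 < poly e 1"
  shows "card {t. 0 < t \<and> t < 1 \<and> poly e t = 0} = 1"
proof -
  have "\<exists>z\<ge>c. z \<le> 1 \<and> poly e z = 0"
    using neg[of c] c pos by (intro IVT') (auto intro: continuous_intros)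
  then obtain z where z: "c \<le> z" "z \<le> 1" "poly e z = 0" by blast
  have z': "c < z" "z < 1" using z neg[of c] c pos by (auto simp: order_less_le)
  have mono: "poly e x < poly e y" if "c \<le> x" "x < y" "y \<le> 1" for x y
    by (rule DERIV_pos_imp_increasing_open[of x y "poly e"])
      (use that incr in \<open>auto intro!: exI poly_DERIV continuous_intros\<close>)
  have "t = z" if "0 < t" "t < 1" "poly e t = 0" for t
  proof -
    have "c < t" using neg[of t] that by force
    then show ?thesis using mono[of t z] mono[of z t] z z' that by (cases t z rule: linorder_cases) auto
  qed
  then have "{t. 0 < t \<and> t < 1 \<and> poly e t = 0} = {z}" using z z' c by auto
  then show ?thesis by simp
qed

definition cubic_and_lines :: "(nat \<Rightarrow> real) \<Rightarrow> nat \<Rightarrow> real poly" where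
  "cubic_and_lines P i = (if i = 0 then wiggle else line (P i))"

text \<open>
  For slopes near \<open>1\<close> the line passes above the bends of the cubic and meets only its steep last branch; for
  slopes near \<open>-5/4\<close> the line falls more steeply than the cubic ever does. In both cases the line meets the cubic once, whereas
  the line of slope \<open>0\<close> meets it three times.
\<close>

definition steep :: "real set \<Rightarrow> bool" where
  "steep S \<longleftrightarrow> S \<subseteq> {1..11/10} \<or> S \<subseteq> {-13/10..-12/10}"

lemma wiggle_line_root_unique:
  assumes "p \<in> {1..11/10} \<or> p \<in> {-13/10..-12/10}"
  shows "card {t. 0 < t \<and> t < 1 \<and> poly (wiggle - line p) t = 0} = 1"
    and "0 < t \<Longrightarrow> t < 1 \<Longrightarrow> poly wiggle t = poly (line p) t \<Longrightarrow> 2 * p < poly (pderiv wiggle) t"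
proof -
  have e: "poly (wiggle - line p) t = 4 * (2 * t - 1) ^ 3 - (2 * t - 1) - p * (2 * t - 1) - (p\<^sup>2 + 5 * p) / 8"
    and e': "poly (pderiv (wiggle - line p)) t = 2 * (12 * (2 * t - 1)\<^sup>2 - 1 - p)" for t
    by (simp_all add: pderiv_diff poly_wiggle poly_line poly_pderiv_wiggle poly_pderiv_line)
  have "\<exists>c. 0 \<le> c \<and> c < 1 \<and> (\<forall>t\<in>{0..c}. poly (wiggle - line p) t < 0) \<and>
     (\<forall>t. c < t \<and> t < 1 \<longrightarrow> 0 < poly (pderiv (wiggle - line p)) t) \<and> 0 < poly (wiggle - line p) 1"
    using assms
  proof
    assume p: "p \<in> {1..11/10}"
    then have p1: "1 \<le> p" by simp
    have "1 * 1 \<le> p * p" "p * p \<le> 11/10 * (11/10)" using p by (intro mult_mono; auto)+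
    then have p2: "1 \<le> p\<^sup>2" "p\<^sup>2 \<le> 121/100" by (auto simp: power2_eq_square)
    have "poly (wiggle - line p) t < 0" if t: "t \<in> {0..3/4}" for t
    proof -
      define u where "u = 2 * t - 1"
      have u: "-1 \<le> u" "u \<le> 1/2" using t by (auto simp: u_def)
      \<comment> \<open>the tangent to the cubic at \<open>u = -2/5\<close>, close to its local maximum after the shear, bounds the cubic\<close>
      have "4 * (u + 2/5)\<^sup>2 * (u - 4/5) \<le> 0" using u by (intro mult_nonneg_nonpos) auto
      moreover have "4 * (u + 2/5)\<^sup>2 * (u - 4/5) = 4 * u ^ 3 - 48/25 * u - 64/125"
        by (simp add: power2_eq_square power3_eq_cube field_simps)
      ultimately have 1: "4 * u ^ 3 - 48/25 * u \<le> 64/125" by simp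
      have "(p - 23/25) * (- u) \<le> (p - 23/25) * 1" using u p by (intro mult_left_mono) auto
      then have 2: "- (p * u) + 23/25 * u \<le> 9/50" using p by (simp add: algebra_simps)
      show ?thesis unfolding e u_def[symmetric] add_divide_distrib using 1 2 p2 p1 by linarith
    qed
    moreover have "0 < poly (pderiv (wiggle - line p)) t" if t: "3/4 < t" "t < 1" for t
    proof -
      have "(1/2) * (1/2) < (2 * t - 1) * (2 * t - 1)" using t by (intro mult_strict_mono) auto
      then show ?thesis unfolding e' using p by (simp add: power2_eq_square)
    qed
    moreover have "0 < poly (wiggle - line p) 1" unfolding e using p p2 by simp
    ultimately show ?thesis by (intro exI[of _ "3/4"]) auto
  next
    assume p: "p \<in> {-13/10..-12/10}"
    have "12/10 * (12/10) \<le> (-p) * (-p)" "(-p) * (-p) \<le> 13/10 * (13/10)" using p by (intro mult_mono; auto)+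
    then have p2: "144/100 \<le> p\<^sup>2" "p\<^sup>2 \<le> 169/100" by (auto simp: power2_eq_square)
    have "poly (wiggle - line p) 0 < 0" "0 < poly (wiggle - line p) 1" unfolding e using p p2 by simp_all
    moreover have "0 < poly (pderiv (wiggle - line p)) t" for t
    proof -
      define w where "w = (2 * t - 1)\<^sup>2"
      have "0 \<le> w" "p < - 1" using p by (simp_all add: w_def)
      then show ?thesis unfolding e' w_def[symmetric] by simp
    qed
    ultimately show ?thesis by (intro exI[of _ 0]) auto
  qed
  then obtain c where c: "0 \<le> c" "c < 1" "\<And>t. t \<in> {0..c} \<Longrightarrow> poly (wiggle - line p) t < 0"
     "\<And>t. c < t \<Longrightarrow> t < 1 \<Longrightarrow> 0 < poly (pderiv (wiggle - line p)) t" "0 < poly (wiggle - line p) 1" by blast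
  show "card {t. 0 < t \<and> t < 1 \<and> poly (wiggle - line p) t = 0} = 1" by (rule unique_root[OF c])
  show "2 * p < poly (pderiv wiggle) t" if "0 < t" "t < 1" "poly wiggle t = poly (line p) t"
  proof -
    have "c < t" using c(3)[of t] that by force
    then show ?thesis using c(4)[of t] that by (simp add: pderiv_diff poly_pderiv_line)
  qed
qed

lemma wiggle_line_zero: "poly wiggle t = poly (line 0) t \<longleftrightarrow> t \<in> {1/4, 1/2, 3/4}"
proof -
  have d: "poly wiggle t - poly (line 0) t = 32 * ((t - 1/4) * ((t - 1/2) * (t - 3/4)))"
    by (simp add: poly_wiggle poly_line power3_eq_cube field_simps)
  have "poly wiggle t = poly (line 0) t \<longleftrightarrow> (t - 1/4) * ((t - 1/2) * (t - 3/4)) = 0"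
    unfolding eq_iff_diff_eq_0[of "poly wiggle t"] d by simp
  also have "\<dots> \<longleftrightarrow> t \<in> {1/4, 1/2, 3/4}" unfolding mult_eq_0_iff by auto
  finally show ?thesis .
qed

text \<open>
  Edge \<open>0\<close> is the cubic, edge \<open>k\<close> the horizontal line, and the other edges are steep lines. Their
  slopes decrease, which gives the order required at both ends.
\<close>

locale slopes =
  fixes n k :: nat and P :: "nat \<Rightarrow> real"
  assumes k: "0 < k" "k < n" and Pk: "P k = 0"
    and decreasing: "0 < i \<Longrightarrow> i < j \<Longrightarrow> j < n \<Longrightarrow> P j < P i"
    and steep: "steep (P ` ({1..<n} - {k}))"
begin

abbreviation "h \<equiv> cubic_and_lines P"

lemma slope_bounds: "0 < i \<Longrightarrow> i < n \<Longrightarrow> -13/10 \<le> P i \<and> P i \<le> 11/10"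
proof (cases "i = k")
  case False
  assume "0 < i" "i < n"
  then have "P i \<in> {1..11/10} \<or> P i \<in> {-13/10..-12/10}"
    using steep False unfolding steep_def image_subset_iff by auto
  then show ?thesis by auto
qed (use Pk in simp)

lemma slopes_distinct: "0 < i \<Longrightarrow> 0 < j \<Longrightarrow> i < n \<Longrightarrow> j < n \<Longrightarrow> i \<noteq> j \<Longrightarrow> P i \<noteq> P j"
  using decreasing by (metis linorder_neqE_nat less_irrefl)

text \<open>
  Two lines with slopes \<open>p\<close>, \<open>p'\<close> meet at height \<open>- p p' / 8\<close>; there the cubic is far below this height, or
  it has another sign.
\<close>

lemma no_triple_cubic:
  assumes i: "0 < i" "i < n" and j: "0 < j" "j < n" and ne: "i \<noteq> j" and eq: "poly (line (P i)) t = poly (line (P j)) t"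
  shows "poly wiggle t \<noteq> poly (line (P i)) t"
proof -
  define p where "p = P i" define p' where "p' = P j"
  define u where "u = 2 * t - 1"
  have pp: "p \<noteq> p'" using slopes_distinct assms by (auto simp: p_def p'_def)
  have u: "u = - (p + p' + 5) / 8" using line_eq_iff[OF pp] eq by (simp add: u_def p_def p'_def)
  have val: "poly (line p) t = - (p * p') / 8"
    unfolding poly_line u_def[symmetric] u by (simp add: power2_eq_square field_simps)
  have q: "poly wiggle t = u * (4 * u\<^sup>2 - 1)"
    unfolding poly_wiggle u_def[symmetric] by (simp add: power2_eq_square power3_eq_cube algebra_simps)
  have mem: "(p = 0 \<or> p \<in> {1..11/10}) \<and> (p' = 0 \<or> p' \<in> {1..11/10}) \<or>
     (p = 0 \<or> p \<in> {-13/10..-12/10}) \<and> (p' = 0 \<or> p' \<in> {-13/10..-12/10})"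
    using steep Pk i j unfolding steep_def p_def p'_def by (auto simp: image_subset_iff)
  have big: "4 * u\<^sup>2 - 1 > 0" if "u \<le> - 3/4"
  proof -
    have "3/4 * (3/4) \<le> (-u) * (-u)" using that by (intro mult_mono) auto
    then show ?thesis by (simp add: power2_eq_square)
  qed
  have small: "4 * u\<^sup>2 - 1 < 0" if "- 1/2 < u" "u < 0"
  proof -
    have "(-u) * (-u) < 1/2 * (1/2)" using that by (intro mult_strict_mono) auto
    then show ?thesis by (simp add: power2_eq_square)
  qed
  consider "p = 0 \<or> p' = 0" "u \<le> -3/4 \<or> - 1/2 < u \<and> u < 0"
    | "p \<in> {1..11/10}" "p' \<in> {1..11/10}" | "p \<in> {-13/10..-12/10}" "p' \<in> {-13/10..-12/10}"
  proof (cases "p = 0 \<or> p' = 0")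
    case True
    then have "p + p' \<in> {1..11/10} \<or> p + p' \<in> {-13/10..-12/10}" using mem pp by auto
    then have "u \<le> -3/4 \<or> - 1/2 < u \<and> u < 0" unfolding u by auto
    with True that(1) show ?thesis by blast
  next
    case False
    then show ?thesis using mem that(2,3) by blast
  qed
  then have "poly wiggle t \<noteq> poly (line p) t"
  proof cases
    case 1
    then show ?thesis using val big small by (auto simp: q)
  next
    case 2
    then have u': "u \<le> - 7/8" using u by auto
    have "7/8 * (7/8) \<le> (-u) * (-u)" using u' by (intro mult_mono) auto
    then have "1 \<le> 4 * u\<^sup>2 - 1" by (simp add: power2_eq_square)
    then have "7/8 * 1 \<le> (-u) * (4 * u\<^sup>2 - 1)" using u' by (intro mult_mono) auto
    moreover have "p * p' \<le> 11/10 * (11/10)" using 2 by (intro mult_mono) auto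
    ultimately show ?thesis unfolding q val by simp
  next
    case 3
    then have u': "- 1/2 < u" "u < 0" using u by auto
    have "0 < u * (4 * u\<^sup>2 - 1)" using small[OF u'] u' by (simp add: zero_less_mult_iff)
    moreover have "0 < p * p'" using 3 by (simp add: zero_less_mult_iff)
    ultimately show ?thesis unfolding q val by simp
  qed
  then show ?thesis by (simp add: p_def)
qed

lemma transverse_cubic:
  assumes j: "0 < j" "j < n" and t: "0 < t" "t < 1" and eq: "poly wiggle t = poly (line (P j)) t"
  shows "poly (pderiv wiggle) t \<noteq> poly (pderiv (line (P j))) t"
proof (cases "j = k")
  case True
  then have "t = 1/4 \<or> t = 1/2 \<or> t = 3/4" using eq Pk wiggle_line_zero by simp
  moreover have "poly (pderiv wiggle) (1/4) \<noteq> 0" "poly (pderiv wiggle) (1/2) \<noteq> 0" "poly (pderiv wiggle) (3/4) \<noteq> 0"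
    by (simp_all add: poly_pderiv_wiggle power2_eq_square)
  ultimately have "poly (pderiv wiggle) t \<noteq> 0" by metis
  then show ?thesis using True Pk by (simp add: poly_pderiv_line)
next
  case False
  then have "P j \<in> {1..11/10} \<or> P j \<in> {-13/10..-12/10}"
    using steep j unfolding steep_def by (auto simp: image_subset_iff)
  from wiggle_line_root_unique(2)[OF this t eq] show ?thesis by (simp add: poly_pderiv_line)
qed

sublocale front_arrangement n h
proof
  fix i j assume ij: "i < j" "j < n"
  show "poly (h i) 0 < poly (h j) 0"
  proof (cases "i = 0")
    case True
    have "0 \<le> (P j - 3/2)\<^sup>2" by simp
    then show ?thesis using True ij
      by (simp add: cubic_and_lines_def poly_wiggle poly_line power2_eq_square field_simps)
  next
    case False
    then have "0 < (P i - P j) * (3 - P i - P j)"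
      using decreasing[of i j] slope_bounds[of i] slope_bounds[of j] ij by (intro mult_pos_pos) auto
    then show ?thesis using False ij
      by (simp add: cubic_and_lines_def poly_line power2_eq_square field_simps)
  qed
  show "poly (h j) 1 < poly (h i) 1"
  proof (cases "i = 0")
    case True
    have "(P j - 11/10) * (P j + 13/10) \<le> 0"
      using slope_bounds[of j] ij by (intro mult_nonpos_nonneg) auto
    then have "(P j)\<^sup>2 + 13 * P j < 24" using slope_bounds[of j] ij by (simp add: power2_eq_square algebra_simps)
    then show ?thesis using True ij
      by (simp add: cubic_and_lines_def poly_wiggle poly_line field_simps)
  next
    case False
    then have "0 < (P i - P j) * (P i + P j + 13)"
      using decreasing[of i j] slope_bounds[of i] slope_bounds[of j] ij by (intro mult_pos_pos) auto
    then show ?thesis using False ij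
      by (simp add: cubic_and_lines_def poly_line power2_eq_square field_simps)
  qed
next
  fix i j x assume *: "i < n" "j < n" "i \<noteq> j" "0 < x" "x < 1" "poly (h i) x = poly (h j) x"
  show "poly (pderiv (h i)) x \<noteq> poly (pderiv (h j)) x"
  proof -
    consider "i = 0" "0 < j" | "j = 0" "0 < i" | "0 < i" "0 < j" using *(3) by force
    then show ?thesis
    proof cases
      case 1 then show ?thesis using transverse_cubic[of j x] * by (simp add: cubic_and_lines_def)
    next
      case 2 then show ?thesis using transverse_cubic[of i x] * by (simp add: cubic_and_lines_def)
    next
      case 3 then show ?thesis using slopes_distinct[of i j] * by (simp add: cubic_and_lines_def poly_pderiv_line)
    qed
  qed
next
  fix i j l x assume *: "i < n" "j < n" "l < n" "i \<noteq> j" "j \<noteq> l" "i \<noteq> l" "0 < x" "x < 1" "poly (h i) x = poly (h j) x"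
  show "poly (h j) x \<noteq> poly (h l) x"
  proof
    assume e: "poly (h j) x = poly (h l) x"
    consider "i = 0" | "j = 0" | "l = 0" | "0 < i" "0 < j" "0 < l" by auto
    then show False
    proof cases
      case 1 then show ?thesis using no_triple_cubic[of j l x] * e by (simp add: cubic_and_lines_def)
    next
      case 2 then show ?thesis using no_triple_cubic[of i l x] * e by (simp add: cubic_and_lines_def)
    next
      case 3 then show ?thesis using no_triple_cubic[of i j x] * e by (simp add: cubic_and_lines_def)
    next
      case 4
      then have d: "P i \<noteq> P j" "P j \<noteq> P l" "P i \<noteq> P l" using * by (intro slopes_distinct; simp)+
      have "poly (line (P i)) x = poly (line (P j)) x" "poly (line (P j)) x = poly (line (P l)) x"
        using 4 *(9) e by (simp_all add: cubic_and_lines_def)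
      then have "2 * x - 1 = - (P i + P j + 5) / 8" "2 * x - 1 = - (P j + P l + 5) / 8"
        using line_eq_iff[OF d(1), of x] line_eq_iff[OF d(2), of x] by blast+
      then have "P i = P l" by simp
      then show ?thesis using d(3) by blast
    qed
  qed
qed

lemma card_crossing_points:
  assumes ij: "i < j" "j < n"
  shows "card (crossing_points i j) = (if i = 0 \<and> j = k then 3 else 1)"
proof (cases "i = 0")
  case True
  show ?thesis
  proof (cases "j = k")
    case True
    have iff: "poly (h i) x = poly (h j) x \<longleftrightarrow> x \<in> {1/4, 1/2, 3/4}" for x
      using True \<open>i = 0\<close> k Pk wiggle_line_zero[of x] by (simp add: cubic_and_lines_def)
    have "crossing_points i j = {1/4, 1/2, 3/4}" unfolding crossing_points_def iff by auto
    then show ?thesis using True \<open>i = 0\<close> by simp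
  next
    case False
    then have "P j \<in> {1..11/10} \<or> P j \<in> {-13/10..-12/10}"
      using steep ij unfolding steep_def by (auto simp: image_subset_iff)
    from wiggle_line_root_unique(1)[OF this] show ?thesis
      using False True ij by (simp add: crossing_points_def cubic_and_lines_def)
  qed
next
  case False
  define x where "x = (1 - (P i + P j + 5) / 8) / 2"
  have ne: "P i \<noteq> P j" using slopes_distinct[of i j] False ij by simp
  have "2 * t - 1 = - (P i + P j + 5) / 8 \<longleftrightarrow> t = x" for t
    unfolding x_def by (simp add: field_simps)
  then have iff: "poly (h i) t = poly (h j) t \<longleftrightarrow> t = x" for t
    using False ij line_eq_iff[OF ne, of t] by (simp add: cubic_and_lines_def)
  have "0 < x" "x < 1"
    using slope_bounds[of i] slope_bounds[of j] False ij unfolding x_def by auto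
  then have "crossing_points i j = {x}" unfolding crossing_points_def iff by auto
  then show ?thesis using False by simp
qed

end

definition slope_offset :: "nat \<Rightarrow> real" where
  "slope_offset j = 1 / (10 * real (j + 1))"

lemma slope_offset:
  "i < j \<Longrightarrow> slope_offset j < slope_offset i" "0 < slope_offset j" "slope_offset j \<le> 1 / 10"
  by (auto simp: slope_offset_def divide_simps)

definition shallow_last :: "nat \<Rightarrow> nat \<Rightarrow> real" where
  "shallow_last n j = (if j = n - 1 then 0 else 1 + slope_offset j)"

definition shallow_first :: "nat \<Rightarrow> real" where
  "shallow_first j = (if j = 1 then 0 else - 13/10 + slope_offset j)"

lemma slopes_shallow_last:
  assumes "n \<ge> 2"
  shows "slopes n (n - 1) (shallow_last n)"
proof
  show "shallow_last n j < shallow_last n i" if "0 < i" "i < j" "j < n" for i j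
  proof -
    have "i \<noteq> n - 1" using that by linarith
    then show ?thesis using slope_offset(1)[OF that(2)] slope_offset(2)[of i] by (simp add: shallow_last_def)
  qed
  have "shallow_last n j \<in> {1..11/10}" if "j \<noteq> n - 1" for j
    using slope_offset(2,3)[of j] that by (simp add: shallow_last_def)
  then show "steep (shallow_last n ` ({1..<n} - {n - 1}))" unfolding steep_def by blast
qed (use assms in \<open>auto simp: shallow_last_def\<close>)

lemma slopes_shallow_first:
  assumes "n \<ge> 2"
  shows "slopes n 1 shallow_first"
proof
  show "shallow_first j < shallow_first i" if "0 < i" "i < j" "j < n" for i j
  proof -
    have "j \<noteq> 1" using that by linarith
    then show ?thesis using slope_offset(1)[OF that(2)] slope_offset(3)[of j] by (simp add: shallow_first_def)
  qed
  have "shallow_first j \<in> {-13/10..-12/10}" if "j \<noteq> 1" for j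
    using slope_offset(2,3)[of j] that by (simp add: shallow_first_def)
  then show "steep (shallow_first ` ({1..<n} - {1}))" unfolding steep_def by blast
qed (use assms in \<open>auto simp: shallow_first_def\<close>)

section \<open>Legendrian isotopies of arrangements\<close>

text \<open>
  Each interval between consecutive zeros is a hump of \<open>e\<close> or of \<open>- e\<close> and contributes once.
\<close>

lemma hump_integral_count:
  fixes e :: "real poly"
  assumes "a < b" "poly e a = 0" "poly e b = 0" "e \<noteq> 0"
  shows "\<forall>\<^sub>F \<epsilon> in at_right 0. \<forall>\<^sub>F \<kappa> in at_right 0.
    integral {a..b} (hump_form \<kappa> \<epsilon> e) + integral {a..b} (hump_form \<kappa> \<epsilon> (- e))
      = (step_height \<kappa>)\<^sup>2 * (card {x. a < x \<and> x < b \<and> poly e x = 0} + 1)"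
  using assms(1-3)
proof (induction "card {x. a < x \<and> x < b \<and> poly e x = 0}" arbitrary: a b rule: less_induct)
  case less
  have fin: "finite {x. poly e x = 0}" by (rule poly_roots_finite[OF \<open>e \<noteq> 0\<close>])
  show ?case
  proof (cases "{x. a < x \<and> x < b \<and> poly e x = 0} = {}")
    case True
    have "\<forall>\<^sub>F \<epsilon> in at_right 0. \<forall>\<^sub>F \<kappa> in at_right 0.
        integral {a..b} (hump_form \<kappa> \<epsilon> e) + integral {a..b} (hump_form \<kappa> \<epsilon> (- e)) = (step_height \<kappa>)\<^sup>2"
      by (rule constant_sign_integral[OF less.prems]) (use True in blast)
    then show ?thesis unfolding True by simp
  next
    case False
    then obtain z where z: "a < z" "z < b" "poly e z = 0" by blast
    define N where "N a b = {x. a < x \<and> x < b \<and> poly e x = 0}" for a b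
    have finN: "finite (N a b)" for a b by (rule finite_subset[OF _ fin]) (auto simp: N_def)
    have split: "N a b = insert z (N a z \<union> N z b)" using z by (auto simp: N_def)
    have "z \<notin> N a z \<union> N z b" "N a z \<inter> N z b = {}" by (auto simp: N_def)
    then have card: "card (N a b) = card (N a z) + card (N z b) + 1"
      unfolding split using finN by (simp add: card_Un_disjoint)
    have I: "integral {a..b} (hump_form \<kappa> \<epsilon> e) = integral {a..z} (hump_form \<kappa> \<epsilon> e) + integral {z..b} (hump_form \<kappa> \<epsilon> e)" for \<kappa> \<epsilon> e
      by (rule Henstock_Kurzweil_Integration.integral_combine[symmetric])
        (use z integrable_continuous_real[OF continuous_on_hump_form[OF continuous_on_id]] in auto)
    have "card (N a z) < card (N a b)" "card (N z b) < card (N a b)" using card by auto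
    from less.hyps[OF this(1)[unfolded N_def] z(1) less.prems(2) z(3)]
      less.hyps[OF this(2)[unfolded N_def] z(2,3) less.prems(3)]
    show ?thesis
    proof eventually_elim
      case (elim \<epsilon>)
      then show ?case
      proof eventually_elim
        case (elim \<kappa>)
        then show ?case using card unfolding I[of _ _ e] I[of _ _ "- e"] N_def by (simp add: algebra_simps)
      qed
    qed
  qed
qed

text \<open>
  A parametrised graph with the same underlying spatial graph runs along the same lifts, possibly
  renumbered. All its edges start at the same vertex, so either all of them or none are reversed.
\<close>

lemma edge_matching:
  assumes arr: "front_arrangement n h" and leg: "legendrian_theta n K"
    and eq: "spatial_edges n K = spatial_edges n (braid_theta h)" and n: "0 < n"
  obtains \<sigma> where "bij_betw \<sigma> {..<n} {..<n}" "\<And>i. i < n \<Longrightarrow> traces (end_weight * h (\<sigma> i)) (K i)"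
    "(\<forall>i<n. K i 0 = 0 \<and> K i 1 = pt 1 0 0) \<or> (\<forall>i<n. K i 0 = pt 1 0 0 \<and> K i 1 = 0)"
proof -
  interpret front_arrangement n h by fact
  have "\<exists>j<n. {K i 0, K i 1} = {0, pt 1 0 0} \<and> path_image (K i) = path_image (G j)" if "i < n" for i
  proof -
    have "({K i 0, K i 1}, path_image (K i)) \<in> spatial_edges n K"
      using that by (auto simp: spatial_edges_def pathstart_def pathfinish_def)
    then show ?thesis unfolding eq
      by (auto simp: spatial_edges_def pathstart_def pathfinish_def braid_theta_start braid_theta_finish)
  qed
  then obtain \<sigma> where \<sigma>: "\<And>i. i < n \<Longrightarrow> \<sigma> i < n" "\<And>i. i < n \<Longrightarrow> {K i 0, K i 1} = {0, pt 1 0 0}"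
    "\<And>i. i < n \<Longrightarrow> path_image (K i) = path_image (G (\<sigma> i))" by metis
  obtain v w where vw: "\<And>i. i < n \<Longrightarrow> K i 0 = v \<and> K i 1 = w"
    "\<And>i j. i < n \<Longrightarrow> j < n \<Longrightarrow> i \<noteq> j \<Longrightarrow> path_image (K i) \<inter> path_image (K j) = {v, w}"
    using leg unfolding legendrian_theta_def pathstart_def pathfinish_def by blast
  have "inj_on \<sigma> {..<n}"
  proof (rule inj_onI, rule ccontr)
    fix i j assume ij: "i \<in> {..<n}" "j \<in> {..<n}" "\<sigma> i = \<sigma> j" "i \<noteq> j"
    have "path_image (K i) = path_image (K j)" using \<sigma>(3) ij by auto
    then have "path_image (G (\<sigma> i)) = {0, pt 1 0 0}" using vw \<sigma> ij by (metis inf.idem lessThan_iff)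
    moreover have "G (\<sigma> i) (1/2) \<in> path_image (G (\<sigma> i))" by (simp add: path_image_def)
    ultimately have "G (\<sigma> i) (1/2) = 0 \<or> G (\<sigma> i) (1/2) = pt 1 0 0" by blast
    then have "G (\<sigma> i) (1/2) $ 1 = 0 \<or> G (\<sigma> i) (1/2) $ 1 = 1" by auto
    then show False by (simp add: braid_theta_def)
  qed
  moreover from this have "\<sigma> ` {..<n} = {..<n}"
    by (intro endo_inj_surj) (use \<sigma>(1) in auto)
  ultimately have bij: "bij_betw \<sigma> {..<n} {..<n}" unfolding bij_betw_def by blast
  have tr: "traces (end_weight * h (\<sigma> i)) (K i)" if "i < n" for i
    unfolding traces_def
  proof
    fix t :: real assume "t \<in> {0..1}"
    then have "K i t \<in> path_image (G (\<sigma> i))" using \<sigma>(3)[OF that] by (auto simp: path_image_def)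
    then obtain x where x: "x \<in> {0..1}" "K i t = G (\<sigma> i) x" by (auto simp: path_image_def)
    then have "K i t $ 1 = x" by (simp add: braid_theta_def)
    then show "K i t $ 1 \<in> {0..1} \<and> K i t = front_lift (end_weight * h (\<sigma> i)) (K i t $ 1)"
      using x by (simp add: braid_theta_def)
  qed
  have "{v, w} = {0, pt 1 0 0}" using \<sigma>(2)[OF n] vw(1)[OF n] by simp
  then have "(v = 0 \<and> w = pt 1 0 0) \<or> (v = pt 1 0 0 \<and> w = 0)" by (auto simp: doubleton_eq_iff)
  then show thesis using vw(1) that[OF bij tr] by blast
qed

lemma continuous_on_slices:
  fixes f :: "real \<Rightarrow> real \<Rightarrow> real"
  assumes "continuous_on ({0..1} \<times> {0..1}) (\<lambda>z. f (fst z) (snd z))" "e \<in> {0..1}"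
  shows "continuous_on {0..1} (\<lambda>s. f s e)" "continuous_on {0..1} (f e)"
proof -
  have "continuous_on {0..1} (\<lambda>s. (s, e))" "continuous_on {0..1} (\<lambda>s. (e, s))"
    by (intro continuous_intros)+
  from continuous_on_compose2[OF assms(1) this(1)] continuous_on_compose2[OF assms(1) this(2)]
  show "continuous_on {0..1} (\<lambda>s. f s e)" "continuous_on {0..1} (f e)"
    using assms(2) by (auto simp: image_subset_iff)
qed

locale theta_isotopy =
  fixes n :: nat and H :: "real \<Rightarrow> theta"
  assumes legendrian_H: "s \<in> {0..1} \<Longrightarrow> legendrian_theta n (H s)"
    and smooth_H: "i < n \<Longrightarrow> smooth_family (\<lambda>s. H s i)"
begin

lemma edge_arc: "s \<in> {0..1} \<Longrightarrow> i < n \<Longrightarrow> legendrian_arc (H s i)"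
  using legendrian_H unfolding legendrian_theta_def by blast

lemma edge_ends: "s \<in> {0..1} \<Longrightarrow> i < n \<Longrightarrow> j < n \<Longrightarrow> e = 0 \<or> e = 1 \<Longrightarrow> H s i e = H s j e"
  using legendrian_H unfolding legendrian_theta_def pathstart_def pathfinish_def by metis

lemma edge_inter: "s \<in> {0..1} \<Longrightarrow> i < n \<Longrightarrow> j < n \<Longrightarrow> i \<noteq> j \<Longrightarrow> path_image (H s i) \<inter> path_image (H s j) = {H s i 0, H s i 1}"
  using legendrian_H unfolding legendrian_theta_def pathstart_def pathfinish_def by metis

lemma edge_tangents: 
  assumes "s \<in> {0..1}" "i < n" "j < n" "i \<noteq> j" "e = 0 \<or> e = 1"
  shows "sgn (vel (H s i) e) \<noteq> sgn (vel (H s j) e)"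
proof -
  have "sgn (vel (H s i) 0) \<noteq> sgn (vel (H s j) 0)" "sgn (- vel (H s i) 1) \<noteq> sgn (- vel (H s j) 1)"
    using legendrian_H[OF assms(1)] assms(2-4) unfolding legendrian_theta_def by blast+
  then show ?thesis using assms(5) by (auto simp: sgn_minus)
qed

lemma edge_homotopy: "i < n \<Longrightarrow> \<exists>Ft Fl Flt. arc_homotopy (\<lambda>s. H s i) Ft Fl Flt"
  using smooth_family_arc_homotopy[OF smooth_H] by metis

lemma edge_velocity:
  assumes "s \<in> {0..1}" "i < n"
  shows "t \<in> {0..1} \<Longrightarrow> (H s i has_vector_derivative vel (H s i) t) (at t within {0..1})"
    and "continuous_on {0..1} (vel (H s i))"
proof -
  obtain Ft Fl Flt where "arc_homotopy (\<lambda>s. H s i) Ft Fl Flt" using edge_homotopy[OF assms(2)] by blast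
  then interpret arc_homotopy "\<lambda>s. H s i" Ft Fl Flt .
  show "(H s i has_vector_derivative vel (H s i) t) (at t within {0..1})" if "t \<in> {0..1}"
    using deriv(1)[OF assms(1) that] vel_eq[OF assms(1) that] by simp
  have "continuous_on {0..1} (\<lambda>t. Ft s t)" by (rule cont2) (use assms in \<open>auto intro: continuous_intros\<close>)
  then show "continuous_on {0..1} (vel (H s i))"
    by (rule continuous_on_eq) (use vel_eq[OF assms(1)] in simp)
qed

definition tangent_angles :: "(nat \<Rightarrow> real \<Rightarrow> real \<Rightarrow> real) \<Rightarrow> bool" where
  "tangent_angles \<theta> \<longleftrightarrow> (\<forall>i<n. continuous_on ({0..1} \<times> {0..1}) (\<lambda>z. \<theta> i (fst z) (snd z)) \<and>
     (\<forall>s\<in>{0..1}. \<forall>t\<in>{0..1}. \<exists>r>0. vel (H s i) t $ 1 = r * cos (\<theta> i s t) \<and> vel (H s i) t $ 2 = r * sin (\<theta> i s t)))"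

lemma tangent_angles_exist: "\<exists>\<theta>. tangent_angles \<theta>"
proof -
  have "\<exists>\<theta>. continuous_on ({0..1} \<times> {0..1}) (\<lambda>z. \<theta> (fst z) (snd z)) \<and>
     (\<forall>s\<in>{0..1}. \<forall>t\<in>{0..1}. \<exists>r>0. vel (H s i) t $ 1 = r * cos (\<theta> s t) \<and> vel (H s i) t $ 2 = r * sin (\<theta> s t))" if i: "i < n" for i
  proof -
    obtain Ft Fl Flt where hom: "arc_homotopy (\<lambda>s. H s i) Ft Fl Flt" using edge_homotopy[OF i] by blast
    obtain \<theta> r where "continuous_on ({0..1} \<times> {0..1}) (\<lambda>z. \<theta> (fst z) (snd z))"
      "\<And>s t. s \<in> {0..1} \<Longrightarrow> t \<in> {0..1} \<Longrightarrow> 0 < r s t \<and>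
         vel (H s i) t $ 1 = r s t * cos (\<theta> s t) \<and> vel (H s i) t $ 2 = r s t * sin (\<theta> s t)"
      by (rule angle_lift[OF hom edge_arc[OF _ i]]) (assumption | rule that)+
    then show ?thesis by blast
  qed
  then have "\<forall>i. \<exists>\<theta>. i < n \<longrightarrow> continuous_on ({0..1} \<times> {0..1}) (\<lambda>z. \<theta> (fst z) (snd z)) \<and>
     (\<forall>s\<in>{0..1}. \<forall>t\<in>{0..1}. \<exists>r>0. vel (H s i) t $ 1 = r * cos (\<theta> s t) \<and> vel (H s i) t $ 2 = r * sin (\<theta> s t))"
    by blast
  from choice[OF this] show ?thesis unfolding tangent_angles_def by blast
qed

text \<open>
  Whole turns from the tangent of edge \<open>j\<close> to that of edge \<open>i\<close> at the first vertex, minus those at the second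
  one. A change of either angle function by multiples of \<open>2 \<pi>\<close> cancels in the difference.
\<close>

definition relative_winding :: "(nat \<Rightarrow> real \<Rightarrow> real \<Rightarrow> real) \<Rightarrow> real \<Rightarrow> nat \<Rightarrow> nat \<Rightarrow> int" where
  "relative_winding \<theta> s i j = \<lfloor>(\<theta> i s 0 - \<theta> j s 0) / (2 * pi)\<rfloor> - \<lfloor>(\<theta> i s 1 - \<theta> j s 1) / (2 * pi)\<rfloor>"

text \<open>
  A jump of one of the two floors would need a moment when the two edges have the same tangent direction at a
  vertex.
\<close>

lemma relative_winding_constant:
  assumes \<theta>: "tangent_angles \<theta>" and ij: "i < n" "j < n" "i \<noteq> j"
  shows "relative_winding \<theta> 0 i j = relative_winding \<theta> 1 i j"
proof -
  have "\<lfloor>(\<theta> i 0 e - \<theta> j 0 e) / (2 * pi)\<rfloor> = \<lfloor>(\<theta> i 1 e - \<theta> j 1 e) / (2 * pi)\<rfloor>" if e: "e = 0 \<or> e = 1" for e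
  proof (rule floor_constant)
    have e01: "e \<in> {0..1}" using e by auto
    have "continuous_on {0..1} (\<lambda>s. \<theta> l s e)" if "l < n" for l
      using continuous_on_slices(1)[OF _ e01] \<theta> that unfolding tangent_angles_def by blast
    then show "continuous_on {0..1} (\<lambda>s. (\<theta> i s e - \<theta> j s e) / (2 * pi))"
      using ij by (intro continuous_intros) auto
    fix s :: real assume s: "s \<in> {0..1}"
    show "(\<theta> i s e - \<theta> j s e) / (2 * pi) \<notin> \<int>"
    proof
      assume "(\<theta> i s e - \<theta> j s e) / (2 * pi) \<in> \<int>"
      then obtain m :: int where "(\<theta> i s e - \<theta> j s e) / (2 * pi) = m" by (elim Ints_cases)
      then have "\<theta> i s e = \<theta> j s e + 2 * pi * m" by (simp add: field_simps)
      then have sc: "sin (\<theta> i s e) = sin (\<theta> j s e)" "cos (\<theta> i s e) = cos (\<theta> j s e)"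
        using sin_cos_eq_iff by metis+
      obtain r where r: "r > 0" "vel (H s i) e $ 1 = r * cos (\<theta> i s e)" "vel (H s i) e $ 2 = r * sin (\<theta> i s e)"
        using \<theta> ij s e01 unfolding tangent_angles_def by blast
      obtain r' where r': "r' > 0" "vel (H s j) e $ 1 = r' * cos (\<theta> j s e)" "vel (H s j) e $ 2 = r' * sin (\<theta> j s e)"
        using \<theta> ij s e01 unfolding tangent_angles_def by blast
      have "sgn (vel (H s i) e) = sgn (vel (H s j) e)"
      proof (rule xi_std_sgn_eq[of _ "H s i e" _ "r / r'"])
        show "vel (H s i) e \<in> xi_std (H s i e)"
          using edge_arc[OF s ij(1)] e01 unfolding legendrian_arc_def by blast
        have "vel (H s j) e \<in> xi_std (H s j e)"
          using edge_arc[OF s ij(2)] e01 unfolding legendrian_arc_def by blast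
        then show "vel (H s j) e \<in> xi_std (H s i e)" unfolding edge_ends[OF s ij(1,2) e] .
      qed (use r r' sc in auto)
      then show False using edge_tangents[OF s ij e] by blast
    qed
  qed
  from this[of 0] this[of 1] show ?thesis by (simp add: relative_winding_def)
qed

text \<open>
  The slopes of the tangents in the contact planes are \<open>2 h\<close>, and their order at one vertex is the reverse of that
  at the other. So exactly one of the two angle differences is positive modulo whole turns, and which one it is
  tells the order of the edges and the direction of travel.
\<close>

lemma relative_winding_end:
  assumes \<theta>: "tangent_angles \<theta>" and s: "s \<in> {0..1}" and arr: "front_arrangement n h"
    and \<sigma>: "bij_betw \<sigma> {..<n} {..<n}" "\<And>i. i < n \<Longrightarrow> traces (end_weight * h (\<sigma> i)) (H s i)"
    and dir: "(\<forall>i<n. H s i 0 = 0 \<and> H s i 1 = pt 1 0 0) \<or> (\<forall>i<n. H s i 0 = pt 1 0 0 \<and> H s i 1 = 0)"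
    and ij: "i < n" "j < n" "i \<noteq> j"
  shows "relative_winding \<theta> s i j = (if (\<sigma> j < \<sigma> i) = (H s 0 0 = 0) then 1 else - 1)"
proof -
  interpret front_arrangement n h by fact
  have x: "(H s i 0 $ 1 = 0 \<and> H s i 1 $ 1 = 1 \<and> H s j 0 $ 1 = 0 \<and> H s j 1 $ 1 = 1 \<and> H s 0 0 = 0) \<or>
    (H s i 0 $ 1 = 1 \<and> H s i 1 $ 1 = 0 \<and> H s j 0 $ 1 = 1 \<and> H s j 1 $ 1 = 0 \<and> H s 0 0 \<noteq> 0)"
    using dir ij by (auto simp: vec3_eq_iff)
  have ang: "\<exists>m::int. \<forall>e. e = 0 \<or> e = 1 \<longrightarrow> \<theta> k s e = arctan (2 * poly (h (\<sigma> k)) (H s k e $ 1)) + (if H s 0 0 = 0 then 0 else pi) + 2 * pi * m"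
    if k: "k \<in> {i, j}" for k
  proof -
    have kn: "k < n" using k ij by auto
    obtain r where r: "\<And>t. t \<in> {0..1} \<Longrightarrow> 0 < r t \<and> vel (H s k) t $ 1 = r t * cos (\<theta> k s t) \<and> vel (H s k) t $ 2 = r t * sin (\<theta> k s t)"
      using \<theta> kn s unfolding tangent_angles_def by metis
    have c: "continuous_on {0..1} (\<theta> k s)"
      using continuous_on_slices(2)[OF _ s] \<theta> kn unfolding tangent_angles_def by blast
    obtain m :: int where m: "\<And>t. t = 0 \<or> t = 1 \<Longrightarrow> \<theta> k s t = arctan (poly (pderiv (pderiv (end_weight * h (\<sigma> k)))) (H s k t $ 1))
        + (if H s k 0 $ 1 \<le> H s k 1 $ 1 then 0 else pi) + 2 * pi * m"
      by (rule traces_angle[OF \<sigma>(2)[OF kn] edge_velocity(1)[OF s kn] edge_velocity(2)[OF s kn] c r]) auto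
    have "(if H s k 0 $ 1 \<le> H s k 1 $ 1 then 0 else pi) = (if H s 0 0 = 0 then 0 else pi)"
      using x k by auto
    moreover have "poly (pderiv (pderiv (end_weight * h (\<sigma> k)))) (H s k t $ 1) = 2 * poly (h (\<sigma> k)) (H s k t $ 1)" if "t = 0 \<or> t = 1" for t
      by (rule poly_pderiv2_weighted_ends) (use x k that in auto)
    ultimately show ?thesis using m by (intro exI[of _ m]) auto
  qed
  obtain m1 :: int where m1: "\<And>e. e = 0 \<or> e = 1 \<Longrightarrow> \<theta> i s e = arctan (2 * poly (h (\<sigma> i)) (H s i e $ 1)) + (if H s 0 0 = 0 then 0 else pi) + 2 * pi * m1"
    using ang[of i] by blast
  obtain m2 :: int where m2: "\<And>e. e = 0 \<or> e = 1 \<Longrightarrow> \<theta> j s e = arctan (2 * poly (h (\<sigma> j)) (H s j e $ 1)) + (if H s 0 0 = 0 then 0 else pi) + 2 * pi * m2"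
    using ang[of j] by blast
  have \<sigma>n: "\<sigma> i < n" "\<sigma> j < n" "\<sigma> i \<noteq> \<sigma> j"
    using \<sigma>(1) ij by (auto simp: bij_betw_def inj_on_def)
  have fl: "\<lfloor>(\<theta> i s e - \<theta> j s e) / (2 * pi)\<rfloor> = (if poly (h (\<sigma> j)) (H s i e $ 1) < poly (h (\<sigma> i)) (H s i e $ 1) then m1 - m2 else m1 - m2 - 1)"
    if e: "e = 0 \<or> e = 1" for e
  proof -
    define a where "a = arctan (2 * poly (h (\<sigma> i)) (H s i e $ 1)) - arctan (2 * poly (h (\<sigma> j)) (H s i e $ 1))"
    have xx: "H s j e $ 1 = H s i e $ 1" "H s i e $ 1 = 0 \<or> H s i e $ 1 = 1" using x e by auto
    have "\<theta> i s e - \<theta> j s e = a + 2 * pi * (m1 - m2)"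
      using m1[OF e] m2[OF e] xx(1) by (simp add: a_def algebra_simps)
    moreover have "\<bar>a\<bar> < 2 * pi"
      using arctan_bounded[of "2 * poly (h (\<sigma> i)) (H s i e $ 1)"] arctan_bounded[of "2 * poly (h (\<sigma> j)) (H s i e $ 1)"] pi_gt_zero
      unfolding a_def by linarith
    moreover have "poly (h (\<sigma> i)) (H s i e $ 1) \<noteq> poly (h (\<sigma> j)) (H s i e $ 1)"
      using ends_distinct[OF \<sigma>n] xx(2) by auto
    then have "a \<noteq> 0" by (simp add: a_def arctan_eq_iff)
    moreover have "0 < a \<longleftrightarrow> poly (h (\<sigma> j)) (H s i e $ 1) < poly (h (\<sigma> i)) (H s i e $ 1)"
      by (simp add: a_def arctan_less_iff)
    ultimately show ?thesis using floor_angle_difference[of a "m1 - m2"] by simp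
  qed
  have "\<sigma> i < \<sigma> j \<or> \<sigma> j < \<sigma> i" using \<sigma>n by auto
  then show ?thesis
    unfolding relative_winding_def fl[of 0, simplified] fl[of 1, simplified]
    using x left_order[of "\<sigma> i" "\<sigma> j"] left_order[of "\<sigma> j" "\<sigma> i"] right_order[of "\<sigma> i" "\<sigma> j"] right_order[of "\<sigma> j" "\<sigma> i"] \<sigma>n
    by auto
qed

lemma linking_constant:
  assumes ij: "i < n" "j < n" "i \<noteq> j"
  shows "\<forall>\<^sub>F \<epsilon> in at_right 0. \<forall>\<^sub>F \<kappa> in at_right 0.
    push_off_linking \<kappa> \<epsilon> (H 0 i) (H 0 j) = push_off_linking \<kappa> \<epsilon> (H 1 i) (H 1 j)"
proof -
  obtain At Al Alt where hA: "arc_homotopy (\<lambda>s. H s i) At Al Alt" using edge_homotopy[OF ij(1)] by blast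
  obtain Bt Bl Blt where hB: "arc_homotopy (\<lambda>s. H s j) Bt Bl Blt" using edge_homotopy[OF ij(2)] by blast
  have AA: "\<forall>\<^sub>F \<epsilon> in at_right 0. \<forall>l\<in>{0..1}. \<forall>s\<in>{0..1}. \<forall>t\<in>{0..1}. H l i s - H l i t + pt 0 0 \<epsilon> \<noteq> 0"
    by (rule no_short_chords_arc[OF hA edge_arc[OF _ ij(1)]])
  have BB: "\<forall>\<^sub>F \<epsilon> in at_right 0. \<forall>l\<in>{0..1}. \<forall>s\<in>{0..1}. \<forall>t\<in>{0..1}. H l j s - H l j t + pt 0 0 \<epsilon> \<noteq> 0"
    by (rule no_short_chords_arc[OF hB edge_arc[OF _ ij(2)]])
  have AB: "\<forall>\<^sub>F \<epsilon> in at_right 0. \<forall>l\<in>{0..1}. \<forall>s\<in>{0..1}. \<forall>t\<in>{0..1}. H l i s - H l j t + pt 0 0 \<epsilon> \<noteq> 0"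
    by (rule no_short_chords_between[OF hA hB edge_arc[OF _ ij(1)] edge_arc[OF _ ij(2)] edge_ends[OF _ ij(1,2)] _ edge_tangents[OF _ ij]])
       (use edge_inter[OF _ ij] in auto)
  have BA: "\<forall>\<^sub>F \<epsilon> in at_right 0. \<forall>l\<in>{0..1}. \<forall>s\<in>{0..1}. \<forall>t\<in>{0..1}. H l j s - H l i t + pt 0 0 \<epsilon> \<noteq> 0"
    by (rule no_short_chords_between[OF hB hA edge_arc[OF _ ij(2)] edge_arc[OF _ ij(1)] edge_ends[OF _ ij(2,1)] _ edge_tangents[OF _ ij(2,1) ij(3)[symmetric]]])
       (use edge_inter[OF _ ij(2,1) ij(3)[symmetric]] in auto)
  from AA AB BA BB show ?thesis
  proof eventually_elim
    case (elim \<epsilon>)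
    show ?case
      by (rule push_off_linking_homotopy_eventually[OF hA hB edge_ends[OF _ ij(1,2)] edge_ends[OF _ ij(1,2)]])
         (use elim in auto)
  qed
qed

lemma linking_end:
  assumes s: "s \<in> {0..1}" and arr: "front_arrangement n h"
    and \<sigma>: "bij_betw \<sigma> {..<n} {..<n}" "\<And>i. i < n \<Longrightarrow> traces (end_weight * h (\<sigma> i)) (H s i)"
    and dir: "(\<forall>i<n. H s i 0 = 0 \<and> H s i 1 = pt 1 0 0) \<or> (\<forall>i<n. H s i 0 = pt 1 0 0 \<and> H s i 1 = 0)"
    and ij: "i < n" "j < n" "i \<noteq> j"
  shows "\<forall>\<^sub>F \<epsilon> in at_right 0. \<forall>\<^sub>F \<kappa> in at_right 0. push_off_linking \<kappa> \<epsilon> (H s i) (H s j)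
    = - (step_height \<kappa> ^ 3 * (card (front_arrangement.crossing_points h (\<sigma> i) (\<sigma> j)) + 1))"
proof -
  interpret front_arrangement n h by fact
  define f where "f = end_weight * h (\<sigma> i)"
  define g where "g = end_weight * h (\<sigma> j)"
  have \<sigma>n: "\<sigma> i < n" "\<sigma> j < n" "\<sigma> i \<noteq> \<sigma> j"
    using \<sigma>(1) ij by (auto simp: bij_betw_def inj_on_def)
  have d: "poly (f - g) x = (x * (1 - x))\<^sup>2 * (poly (h (\<sigma> i)) x - poly (h (\<sigma> j)) x)" for x
    by (simp add: f_def g_def poly_end_weight algebra_simps)
  have d0: "poly (f - g) 0 = 0" "poly (f - g) 1 = 0" unfolding d by simp_all
  have "end_weight \<noteq> 0"
  proof
    assume "end_weight = 0"
    then have "poly end_weight (1/2) = 0" by simp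
    then show False by (simp add: poly_end_weight)
  qed
  then have ne: "f - g \<noteq> 0" using h_inj[OF \<sigma>n] by (simp add: f_def g_def)
  have nz: "pderiv (f - g) \<noteq> 0"
  proof
    assume "pderiv (f - g) = 0"
    then obtain c where "f - g = [:c:]" using pderiv_iszero by blast
    then show False using d0(1) ne by auto
  qed
  have roots: "{x. 0 < x \<and> x < 1 \<and> poly (f - g) x = 0} = crossing_points (\<sigma> i) (\<sigma> j)"
    unfolding crossing_points_def d by auto
  have ends: "(H s i 0 $ 1 = 0 \<and> H s i 1 $ 1 = 1 \<and> H s j 0 $ 1 = 0 \<and> H s j 1 $ 1 = 1) \<or>
     (H s i 0 $ 1 = 1 \<and> H s i 1 $ 1 = 0 \<and> H s j 0 $ 1 = 1 \<and> H s j 1 $ 1 = 0)"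
    using dir ij by auto
  have fg: "poly f x = poly g x" "poly (pderiv f) x = poly (pderiv g) x" if "x = 0 \<or> x = 1" for x
    using that d0 unfolding f_def g_def poly_pderiv_weighted by auto
  have "\<forall>\<^sub>F \<epsilon> in at_right 0. \<forall>\<^sub>F \<kappa> in at_right 0. push_off_linking \<kappa> \<epsilon> (H s i) (H s j)
     = - step_height \<kappa> * (integral {0..1} (hump_form \<kappa> \<epsilon> (f - g)) + integral {0..1} (hump_form \<kappa> \<epsilon> (- (f - g))))"
    by (rule push_off_linking_of_traces[OF \<sigma>(2)[OF ij(1), folded f_def] \<sigma>(2)[OF ij(2), folded g_def]
        edge_velocity[OF s ij(1)] edge_velocity[OF s ij(2)] ends _ _ nz]) (assumption | rule fg)+
  from this hump_integral_count[OF zero_less_one d0 ne] show ?thesis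
  proof eventually_elim
    case (elim \<epsilon>)
    then show ?case
    proof eventually_elim
      case (elim \<kappa>)
      show ?case unfolding elim(1) elim(2) roots by (simp add: power2_eq_square power3_eq_cube)
    qed
  qed
qed

end

text \<open>
  Constancy of the relative windings forces the matching of the edges to be monotone, increasing or
  decreasing. It therefore maps the pair of extreme edges to itself, and the linking integral of this
  cycle determines the number of its crossings.
\<close>

theorem isotopic_crossing_number_of_extreme_edges:
  assumes arr: "front_arrangement n h" "front_arrangement n h'" and n: "2 \<le> n"
    and iso: "legendrian_isotopic n (braid_theta h) (braid_theta h')"
  shows "card (front_arrangement.crossing_points h 0 (n - 1)) = card (front_arrangement.crossing_points h' 0 (n - 1))"
proof -
  obtain H where H: "\<And>s. s \<in> {0..1} \<Longrightarrow> legendrian_theta n (H s)" "\<And>i. i < n \<Longrightarrow> smooth_family (\<lambda>s. H s i)"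
    "spatial_edges n (H 0) = spatial_edges n (braid_theta h)" "spatial_edges n (H 1) = spatial_edges n (braid_theta h')"
    using iso unfolding legendrian_isotopic_def by blast
  interpret theta_isotopy n H by standard (use H in auto)
  have n0: "0 < n" using n by simp
  have s01: "0 \<in> {0..1::real}" "1 \<in> {0..1::real}" by auto
  obtain \<sigma> where \<sigma>: "bij_betw \<sigma> {..<n} {..<n}" "\<And>i. i < n \<Longrightarrow> traces (end_weight * h (\<sigma> i)) (H 0 i)"
    "(\<forall>i<n. H 0 i 0 = 0 \<and> H 0 i 1 = pt 1 0 0) \<or> (\<forall>i<n. H 0 i 0 = pt 1 0 0 \<and> H 0 i 1 = 0)"
    by (rule edge_matching[OF arr(1) legendrian_H[OF s01(1)] H(3) n0]) (assumption | rule that)+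
  obtain \<tau> where \<tau>: "bij_betw \<tau> {..<n} {..<n}" "\<And>i. i < n \<Longrightarrow> traces (end_weight * h' (\<tau> i)) (H 1 i)"
    "(\<forall>i<n. H 1 i 0 = 0 \<and> H 1 i 1 = pt 1 0 0) \<or> (\<forall>i<n. H 1 i 0 = pt 1 0 0 \<and> H 1 i 1 = 0)"
    by (rule edge_matching[OF arr(2) legendrian_H[OF s01(2)] H(4) n0]) (assumption | rule that)+
  obtain \<theta> where \<theta>: "tangent_angles \<theta>" using tangent_angles_exist by blast
  \<comment> \<open>whether the isotopy keeps or exchanges the two vertices, relative to the given parametrisations\<close>
  define same where "same \<longleftrightarrow> (H 0 0 0 = 0) = (H 1 0 0 = 0)"
  have order: "(\<sigma> j < \<sigma> i) = (\<tau> j < \<tau> i) \<longleftrightarrow> same" if ij: "i < n" "j < n" "i \<noteq> j" for i j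
    using relative_winding_constant[OF \<theta> ij] relative_winding_end[OF \<theta> s01(1) arr(1) \<sigma> ij]
      relative_winding_end[OF \<theta> s01(2) arr(2) \<tau> ij] unfolding same_def by (auto split: if_splits)
  have \<sigma>s: "\<sigma> ` {..<n} = {..<n}" "inj_on \<sigma> {..<n}" and \<tau>s: "\<tau> ` {..<n} = {..<n}" "inj_on \<tau> {..<n}"
    using \<sigma>(1) \<tau>(1) by (auto simp: bij_betw_def)
  have "0 \<in> \<sigma> ` {..<n}" "n - 1 \<in> \<sigma> ` {..<n}" using \<sigma>s n0 by auto
  then obtain i j where i: "i < n" "\<sigma> i = 0" and j: "j < n" "\<sigma> j = n - 1" by auto
  have ij: "i \<noteq> j" using i j n by auto
  have \<sigma>b: "\<sigma> l < n" and \<tau>b: "\<tau> l < n" if "l < n" for l using \<sigma>s \<tau>s that by blast+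
  have \<sigma>ne: "\<sigma> l \<noteq> \<sigma> l'" and \<tau>ne: "\<tau> l \<noteq> \<tau> l'" if "l < n" "l' < n" "l \<noteq> l'" for l l'
    using \<sigma>s \<tau>s that by (auto simp: inj_on_def)
  have "0 \<in> \<tau> ` {..<n}" "n - 1 \<in> \<tau> ` {..<n}" using \<tau>s n0 by auto
  then obtain a b where a: "a < n" "\<tau> a = 0" and b: "b < n" "\<tau> b = n - 1" by auto
  have "\<tau> i = 0 \<and> \<tau> j = n - 1 \<or> \<tau> i = n - 1 \<and> \<tau> j = 0"
  proof (cases same)
    case True
    have "a = i"
    proof (rule ccontr)
      assume "a \<noteq> i"
      then have "(\<sigma> a < \<sigma> i) = (\<tau> a < \<tau> i)" using order[of i a] True a i by simp
      then show False using \<tau>ne[of a i] a i \<open>a \<noteq> i\<close> by simp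
    qed
    moreover have "b = j"
    proof (rule ccontr)
      assume "b \<noteq> j"
      then have "(\<sigma> j < \<sigma> b) = (\<tau> j < \<tau> b)" using order[of b j] True b j by simp
      moreover have "\<not> \<sigma> j < \<sigma> b" using \<sigma>b[of b] b j by simp
      moreover have "\<tau> j < \<tau> b" using \<tau>ne[of b j] \<tau>b[of j] b j \<open>b \<noteq> j\<close> by linarith
      ultimately show False by blast
    qed
    ultimately show ?thesis using a b by blast
  next
    case False
    have "b = i"
    proof (rule ccontr)
      assume "b \<noteq> i"
      then have "(\<sigma> b < \<sigma> i) \<noteq> (\<tau> b < \<tau> i)" using order[of i b] False b i by simp
      moreover have "\<not> \<sigma> b < \<sigma> i" using i by simp
      moreover have "\<not> \<tau> b < \<tau> i" using \<tau>b[of i] b i by simp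
      ultimately show False by blast
    qed
    moreover have "a = j"
    proof (rule ccontr)
      assume "a \<noteq> j"
      then have "(\<sigma> j < \<sigma> a) \<noteq> (\<tau> j < \<tau> a)" using order[of a j] False a j by simp
      moreover have "\<not> \<sigma> j < \<sigma> a" using \<sigma>b[of a] a j by simp
      moreover have "\<not> \<tau> j < \<tau> a" using a by simp
      ultimately show False by blast
    qed
    ultimately show ?thesis using a b by blast
  qed
  moreover have "front_arrangement.crossing_points h' x y = front_arrangement.crossing_points h' y x" for x y
    unfolding front_arrangement.crossing_points_def[OF arr(2)] by auto
  ultimately have cp: "front_arrangement.crossing_points h' (\<tau> i) (\<tau> j) = front_arrangement.crossing_points h' 0 (n - 1)"
    by metis
  define c where "c = card (front_arrangement.crossing_points h 0 (n - 1))"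
  define c' where "c' = card (front_arrangement.crossing_points h' 0 (n - 1))"
  have L0: "\<forall>\<^sub>F \<epsilon> in at_right 0. \<forall>\<^sub>F \<kappa> in at_right 0.
      push_off_linking \<kappa> \<epsilon> (H 0 i) (H 0 j) = - (step_height \<kappa> ^ 3 * real (c + 1))"
    unfolding c_def i(2)[symmetric] j(2)[symmetric]
    by (rule linking_end[OF s01(1) arr(1) \<sigma>(1) _ \<sigma>(3) i(1) j(1) ij]) (rule \<sigma>(2))
  have L1: "\<forall>\<^sub>F \<epsilon> in at_right 0. \<forall>\<^sub>F \<kappa> in at_right 0.
      push_off_linking \<kappa> \<epsilon> (H 1 i) (H 1 j) = - (step_height \<kappa> ^ 3 * real (c' + 1))"
    unfolding c'_def cp[symmetric]
    by (rule linking_end[OF s01(2) arr(2) \<tau>(1) _ \<tau>(3) i(1) j(1) ij]) (rule \<tau>(2))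
  have "\<forall>\<^sub>F \<epsilon> in at_right (0::real). \<forall>\<^sub>F \<kappa> in at_right 0. step_height \<kappa> ^ 3 * real (c + 1) = step_height \<kappa> ^ 3 * real (c' + 1) \<and> 0 < \<kappa>"
    using linking_constant[OF i(1) j(1) ij] L0 L1
  proof eventually_elim
    case (elim \<epsilon>)
    have "\<forall>\<^sub>F \<kappa> in at_right (0::real). 0 < \<kappa> \<and> \<kappa> < 1" by (rule eventually_at_right_less) simp
    with elim show ?case
      by eventually_elim simp
  qed
  then have "\<forall>\<^sub>F \<kappa> in at_right (0::real). step_height \<kappa> ^ 3 * real (c + 1) = step_height \<kappa> ^ 3 * real (c' + 1) \<and> 0 < \<kappa>"
    by simp
  from eventually_happens'[OF _ this] obtain \<kappa> :: real where "0 < \<kappa>" "step_height \<kappa> ^ 3 * real (c + 1) = step_height \<kappa> ^ 3 * real (c' + 1)"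
    by auto
  then have "real c = real c'" using step_height_pos[of \<kappa>] by simp
  then show ?thesis by (simp add: c_def c'_def)
qed

section \<open>Equal invariants, different Legendrian classes\<close>

text \<open>
  The cycle with three crossings comes first, so that the lists of invariants do not depend on \<open>k\<close>.
\<close>

definition standard_cycles :: "nat \<Rightarrow> nat \<Rightarrow> (nat \<times> nat) list" where
  "standard_cycles n k = (0, k) # filter (\<lambda>c. c \<noteq> (0, k)) [(i, j). i \<leftarrow> [0..<n], j \<leftarrow> [Suc i..<n]]"

lemma set_standard_cycles:
  assumes "0 < k" "k < n"
  shows "set (standard_cycles n k) = {(i, j). i < j \<and> j < n}"
  using assms by (auto simp: standard_cycles_def image_iff)

lemma distinct_standard_cycles: "distinct (standard_cycles n k)"
proof -
  have "distinct [(i, j). i \<leftarrow> xs, j \<leftarrow> [Suc i..<n]]" if "distinct xs" for xs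
    using that by (induction xs) (auto simp: distinct_map inj_on_def)
  then show ?thesis by (simp add: standard_cycles_def)
qed

lemma oriented_cycle_order_standard_cycles:
  assumes k: "0 < k" "k < n"
  shows "oriented_cycle_order n (standard_cycles n k)"
proof -
  have inj: "inj_on (\<lambda>(i, j). {i, j}) {(i :: nat, j). i < j \<and> j < n}"
    by (auto simp: inj_on_def doubleton_eq_iff)
  have img: "(\<lambda>(i, j). {i, j}) ` {(i :: nat, j). i < j \<and> j < n} = {{i, j} | i j. i < n \<and> j < n \<and> i \<noteq> j}"
  proof (intro equalityI subsetI)
    fix A assume "A \<in> {{i, j} | i j. i < n \<and> j < n \<and> i \<noteq> j}"
    then obtain i j where "A = {i, j}" "i < n" "j < n" "i \<noteq> j" by blast
    then show "A \<in> (\<lambda>(i, j). {i, j}) ` {(i :: nat, j). i < j \<and> j < n}"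
      by (cases "i < j") (auto intro: image_eqI[of _ _ "(i, j)"] image_eqI[of _ _ "(j, i)"])
  next
    fix A assume "A \<in> (\<lambda>(i, j). {i, j}) ` {(i :: nat, j). i < j \<and> j < n}"
    then obtain i j where "A = {i, j}" "i < j" "j < n" by auto
    moreover from this have "i < n" "i \<noteq> j" by auto
    ultimately show "A \<in> {{i, j} | i j. i < n \<and> j < n \<and> i \<noteq> j}" by blast
  qed
  show ?thesis
    unfolding oriented_cycle_order_def distinct_map set_map set_standard_cycles[OF k]
    by (intro conjI distinct_standard_cycles inj img)
qed

lemma length_standard_cycles:
  assumes "0 < k" "k < n"
  shows "length (standard_cycles n k) = card {(i, j). i < j \<and> j < n}"
  using distinct_card[OF distinct_standard_cycles[of n k]] set_standard_cycles[OF assms] by simp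

context slopes begin

lemma invariants_standard_cycles:
  "tb_list G (standard_cycles n k) = -4 # replicate (card {(i, j). i < j \<and> j < n} - 1) (-2)"
  "rot_list G (standard_cycles n k) = replicate (card {(i, j). i < j \<and> j < n}) 1"
proof -
  obtain cs where cs: "standard_cycles n k = (0, k) # cs" by (simp add: standard_cycles_def)
  have mem: "fst c < snd c \<and> snd c < n" if "c \<in> set (standard_cycles n k)" for c
    using that unfolding set_standard_cycles[OF k] by auto
  have tail: "c \<noteq> (0, k)" "fst c < snd c" "snd c < n" if "c \<in> set cs" for c
    using mem[of c] that distinct_standard_cycles[of n k] unfolding cs by auto
  have "tb (theta_cycle G c) = -2" if "c \<in> set cs" for c
    using tb_cycle[of "fst c" "snd c"] card_crossing_points[of "fst c" "snd c"] tail[OF that]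
    by (cases c) auto
  then have "map (\<lambda>c. tb (theta_cycle G c)) cs = replicate (length cs) (-2)"
    by (auto simp: map_eq_conv map_replicate_const[symmetric])
  moreover have "tb (theta_cycle G (0, k)) = -4"
    using tb_cycle[of 0 k] card_crossing_points[of 0 k] k by simp
  moreover have "length cs = card {(i, j). i < j \<and> j < n} - 1"
    using length_standard_cycles[OF k] unfolding cs by simp
  ultimately show "tb_list G (standard_cycles n k) = -4 # replicate (card {(i, j). i < j \<and> j < n} - 1) (-2)"
    by (simp add: tb_list_def cs)
  have "rot (theta_cycle G c) = 1" if "c \<in> set (standard_cycles n k)" for c
    using rot_cycle[of "fst c" "snd c"] mem[OF that] by simp
  then have "rot_list G (standard_cycles n k) = replicate (length (standard_cycles n k)) 1"
    unfolding rot_list_def by (auto simp: map_eq_conv map_replicate_const[symmetric])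
  then show "rot_list G (standard_cycles n k) = replicate (card {(i, j). i < j \<and> j < n}) 1"
    by (simp add: length_standard_cycles[OF k])
qed

end

theorem corollary8:
  fixes n :: nat
  assumes "n \<ge> 3"
  shows "\<exists>G G' :: theta.
    legendrian_theta n G \<and> legendrian_theta n G' \<and>
    topologically_planar (support n G) \<and> topologically_planar (support n G') \<and>
    generic_front n G \<and> generic_front n G' \<and>
    (\<exists>cs cs'. oriented_cycle_order n cs \<and> oriented_cycle_order n cs' \<and>
       tb_list G cs = tb_list G' cs' \<and> rot_list G cs = rot_list G' cs') \<and>
    \<not> legendrian_isotopic n G G'"
proof -
  have n2: "n \<ge> 2" using assms by simp
  interpret A: slopes n "n - 1" "shallow_last n" by (rule slopes_shallow_last[OF n2])
  interpret B: slopes n 1 shallow_first by (rule slopes_shallow_first[OF n2])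
  let ?cs = "standard_cycles n (n - 1)" and ?cs' = "standard_cycles n 1"
  have "card (A.crossing_points 0 (n - 1)) = 3" "card (B.crossing_points 0 (n - 1)) = 1"
    using A.card_crossing_points[of 0 "n - 1"] B.card_crossing_points[of 0 "n - 1"] assms by auto
  then have "\<not> legendrian_isotopic n A.G B.G"
    using isotopic_crossing_number_of_extreme_edges[OF A.front_arrangement_axioms B.front_arrangement_axioms n2] by auto
  moreover have "oriented_cycle_order n ?cs" "oriented_cycle_order n ?cs'"
    using assms by (auto intro: oriented_cycle_order_standard_cycles)
  moreover have "tb_list A.G ?cs = tb_list B.G ?cs'" "rot_list A.G ?cs = rot_list B.G ?cs'"
    by (simp_all only: A.invariants_standard_cycles B.invariants_standard_cycles)
  ultimately show ?thesis
    using A.legendrian B.legendrian A.planar B.planar A.generic B.generic by blast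
qed

end
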